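(* Let $\varphi$ be a nonconstant linear-fractional selfmap of the open unit disk $\mathbb{D}$ with Denjoy-Wolff point $w$ (so $w\in\overline{\mathbb{D}}$), and let $C_\varphi : H^2\to H^2$ be the induced composition operator. Then $C_\varphi$ is posinormal if and only if one of the following is true: (1) $\varphi$ is an automorphism of $\mathbb{D}$ (so that $C_\varphi$ is invertible); (2) $w\in\mathbb{D}$ and $\varphi(z)=\tau(\alpha\,\tau(z))$ for some $\alpha\in\mathbb{C}$ with $|\alpha|<1$ and $|w|<|\alpha|$, where $\tau(z)=\frac{w-z}{1-\overline{w}z}$; (3) $|w|=1$, $\varphi'(w)=1$, and $\varphi(\beta)=0$ for some $\beta\in\mathbb{D}$; (4) $\varphi$ has one fixed point in $\mathbb{D}$ and one on $\partial\mathbb{D}$, and $\varphi(\beta)=0$ for some $\beta\in\mathbb{D}$. Furthermore, $C_\varphi$ is coposinormal if and only if one of the following is true: (1') $\varphi$ is an automorphism of $\mathbb{D}$ (so that $C_\varphi$ is invertible); (2') the Denjoy-Wolff point $w$ of $\varphi$ is on $\partial\mathbb{D}$; (3') $w\in\mathbb{D}$ and $\varphi(z)=\tau(\alpha\,\tau(z))$ for some $\alpha\in\mathbb{C}$ with $0<|\alpha|<1$, where $\tau(z)=\frac{w-z}{1-\overline{w}z}$.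
   Context: $H^2$ is the Hilbert space of analytic functions $f(z)=\sum_{n\ge 0}a_nz^n$ on the open unit disk $\mathbb{D}$ with $\|f\|^2=\sum|a_n|^2<\infty$. For an analytic selfmap $\varphi$ of $\mathbb{D}$, $C_\varphi f=f\circ\varphi$ is the composition operator, which is bounded on $H^2$. A linear-fractional selfmap of $\mathbb{D}$ is a map $\varphi(z)=\frac{az+b}{cz+d}$ with $\varphi(\mathbb{D})\subseteq\mathbb{D}$, regarded also as a map of the extended complex plane. The Denjoy-Wolff point of an analytic selfmap of $\mathbb{D}$ (other than an elliptic automorphism) is its unique attracting fixed point in $\overline{\mathbb{D}}$, to which the iterates of $\varphi$ converge uniformly on compact subsets of $\mathbb{D}$. A bounded linear operator $A$ on a Hilbert space is posinormal if there is a positive operator $P$ with $AA^*=A^*PA$ (equivalently, $\operatorname{ran}A\subseteq\operatorname{ran}A^*$); $A$ is coposinormal if $A^*$ is posinormal. *)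

theory Defs
  imports "HOL-Complex_Analysis.Complex_Analysis"
begin

class complex_hilbert_space = real_inner + complete_space +
  fixes scaleC :: "complex \<Rightarrow> 'a \<Rightarrow> 'a"  (infixr \<open>*\<^sub>C\<close> 75)
    and cinner :: "'a \<Rightarrow> 'a \<Rightarrow> complex"
  assumes scaleC_add_right: "c *\<^sub>C (x + y) = c *\<^sub>C x + c *\<^sub>C y"
    and scaleC_add_left: "(b + c) *\<^sub>C x = b *\<^sub>C x + c *\<^sub>C x"
    and scaleC_scaleC: "b *\<^sub>C (c *\<^sub>C x) = (b * c) *\<^sub>C x"
    and scaleR_scaleC: "r *\<^sub>R x = complex_of_real r *\<^sub>C x"
    and cinner_add_left: "cinner (x + y) z = cinner x z + cinner y z"
    and cinner_scaleC_left: "cinner (c *\<^sub>C x) y = c * cinner x y"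
    and cinner_commute: "cinner x y = cnj (cinner y x)"
    and inner_eq_Re_cinner: "inner x y = Re (cinner x y)"

definition bounded_clinear :: "('a::complex_hilbert_space \<Rightarrow> 'b::complex_hilbert_space) \<Rightarrow> bool"
  where "bounded_clinear A \<longleftrightarrow> bounded_linear A \<and> (\<forall>c x. A (c *\<^sub>C x) = c *\<^sub>C A x)"

definition cadjoint ::
    "('a::complex_hilbert_space \<Rightarrow> 'b::complex_hilbert_space) \<Rightarrow> 'b \<Rightarrow> 'a"
  where "cadjoint A = (THE B. \<forall>x y. cinner (A x) y = cinner x (B y))"

definition invertible_operator :: "('a::complex_hilbert_space \<Rightarrow> 'a) \<Rightarrow> bool"
  where "invertible_operator A \<longleftrightarrow>
    bounded_clinear A \<and> (\<exists>B. bounded_clinear B \<and> A \<circ> B = id \<and> B \<circ> A = id)"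

definition positive_operator :: "('a::complex_hilbert_space \<Rightarrow> 'a) \<Rightarrow> bool"
  where "positive_operator P \<longleftrightarrow>
    bounded_clinear P \<and> (\<forall>x. cinner (P x) x \<in> \<real>\<^sub>\<ge>\<^sub>0)"

definition posinormal :: "('a::complex_hilbert_space \<Rightarrow> 'a) \<Rightarrow> bool"
  where "posinormal A \<longleftrightarrow> bounded_clinear A \<and>
    (\<exists>P. positive_operator P \<and> A \<circ> cadjoint A = cadjoint A \<circ> P \<circ> A)"

definition coposinormal :: "('a::complex_hilbert_space \<Rightarrow> 'a) \<Rightarrow> bool"
  where "coposinormal A \<longleftrightarrow> bounded_clinear A \<and> posinormal (cadjoint A)"

definition taylor_coeff :: "(complex \<Rightarrow> complex) \<Rightarrow> nat \<Rightarrow> complex"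
  where "taylor_coeff f n = fps_nth (fps_expansion f 0) n"

(* HOL functions are total: elements of H^2 are set to 0 off the disk, so that equality in the
   type hardy2 is equality of functions on the disk. *)
definition hardy2_set :: "(complex \<Rightarrow> complex) set"
  where "hardy2_set = {f. f holomorphic_on ball 0 1 \<and>
    summable (\<lambda>n. (cmod (taylor_coeff f n))\<^sup>2) \<and> (\<forall>z. z \<notin> ball 0 1 \<longrightarrow> f z = 0)}"

lemma hardy2_sums:
  assumes "f \<in> hardy2_set" "z \<in> ball 0 1"
  shows "(\<lambda>n. taylor_coeff f n * z ^ n) sums f z"
  using holomorphic_power_series[of f 0 1 z] assms
  by (simp add: hardy2_set_def taylor_coeff_def fps_expansion_def)

lemma taylor_coeff_unique:
  assumes "\<And>z. z \<in> ball 0 1 \<Longrightarrow> (\<lambda>n. a n * z ^ n) sums f z"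
  shows "f holomorphic_on ball 0 1" "taylor_coeff f n = a n"
proof -
  show "f holomorphic_on ball 0 1"
    by (rule power_series_holomorphic[where a = a]) (use assms in auto)
  have "eventually (\<lambda>z::complex. z \<in> ball 0 1) (nhds 0)"
    by (rule eventually_nhds_in_open) auto
  then have "eventually (\<lambda>z. (\<lambda>n. fps_nth (Abs_fps a) n * z ^ n) sums f z) (nhds 0)"
    by eventually_elim (use assms in auto)
  then have "f has_fps_expansion Abs_fps a"
    by (rule has_fps_expansionI)
  then have "fps_expansion f 0 = Abs_fps a"
    by (rule fps_expansion_eqI)
  then show "taylor_coeff f n = a n"
    by (simp add: taylor_coeff_def)
qed

lemma hardy2_setI:
  assumes "\<And>z. z \<in> ball 0 1 \<Longrightarrow> (\<lambda>n. a n * z ^ n) sums f z"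
    and "summable (\<lambda>n. (cmod (a n))\<^sup>2)" and "\<And>z. z \<notin> ball 0 1 \<Longrightarrow> f z = 0"
  shows "f \<in> hardy2_set"
  using assms taylor_coeff_unique[of a f, OF assms(1)] by (simp add: hardy2_set_def)

lemma summable_sq_add:
  fixes a b :: "nat \<Rightarrow> complex"
  assumes "summable (\<lambda>n. (cmod (a n))\<^sup>2)" "summable (\<lambda>n. (cmod (b n))\<^sup>2)"
  shows "summable (\<lambda>n. (cmod (a n + b n))\<^sup>2)"
proof (rule summable_comparison_test')
  show "summable (\<lambda>n. 2 * (cmod (a n))\<^sup>2 + 2 * (cmod (b n))\<^sup>2)"
    by (intro summable_add summable_mult assms)
  fix n
  have "(cmod (a n + b n))\<^sup>2 \<le> (cmod (a n) + cmod (b n))\<^sup>2"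
    by (intro power_mono norm_triangle_ineq) auto
  also have "\<dots> \<le> 2 * (cmod (a n))\<^sup>2 + 2 * (cmod (b n))\<^sup>2"
    using zero_le_power2[of "cmod (a n) - cmod (b n)"] by (simp add: power2_eq_square algebra_simps)
  finally show "norm ((cmod (a n + b n))\<^sup>2) \<le> 2 * (cmod (a n))\<^sup>2 + 2 * (cmod (b n))\<^sup>2"
    by simp
qed

lemma summable_sq_mult:
  fixes a b :: "nat \<Rightarrow> complex"
  assumes "summable (\<lambda>n. (cmod (a n))\<^sup>2)" "summable (\<lambda>n. (cmod (b n))\<^sup>2)"
  shows "summable (\<lambda>n. a n * cnj (b n))"
proof (rule summable_comparison_test')
  show "summable (\<lambda>n. (cmod (a n))\<^sup>2 + (cmod (b n))\<^sup>2)"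
    by (intro summable_add assms)
  fix n
  have "cmod (a n) * cmod (b n) \<le> (cmod (a n))\<^sup>2 + (cmod (b n))\<^sup>2"
    using zero_le_power2[of "cmod (a n) - cmod (b n)"] zero_le_power2[of "cmod (a n) + cmod (b n)"]
    unfolding power2_sum power2_diff by linarith
  then show "norm (a n * cnj (b n)) \<le> (cmod (a n))\<^sup>2 + (cmod (b n))\<^sup>2"
    by (simp add: norm_mult)
qed

lemma summable_sq_series:
  fixes a :: "nat \<Rightarrow> complex"
  assumes "summable (\<lambda>n. (cmod (a n))\<^sup>2)" "z \<in> ball 0 1"
  shows "summable (\<lambda>n. a n * z ^ n)"
proof -
  have "summable (\<lambda>n. ((cmod z)\<^sup>2) ^ n)"
    using assms(2) by (intro summable_geometric) (simp add: abs_square_less_1)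
  then have "summable (\<lambda>n. (cmod (cnj z ^ n))\<^sup>2)"
    by (simp add: norm_power power_mult [symmetric] mult.commute)
  from summable_sq_mult[OF assms(1) this] show ?thesis
    by simp
qed

lemma hardy2_zero: "(\<lambda>z. 0) \<in> hardy2_set"
  by (rule hardy2_setI[where a = "\<lambda>n. 0"]) auto

lemma hardy2_add:
  assumes "f \<in> hardy2_set" "g \<in> hardy2_set"
  shows "(\<lambda>z. f z + g z) \<in> hardy2_set"
    "taylor_coeff (\<lambda>z. f z + g z) n = taylor_coeff f n + taylor_coeff g n"
proof -
  have *: "(\<lambda>n. (taylor_coeff f n + taylor_coeff g n) * z ^ n) sums (f z + g z)"
    if "z \<in> ball 0 1" for z
    using sums_add[OF hardy2_sums[OF assms(1) that] hardy2_sums[OF assms(2) that]]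
    by (simp add: algebra_simps)
  show "(\<lambda>z. f z + g z) \<in> hardy2_set"
    using * by (rule hardy2_setI) (use assms summable_sq_add in \<open>auto simp: hardy2_set_def\<close>)
  show "taylor_coeff (\<lambda>z. f z + g z) n = taylor_coeff f n + taylor_coeff g n"
    using * by (rule taylor_coeff_unique)
qed

lemma hardy2_cmult:
  assumes "f \<in> hardy2_set"
  shows "(\<lambda>z. c * f z) \<in> hardy2_set" "taylor_coeff (\<lambda>z. c * f z) n = c * taylor_coeff f n"
proof -
  have *: "(\<lambda>n. (c * taylor_coeff f n) * z ^ n) sums (c * f z)"
    if "z \<in> ball 0 1" for z
    using sums_mult[OF hardy2_sums[OF assms(1) that], of c] by (simp add: algebra_simps)
  show "(\<lambda>z. c * f z) \<in> hardy2_set"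
    using * by (rule hardy2_setI)
      (use assms in \<open>auto simp: hardy2_set_def norm_mult power_mult_distrib intro: summable_mult\<close>)
  show "taylor_coeff (\<lambda>z. c * f z) n = c * taylor_coeff f n"
    using * by (rule taylor_coeff_unique)
qed

typedef hardy2 = hardy2_set
  morphisms hardy2_apply Abs_hardy2
  using hardy2_zero by blast

setup_lifting type_definition_hardy2

definition hardy2_coeff :: "hardy2 \<Rightarrow> nat \<Rightarrow> complex"
  where "hardy2_coeff f = taylor_coeff (hardy2_apply f)"

lemma summable_hardy2_coeff: "summable (\<lambda>n. (cmod (hardy2_coeff f n))\<^sup>2)"
  using hardy2_apply[of f] by (simp add: hardy2_coeff_def hardy2_set_def)

lemma hardy2_apply_sums:
  "z \<in> ball 0 1 \<Longrightarrow> (\<lambda>n. hardy2_coeff f n * z ^ n) sums hardy2_apply f z"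
  unfolding hardy2_coeff_def by (rule hardy2_sums[OF hardy2_apply])

lemma hardy2_apply_outside: "z \<notin> ball 0 1 \<Longrightarrow> hardy2_apply f z = 0"
  using hardy2_apply[of f] by (simp add: hardy2_set_def)

lemma hardy2_eqI:
  assumes "\<And>n. hardy2_coeff f n = hardy2_coeff g n"
  shows "f = g"
proof -
  have "hardy2_apply f z = hardy2_apply g z" for z
  proof (cases "z \<in> ball 0 1")
    case True
    with hardy2_apply_sums[OF True, of f] hardy2_apply_sums[OF True, of g] show ?thesis
      by (simp only: assms sums_unique2)
  qed (simp add: hardy2_apply_outside)
  then show ?thesis
    by (metis ext hardy2_apply_inject)
qed

lemma hardy2_of_coeff:
  assumes "summable (\<lambda>n. (cmod (a n))\<^sup>2)"
  obtains f where "hardy2_coeff f = a"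
proof -
  define f where "f z = (if z \<in> ball 0 1 then \<Sum>n. a n * z ^ n else 0)" for z
  have *: "(\<lambda>n. a n * z ^ n) sums f z" if "z \<in> ball 0 1" for z
    using summable_sq_series[OF assms that] that by (simp add: f_def summable_sums del: mem_ball)
  have "f \<in> hardy2_set"
    by (rule hardy2_setI[OF * assms]) (auto simp: f_def)
  moreover have "taylor_coeff f = a"
    using taylor_coeff_unique(2)[OF *] by blast
  ultimately show ?thesis
    using that[of "Abs_hardy2 f"] by (simp add: hardy2_coeff_def Abs_hardy2_inverse)
qed

instantiation hardy2 :: real_inner
begin

lift_definition zero_hardy2 :: hardy2 is "\<lambda>z. 0"
  by (rule hardy2_zero)

lift_definition plus_hardy2 :: "hardy2 \<Rightarrow> hardy2 \<Rightarrow> hardy2" is "\<lambda>f g z. f z + g z"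
  by (rule hardy2_add)

lift_definition uminus_hardy2 :: "hardy2 \<Rightarrow> hardy2" is "\<lambda>f z. - f z"
  using hardy2_cmult(1)[where c = "-1"] by simp

lift_definition minus_hardy2 :: "hardy2 \<Rightarrow> hardy2 \<Rightarrow> hardy2" is "\<lambda>f g z. f z - g z"
  using hardy2_add(1)[OF _ hardy2_cmult(1)[where c = "-1"]] by simp

lift_definition scaleR_hardy2 :: "real \<Rightarrow> hardy2 \<Rightarrow> hardy2" is "\<lambda>r f z. complex_of_real r * f z"
  by (rule hardy2_cmult)

definition inner_hardy2 :: "hardy2 \<Rightarrow> hardy2 \<Rightarrow> real"
  where "inner_hardy2 f g = Re (\<Sum>n. hardy2_coeff f n * cnj (hardy2_coeff g n))"

definition norm_hardy2 :: "hardy2 \<Rightarrow> real"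
  where "norm_hardy2 f = sqrt (\<Sum>n. (cmod (hardy2_coeff f n))\<^sup>2)"

definition dist_hardy2 :: "hardy2 \<Rightarrow> hardy2 \<Rightarrow> real"
  where "dist_hardy2 f g = norm (f - g)"

definition sgn_hardy2 :: "hardy2 \<Rightarrow> hardy2"
  where "sgn_hardy2 f = inverse (norm f) *\<^sub>R f"

definition uniformity_hardy2 :: "(hardy2 \<times> hardy2) filter"
  where "uniformity_hardy2 = (INF e\<in>{0 <..}. principal {(x, y). dist x y < e})"

definition open_hardy2 :: "hardy2 set \<Rightarrow> bool"
  where "open_hardy2 S \<longleftrightarrow> (\<forall>x\<in>S. \<forall>\<^sub>F (x', y) in uniformity. x' = x \<longrightarrow> y \<in> S)"

lemma hardy2_coeff_simps:
  "hardy2_coeff (f + g) n = hardy2_coeff f n + hardy2_coeff g n"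
  "hardy2_coeff (r *\<^sub>R f) n = complex_of_real r * hardy2_coeff f n"
  unfolding hardy2_coeff_def
  by (simp_all add: plus_hardy2.rep_eq scaleR_hardy2.rep_eq hardy2_add(2)[OF hardy2_apply hardy2_apply]
       hardy2_cmult(2)[OF hardy2_apply])

lemma summable_cinner_hardy2:
  "summable (\<lambda>n. hardy2_coeff f n * cnj (hardy2_coeff g n))"
  by (intro summable_sq_mult summable_hardy2_coeff)

lemma cinner_hardy2_self:
  "(\<Sum>n. hardy2_coeff f n * cnj (hardy2_coeff f n)) =
    complex_of_real (\<Sum>n. (cmod (hardy2_coeff f n))\<^sup>2)"
proof -
  have "(\<lambda>n. complex_of_real ((cmod (hardy2_coeff f n))\<^sup>2)) sums
      complex_of_real (\<Sum>n. (cmod (hardy2_coeff f n))\<^sup>2)"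
    by (intro sums_of_real summable_sums summable_hardy2_coeff)
  then show ?thesis
    unfolding complex_norm_square by (rule sums_unique[symmetric])
qed

lemma cinner_hardy2_swap:
  "(\<Sum>n. hardy2_coeff g n * cnj (hardy2_coeff f n)) =
    cnj (\<Sum>n. hardy2_coeff f n * cnj (hardy2_coeff g n))"
proof -
  have "(\<lambda>n. cnj (hardy2_coeff f n * cnj (hardy2_coeff g n))) sums
      cnj (\<Sum>n. hardy2_coeff f n * cnj (hardy2_coeff g n))"
    unfolding sums_cnj by (rule summable_sums[OF summable_cinner_hardy2])
  moreover have "(\<lambda>n. cnj (hardy2_coeff f n * cnj (hardy2_coeff g n))) =
      (\<lambda>n. hardy2_coeff g n * cnj (hardy2_coeff f n))"
    by (simp add: mult.commute)
  ultimately show ?thesis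
    by (simp only: sums_unique[symmetric])
qed

instance
proof
  fix f g h :: hardy2 and r s :: real
  show "f + g + h = f + (g + h)" by transfer (simp add: algebra_simps)
  show "f + g = g + f" by transfer (simp add: algebra_simps)
  show "0 + f = f" by transfer simp
  show "- f + f = 0" by transfer simp
  show "f - g = f + - g" by transfer simp
  show "r *\<^sub>R (f + g) = r *\<^sub>R f + r *\<^sub>R g" by transfer (simp add: algebra_simps)
  show "(r + s) *\<^sub>R f = r *\<^sub>R f + s *\<^sub>R f" by transfer (simp add: algebra_simps)
  show "r *\<^sub>R s *\<^sub>R f = (r * s) *\<^sub>R f" by transfer (simp add: algebra_simps)
  show "1 *\<^sub>R f = f" by transfer simp
  show "sgn f = inverse (norm f) *\<^sub>R f" by (rule sgn_hardy2_def)
  show "dist f g = norm (f - g)" by (rule dist_hardy2_def)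
  show "(uniformity :: (hardy2 \<times> hardy2) filter) = (INF e\<in>{0 <..}. principal {(x, y). dist x y < e})"
    by (rule uniformity_hardy2_def)
  show "open S \<longleftrightarrow> (\<forall>x\<in>S. \<forall>\<^sub>F (x', y) in uniformity. x' = x \<longrightarrow> y \<in> S)" for S :: "hardy2 set"
    by (rule open_hardy2_def)
  show "inner f g = inner g f"
    unfolding inner_hardy2_def cinner_hardy2_swap[of g f] by simp
  show "inner (f + g) h = inner f h + inner g h"
    unfolding inner_hardy2_def hardy2_coeff_simps distrib_right
    by (subst suminf_add[OF summable_cinner_hardy2 summable_cinner_hardy2, symmetric]) simp
  show "inner (r *\<^sub>R f) g = r * inner f g"
    unfolding inner_hardy2_def hardy2_coeff_simps mult.assoc
    by (subst suminf_mult[OF summable_cinner_hardy2]) simp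
  have self: "inner f f = (\<Sum>n. (cmod (hardy2_coeff f n))\<^sup>2)"
    by (simp add: inner_hardy2_def cinner_hardy2_self)
  show "0 \<le> inner f f"
    unfolding self by (intro suminf_nonneg summable_hardy2_coeff) simp
  show "norm f = sqrt (inner f f)"
    by (simp add: self norm_hardy2_def)
  have z: "hardy2_coeff 0 n = 0" for n
    using taylor_coeff_unique(2)[of "\<lambda>n. 0" "\<lambda>z. 0"]
    by (simp add: hardy2_coeff_def zero_hardy2.rep_eq)
  show "inner f f = 0 \<longleftrightarrow> f = 0"
    unfolding self
    by (subst suminf_eq_zero_iff[OF summable_hardy2_coeff]) (auto intro: hardy2_eqI simp: z)
qed

end

lemma hardy2_coeff_diff: "hardy2_coeff (f - g) n = hardy2_coeff f n - hardy2_coeff g n"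
  using hardy2_coeff_simps(1)[of "f - g" g n] by simp

lemma cmod_hardy2_coeff_le:
  "(\<Sum>n<k. (cmod (hardy2_coeff f n))\<^sup>2) \<le> (norm f)\<^sup>2" "cmod (hardy2_coeff f n) \<le> norm f"
proof -
  have nn: "(norm f)\<^sup>2 = (\<Sum>n. (cmod (hardy2_coeff f n))\<^sup>2)"
    by (simp add: norm_hardy2_def suminf_nonneg summable_hardy2_coeff)
  show *: "(\<Sum>n<k. (cmod (hardy2_coeff f n))\<^sup>2) \<le> (norm f)\<^sup>2" for k
    unfolding nn by (rule sum_le_suminf[OF summable_hardy2_coeff]) auto
  have "(cmod (hardy2_coeff f n))\<^sup>2 \<le> (\<Sum>n<Suc n. (cmod (hardy2_coeff f n))\<^sup>2)"
    by (simp add: sum_nonneg)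
  also note *
  finally show "cmod (hardy2_coeff f n) \<le> norm f"
    by (rule power2_le_imp_le) simp
qed

instance hardy2 :: complete_space
proof
  fix X :: "nat \<Rightarrow> hardy2"
  assume X: "Cauchy X"
  have "Cauchy (\<lambda>m. hardy2_coeff (X m) n)" for n
  proof (rule metric_CauchyI)
    fix e :: real assume "0 < e"
    then obtain M where M: "\<And>i j. i \<ge> M \<Longrightarrow> j \<ge> M \<Longrightarrow> dist (X i) (X j) < e"
      using X by (metis metric_CauchyD)
    have "dist (hardy2_coeff (X i) n) (hardy2_coeff (X j) n) < e" if "i \<ge> M" "j \<ge> M" for i j
      using cmod_hardy2_coeff_le(2)[of "X i - X j" n] M[OF that]
      by (simp add: dist_norm hardy2_coeff_diff)
    then show "\<exists>M. \<forall>i\<ge>M. \<forall>j\<ge>M. dist (hardy2_coeff (X i) n) (hardy2_coeff (X j) n) < e"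
      by blast
  qed
  then have "\<forall>n. \<exists>l. (\<lambda>m. hardy2_coeff (X m) n) \<longlonglongrightarrow> l"
    by (simp add: Cauchy_convergent_iff convergent_def)
  then obtain a where a: "\<And>n. (\<lambda>m. hardy2_coeff (X m) n) \<longlonglongrightarrow> a n"
    by metis
  have bound: "(\<Sum>n<k. (cmod (hardy2_coeff (X i) n - a n))\<^sup>2) \<le> e\<^sup>2"
    if M: "\<And>i j. i \<ge> M \<Longrightarrow> j \<ge> M \<Longrightarrow> dist (X i) (X j) < e" and i: "i \<ge> M" for e M i k
  proof (rule LIMSEQ_le_const2)
    show "(\<lambda>j. \<Sum>n<k. (cmod (hardy2_coeff (X i) n - hardy2_coeff (X j) n))\<^sup>2)
        \<longlonglongrightarrow> (\<Sum>n<k. (cmod (hardy2_coeff (X i) n - a n))\<^sup>2)"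
      by (intro tendsto_intros a)
    have "(\<Sum>n<k. (cmod (hardy2_coeff (X i) n - hardy2_coeff (X j) n))\<^sup>2) \<le> e\<^sup>2" if "j \<ge> M" for j
    proof -
      have "(\<Sum>n<k. (cmod (hardy2_coeff (X i - X j) n))\<^sup>2) \<le> (norm (X i - X j))\<^sup>2"
        by (rule cmod_hardy2_coeff_le)
      also have "\<dots> \<le> e\<^sup>2"
        using M[OF i that] by (intro power_mono) (auto simp: dist_norm)
      finally show ?thesis
        by (simp add: hardy2_coeff_diff)
    qed
    then show "\<exists>N. \<forall>j\<ge>N. (\<Sum>n<k. (cmod (hardy2_coeff (X i) n - hardy2_coeff (X j) n))\<^sup>2) \<le> e\<^sup>2"
      by blast
  qed
  have sm: "summable (\<lambda>n. (cmod (hardy2_coeff (X i) n - a n))\<^sup>2)"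
    and le: "(\<Sum>n. (cmod (hardy2_coeff (X i) n - a n))\<^sup>2) \<le> e\<^sup>2"
    if M: "\<And>i j. i \<ge> M \<Longrightarrow> j \<ge> M \<Longrightarrow> dist (X i) (X j) < e" and i: "i \<ge> M" for e M i
  proof -
    show *: "summable (\<lambda>n. (cmod (hardy2_coeff (X i) n - a n))\<^sup>2)"
      by (rule bounded_imp_summable[where B = "e\<^sup>2"])
        (use bound[OF M i, of "Suc _"] in \<open>auto simp: lessThan_Suc_atMost\<close>)
    show "(\<Sum>n. (cmod (hardy2_coeff (X i) n - a n))\<^sup>2) \<le> e\<^sup>2"
      by (rule suminf_le_const[OF * bound[OF M i]])
  qed
  obtain M where "\<And>i j. i \<ge> M \<Longrightarrow> j \<ge> M \<Longrightarrow> dist (X i) (X j) < 1"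
    using X by (metis metric_CauchyD zero_less_one)
  from sm[OF this order_refl]
  have "summable (\<lambda>n. (cmod (a n - hardy2_coeff (X M) n))\<^sup>2)"
    by (simp add: norm_minus_commute)
  from summable_sq_add[OF this summable_hardy2_coeff[of "X M"]]
  have "summable (\<lambda>n. (cmod (a n))\<^sup>2)"
    by simp
  then obtain f where f: "hardy2_coeff f = a"
    by (rule hardy2_of_coeff)
  have "X \<longlonglongrightarrow> f"
  proof (rule metric_LIMSEQ_I)
    fix e :: real assume e: "0 < e"
    then obtain M where M: "\<And>i j. i \<ge> M \<Longrightarrow> j \<ge> M \<Longrightarrow> dist (X i) (X j) < e / 2"
      using X by (metis metric_CauchyD half_gt_zero)
    have "dist (X i) f < e" if "i \<ge> M" for i
    proof -
      have "dist (X i) f \<le> sqrt ((e / 2)\<^sup>2)"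
        using le[OF M that] unfolding dist_norm norm_hardy2_def hardy2_coeff_diff f
        by (rule real_sqrt_le_mono)
      also have "\<dots> < e"
        using e by simp
      finally show ?thesis .
    qed
    then show "\<exists>M. \<forall>i\<ge>M. dist (X i) f < e"
      by blast
  qed
  then show "convergent X"
    by (rule convergentI)
qed

instantiation hardy2 :: complex_hilbert_space
begin

lift_definition scaleC_hardy2 :: "complex \<Rightarrow> hardy2 \<Rightarrow> hardy2" is "\<lambda>c f z. c * f z"
  by (rule hardy2_cmult)

definition cinner_hardy2 :: "hardy2 \<Rightarrow> hardy2 \<Rightarrow> complex"
  where "cinner_hardy2 f g = (\<Sum>n. hardy2_coeff f n * cnj (hardy2_coeff g n))"

lemma hardy2_coeff_scaleC: "hardy2_coeff (c *\<^sub>C f) n = c * hardy2_coeff f n"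
  unfolding hardy2_coeff_def scaleC_hardy2.rep_eq by (rule hardy2_cmult(2)[OF hardy2_apply])

instance
proof
  fix f g h :: hardy2 and b c :: complex and r :: real
  show "c *\<^sub>C (f + g) = c *\<^sub>C f + c *\<^sub>C g" by transfer (simp add: algebra_simps)
  show "(b + c) *\<^sub>C f = b *\<^sub>C f + c *\<^sub>C f" by transfer (simp add: algebra_simps)
  show "b *\<^sub>C (c *\<^sub>C f) = (b * c) *\<^sub>C f" by transfer (simp add: algebra_simps)
  show "r *\<^sub>R f = complex_of_real r *\<^sub>C f" by transfer simp
  show "cinner (f + g) h = cinner f h + cinner g h"
    unfolding cinner_hardy2_def hardy2_coeff_simps distrib_right
    by (rule suminf_add[OF summable_cinner_hardy2 summable_cinner_hardy2, symmetric])
  show "cinner (c *\<^sub>C f) g = c * cinner f g"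
    unfolding cinner_hardy2_def hardy2_coeff_scaleC mult.assoc
    by (rule suminf_mult[OF summable_cinner_hardy2])
  show "cinner f g = cnj (cinner g f)"
    unfolding cinner_hardy2_def by (rule cinner_hardy2_swap)
  show "inner f g = Re (cinner f g)"
    by (simp add: inner_hardy2_def cinner_hardy2_def)
qed

end

(* THE picks out the unique element of H^2 agreeing with f o phi on the disk; it exists for
   every analytic selfmap phi by Littlewood's subordination theorem. *)
definition composition_operator :: "(complex \<Rightarrow> complex) \<Rightarrow> hardy2 \<Rightarrow> hardy2"
  where "composition_operator \<phi> f =
    (THE g. \<forall>z\<in>ball 0 1. hardy2_apply g z = hardy2_apply f (\<phi> z))"

(* The point at infinity is never needed: a nonconstant linear-fractional selfmap of the open disk
   has its pole off the closed disk, so its values on the closed disk, and its derivative there,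
   are those of the extended map.  The value at the pole is 0 by the convention x / 0 = 0 and is
   never used. *)
definition linear_fractional_selfmap :: "(complex \<Rightarrow> complex) \<Rightarrow> bool"
  where "linear_fractional_selfmap \<phi> \<longleftrightarrow>
    (\<exists>a b c d. (\<forall>z. \<phi> z = (a * z + b) / (c * z + d)) \<and> (\<forall>z\<in>ball 0 1. c * z + d \<noteq> 0)) \<and>
    \<phi> ` ball 0 1 \<subseteq> ball 0 1"

definition disk_automorphism :: "(complex \<Rightarrow> complex) \<Rightarrow> bool"
  where "disk_automorphism \<phi> \<longleftrightarrow> \<phi> holomorphic_on ball 0 1 \<and> bij_betw \<phi> (ball 0 1) (ball 0 1)"

(* For selfmaps that extend continuously to the closed disk, such as the nonconstant
   linear-fractional ones; in general phi w has to be read as an angular limit when |w| = 1.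
   Elliptic automorphisms, the identity included, have no such point. *)
definition denjoy_wolff_point :: "(complex \<Rightarrow> complex) \<Rightarrow> complex \<Rightarrow> bool"
  where "denjoy_wolff_point \<phi> w \<longleftrightarrow> w \<in> cball 0 1 \<and> \<phi> w = w \<and>
    (\<forall>K. compact K \<and> K \<subseteq> ball 0 1 \<longrightarrow>
      uniform_limit K (\<lambda>n. \<phi> ^^ n) (\<lambda>_. w) sequentially)"

definition disk_involution :: "complex \<Rightarrow> complex \<Rightarrow> complex"
  where "disk_involution w z = (w - z) / (1 - cnj w * z)"

end

theory Submission
  imports Defs
begin

text \<open>Write \<open>\<phi>(z) = (a z + b) / (c z + d)\<close>, and let \<open>\<sigma>\<close> be the linear-fractional map whose matrix
  is the adjoint of that of \<open>\<phi>\<close> for the form \<open>\<bar>x\<bar>\<^sup>2 - \<bar>y\<bar>\<^sup>2\<close>. By Cowen's formula the range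
  of the adjoint of \<open>C\<^sub>\<phi>\<close> consists of the functions \<open>g \<cdot> (F \<circ> \<sigma>)\<close> with \<open>F\<close> in \<open>H\<^sup>2\<close>, where
  \<open>g(z) = 1 / (cnj d - cnj b * z)\<close>. Comparing ranges, \<open>C\<^sub>\<phi>\<close> is coposinormal iff
  \<open>\<sigma> \<circ> \<phi>\<inverse>\<close> maps the disk into itself, and posinormal iff \<open>\<bar>b\<bar> < \<bar>a\<bar>\<close> (that is, \<open>\<phi>\<close> vanishes
  in the disk) and \<open>\<phi> \<circ> \<sigma>\<inverse>\<close> maps the disk into itself.

  The two inclusions compare the pullbacks of the form under the two matrices. If \<open>w\<close> is fixed by
  \<open>\<phi>\<close> and \<open>e = d - a + c w\<close>, so that \<open>-e/c\<close> is the other fixed point, the difference of the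
  pullbacks is \<open>\<bar>cnj w * x - y\<bar>\<^sup>2 (\<bar>c\<bar>\<^sup>2 - \<bar>e\<bar>\<^sup>2) + \<bar>c x + e y\<bar>\<^sup>2 (1 - \<bar>w\<bar>\<^sup>2)\<close>. For \<open>\<bar>w\<bar> = 1\<close> its sign
  is decided by the position of the other fixed point; for \<open>\<bar>w\<bar> < 1\<close> the Schwarz--Pick inequality
  forces that point to be the reflection of \<open>w\<close> or, in the posinormal case, to lie on the circle.\<close>

section \<open>Posinormality and ranges\<close>

text \<open>Both inclusions are written for vectors (x, y) instead of points x / y: the inverse of a
  linear-fractional map need not be defined on the whole disk, while an implication between
  inequalities of linear forms never meets a pole. Sufficiency takes the strict implication; the
  composite, whose matrix is called \<open>P\<close>, \<open>Q\<close>, \<open>R\<close>,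
  \<open>S\<close>, then maps the open disk into itself, and the factor between the operator and its
  adjoint is a weighted composition operator. Necessity yields the weak implication, from closed
  disk to closed disk, and the sign arguments are arranged to work with it.

  The adjoint of multiplication by c z + d is invertible, so it does not affect ranges. The
  condition |b| < |a| comes from the constant function 1: to lie in the range of the adjoint it
  needs \<open>\<Delta> / (cnj b * y + cnj a)\<close> in H^2, hence a pole outside the closed disk.
  Coposinormality has no such condition because its weight has the same denominator as the composite
  selfmap.\<close>

lemma cinner_add_right:
  fixes x y z :: "'a::complex_hilbert_space"
  shows "cinner x (y + z) = cinner x y + cinner x z"
  by (metis cinner_commute cinner_add_left complex_cnj_add)

lemma cinner_scaleC_right:
  fixes x y :: "'a::complex_hilbert_space"
  shows "cinner x (c *\<^sub>C y) = cnj c * cinner x y"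
  by (metis cinner_commute cinner_scaleC_left complex_cnj_mult)

lemma cinner_diff_right:
  fixes x y z :: "'a::complex_hilbert_space"
  shows "cinner x (y - z) = cinner x y - cinner x z"
  using cinner_add_right[of x "y - z" z] by simp

lemma cinner_self: "cinner x x = complex_of_real ((norm x)\<^sup>2)"
  for x :: "'a::complex_hilbert_space"
proof (rule complex_eqI)
  show "Re (cinner x x) = Re (complex_of_real ((norm x)\<^sup>2))"
    by (simp add: inner_eq_Re_cinner [symmetric] power2_norm_eq_inner)
  show "Im (cinner x x) = Im (complex_of_real ((norm x)\<^sup>2))"
    using cinner_commute[of x x] by (metis Im_complex_of_real Reals_cnj_iff complex_is_Real_iff)
qed

lemma norm_scaleC: "norm (c *\<^sub>C x) = cmod c * norm x"
  for x :: "'a::complex_hilbert_space"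
proof -
  have "complex_of_real ((norm (c *\<^sub>C x))\<^sup>2) = complex_of_real ((cmod c * norm x)\<^sup>2)"
    using complex_norm_square[of c]
    by (simp add: cinner_self [symmetric] cinner_scaleC_left cinner_scaleC_right
        power_mult_distrib flip: of_real_power)
  then have "(norm (c *\<^sub>C x))\<^sup>2 = (cmod c * norm x)\<^sup>2"
    by (simp only: of_real_eq_iff)
  then show ?thesis
    by (simp add: power2_eq_iff_nonneg)
qed

lemma cmod_cinner_le: "cmod (cinner x y) \<le> norm x * norm y"
  for x y :: "'a::complex_hilbert_space"
proof (cases "cinner x y = 0")
  case False
  \<comment> \<open>A unimodular factor that rotates the inner product onto the positive real axis,
    which reduces the claim to the real Cauchy-Schwarz inequality.\<close>
  define c where "c = cnj (cinner x y) / cmod (cinner x y)"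
  have "c * cinner x y = complex_of_real (cmod (cinner x y))"
    using False by (simp add: c_def complex_norm_square [symmetric] power2_eq_square mult.commute)
  then have "cmod (cinner x y) = Re (cinner (c *\<^sub>C x) y)"
    by (simp add: cinner_scaleC_left)
  also have "\<dots> \<le> norm (c *\<^sub>C x) * norm y"
    by (metis inner_eq_Re_cinner norm_cauchy_schwarz)
  also have "norm (c *\<^sub>C x) = norm x"
    using False by (simp add: c_def norm_scaleC norm_divide)
  finally show ?thesis .
qed auto

lemma cinner_eqI:
  fixes x y :: "'a::complex_hilbert_space"
  assumes "\<And>z. cinner z x = cinner z y"
  shows "x = y"
proof -
  have "cinner (x - y) (x - y) = 0"
    using assms[of "x - y"] by (simp add: cinner_diff_right)
  then show ?thesis
    by (simp add: cinner_self)
qed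

lemma bounded_clinear_boundI:
  fixes A :: "'a::complex_hilbert_space \<Rightarrow> 'b::complex_hilbert_space"
  assumes "\<And>x y. A (x + y) = A x + A y" "\<And>c x. A (c *\<^sub>C x) = c *\<^sub>C A x"
    "\<And>x. norm (A x) \<le> norm x * K"
  shows "bounded_clinear A"
  unfolding bounded_clinear_def
  by (intro conjI allI bounded_linear_intro[where K = K])
    (use assms in \<open>auto simp: scaleR_scaleC\<close>)

lemma bounded_clinear_add: "bounded_clinear A \<Longrightarrow> A (x + y) = A x + A y"
  by (simp add: bounded_clinear_def linear_add bounded_linear.linear)

lemma bounded_clinear_scaleC: "bounded_clinear A \<Longrightarrow> A (c *\<^sub>C x) = c *\<^sub>C A x"
  by (simp add: bounded_clinear_def)

lemma bounded_clinear_bound: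
  assumes "bounded_clinear A"
  obtains K where "K \<ge> 0" "\<And>x. norm (A x) \<le> K * norm x"
  using assms bounded_linear.nonneg_bounded unfolding bounded_clinear_def
  by (metis mult.commute)

lemma bounded_clinear_compose:
  "bounded_clinear A \<Longrightarrow> bounded_clinear B \<Longrightarrow> bounded_clinear (\<lambda>x. A (B x))"
  by (simp add: bounded_clinear_def bounded_linear_compose)

text \<open>The representing vector is the limit of \<open>A f\<close> along a minimising sequence of
  \<open>\<parallel>A f\<parallel>\<^sup>2 - 2 Re (l f)\<close>, which is Cauchy by the parallelogram law.\<close>

lemma dominated_functional_representation:
  fixes A :: "'a::complex_hilbert_space \<Rightarrow> 'b::complex_hilbert_space"
  assumes A: "bounded_clinear A"
    and l_add: "\<And>x y. l (x + y) = l x + l y" and l_scale: "\<And>c x. l (c *\<^sub>C x) = c * l x"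
    and l_bound: "\<And>x. cmod (l x) \<le> k * norm (A x)"
  obtains u where "\<And>x. l x = cinner (A x) u"
proof -
  define J where "J x = (norm (A x))\<^sup>2 - 2 * Re (l x)" for x
  have A_scaleR: "A (r *\<^sub>R x) = r *\<^sub>R A x" for r x
    by (simp add: scaleR_scaleC bounded_clinear_scaleC[OF A])
  have l_scaleR: "Re (l (r *\<^sub>R x)) = r * Re (l x)" for r x
    by (simp add: scaleR_scaleC l_scale)
  have "J x \<ge> - k\<^sup>2" for x
  proof -
    have "2 * Re (l x) \<le> 2 * (k * norm (A x))"
      using l_bound[of x] complex_Re_le_cmod[of "l x"] by linarith
    moreover have "(norm (A x) - k)\<^sup>2 \<ge> 0"
      by simp
    ultimately show ?thesis
      unfolding J_def by (simp add: power2_diff algebra_simps)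
  qed
  then have bdd: "bdd_below (range J)"
    by (intro bdd_belowI2)
  define m where "m = Inf (range J)"
  have m_le: "m \<le> J x" for x
    unfolding m_def using bdd by (intro cINF_lower) auto
  have "\<exists>x. J x < m + inverse (real (Suc n))" for n
  proof -
    have "m < m + inverse (real (Suc n))"
      by simp
    then show ?thesis
      unfolding m_def using bdd by (subst (asm) cINF_less_iff) auto
  qed
  then obtain f where f: "\<And>n. J (f n) < m + inverse (real (Suc n))"
    by metis
  have par: "(norm (A x - A y))\<^sup>2 \<le> 2 * (J x + J y - 2 * m)" for x y
  proof -
    define z where "z = (1/2) *\<^sub>R (x + y)"
    have "J x + J y - 2 * J z = (norm (A x - A y))\<^sup>2 / 2"
      by (simp add: z_def J_def A_scaleR l_scaleR bounded_clinear_add[OF A] l_add power2_norm_eq_inner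
          inner_add_left inner_add_right inner_diff_left inner_diff_right inner_commute
          algebra_simps)
    then show ?thesis
      using m_le[of z] by (simp add: field_simps)
  qed
  have "Cauchy (\<lambda>n. A (f n))"
  proof (rule metric_CauchyI)
    fix e :: real assume e: "0 < e"
    obtain M where M: "inverse (real (Suc M)) < e\<^sup>2 / 4"
      using reals_Archimedean[of "e\<^sup>2 / 4"] e by auto
    have "dist (A (f i)) (A (f j)) < e" if "i \<ge> M" "j \<ge> M" for i j
    proof -
      have "inverse (real (Suc i)) \<le> inverse (real (Suc M))"
        "inverse (real (Suc j)) \<le> inverse (real (Suc M))"
        using that by (auto intro!: le_imp_inverse_le)
      then have "(norm (A (f i) - A (f j)))\<^sup>2 < e\<^sup>2"
        using par[of "f i" "f j"] f[of i] f[of j] M by argo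
      then show ?thesis
        unfolding dist_norm using e by (auto intro: power2_less_imp_less)
    qed
    then show "\<exists>M. \<forall>i\<ge>M. \<forall>j\<ge>M. dist (A (f i)) (A (f j)) < e"
      by blast
  qed
  then obtain u where u: "(\<lambda>n. A (f n)) \<longlonglongrightarrow> u"
    using Cauchy_convergent_iff convergent_def by blast
  have Re_eq: "inner (A x) u = Re (l x)" for x
  proof -
    \<comment> \<open>Minimality tested in the direction x: expand
      \<open>m \<le> J (f n + t *\<^sub>R x)\<close> in t, use that \<open>J (f n)\<close> exceeds
      \<open>m\<close> by less than \<open>inverse (Suc n)\<close>, and let n tend to
      infinity.\<close>
    have nonneg: "0 \<le> 2 * t * (inner (A x) u - Re (l x)) + t\<^sup>2 * (norm (A x))\<^sup>2" for t
    proof (rule LIMSEQ_le)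
      show "(\<lambda>n. - inverse (real (Suc n))) \<longlonglongrightarrow> 0"
        using tendsto_minus[OF LIMSEQ_inverse_real_of_nat] by simp
      show "(\<lambda>n. 2 * t * (inner (A x) (A (f n)) - Re (l x)) + t\<^sup>2 * (norm (A x))\<^sup>2) \<longlonglongrightarrow>
          2 * t * (inner (A x) u - Re (l x)) + t\<^sup>2 * (norm (A x))\<^sup>2"
        by (intro tendsto_intros u)
      have "- inverse (real (Suc n)) \<le>
          2 * t * (inner (A x) (A (f n)) - Re (l x)) + t\<^sup>2 * (norm (A x))\<^sup>2" for n
      proof -
        have "J (f n + t *\<^sub>R x) =
            J (f n) + 2 * t * (inner (A x) (A (f n)) - Re (l x)) + t\<^sup>2 * (norm (A x))\<^sup>2"
          by (simp add: J_def A_scaleR l_scaleR bounded_clinear_add[OF A] l_add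
              power2_norm_eq_inner inner_add_left inner_add_right inner_commute
              algebra_simps) (simp add: power2_eq_square)
        then show ?thesis
          using m_le[of "f n + t *\<^sub>R x"] f[of n] by linarith
      qed
      then show "\<exists>N. \<forall>n\<ge>N. - inverse (real (Suc n)) \<le>
          2 * t * (inner (A x) (A (f n)) - Re (l x)) + t\<^sup>2 * (norm (A x))\<^sup>2"
        by blast
    qed
    define \<alpha> \<beta> where "\<alpha> = inner (A x) u - Re (l x)" and "\<beta> = (norm (A x))\<^sup>2"
    have "\<beta> \<ge> 0"
      by (simp add: \<beta>_def)
    \<comment> \<open>This t nearly minimises the quadratic; the summand 1 keeps it defined when A x
      = 0.\<close>
    have "0 \<le> 2 * (- \<alpha> / (\<beta> + 1)) * \<alpha> + (- \<alpha> / (\<beta> + 1))\<^sup>2 * \<beta>"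
      using nonneg[of "- \<alpha> / (\<beta> + 1)"] unfolding \<alpha>_def \<beta>_def .
    also have "\<dots> = - (\<alpha>\<^sup>2 * (\<beta> + 2)) / (\<beta> + 1)\<^sup>2"
      using \<open>\<beta> \<ge> 0\<close> by (simp add: divide_simps power2_eq_square) (simp add: algebra_simps)
    finally have "\<alpha>\<^sup>2 * (\<beta> + 2) \<le> 0"
      using \<open>\<beta> \<ge> 0\<close> by (simp add: divide_le_0_iff zero_le_divide_iff)
    then have "\<alpha> = 0"
      using \<open>\<beta> \<ge> 0\<close> by (simp add: mult_le_0_iff)
    then show ?thesis
      by (simp add: \<alpha>_def)
  qed
  have "l x = cinner (A x) u" for x
  proof (rule complex_eqI)
    show "Re (l x) = Re (cinner (A x) u)"
      using Re_eq[of x] by (simp add: inner_eq_Re_cinner)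
    show "Im (l x) = Im (cinner (A x) u)"
      using Re_eq[of "\<i> *\<^sub>C x"]
      by (simp add: inner_eq_Re_cinner bounded_clinear_scaleC[OF A] l_scale cinner_scaleC_left)
  qed
  then show ?thesis
    using that by blast
qed

section \<open>Existence and properties of the adjoint\<close>

lemma cadjoint_eqI:
  assumes "\<And>x y. cinner (A x) y = cinner x (B y)"
  shows "cadjoint A = B"
  unfolding cadjoint_def
proof (rule the_equality)
  fix B' assume "\<forall>x y. cinner (A x) y = cinner x (B' y)"
  then show "B' = B"
    by (intro ext cinner_eqI) (metis assms)
qed (use assms in blast)

lemma cadjoint:
  fixes A :: "'a::complex_hilbert_space \<Rightarrow> 'b::complex_hilbert_space"
  assumes A: "bounded_clinear A"
  shows cinner_cadjoint: "cinner (A x) y = cinner x (cadjoint A y)"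
    and bounded_clinear_cadjoint: "bounded_clinear (cadjoint A)"
proof -
  obtain K where K: "K \<ge> 0" "\<And>x. norm (A x) \<le> K * norm x"
    using bounded_clinear_bound[OF A] by blast
  have id: "bounded_clinear (\<lambda>x::'a. x)"
    by (rule bounded_clinear_boundI[where K = 1]) auto
  \<comment> \<open>Domination by the identity is boundedness, so this instance is the Riesz
    representation theorem.\<close>
  have "\<exists>u. \<forall>x. cinner (A x) y = cinner x u" for y
  proof (rule dominated_functional_representation[OF id, where l = "\<lambda>x. cinner (A x) y"])
    show "cmod (cinner (A x) y) \<le> (K * norm y) * norm x" for x
    proof -
      have "cmod (cinner (A x) y) \<le> norm (A x) * norm y"
        by (rule cmod_cinner_le)
      also have "\<dots> \<le> K * norm x * norm y"
        by (intro mult_right_mono K) auto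
      finally show ?thesis
        by (simp add: mult_ac)
    qed
  qed (auto simp: bounded_clinear_add[OF A] bounded_clinear_scaleC[OF A] cinner_add_left
      cinner_scaleC_left)
  then obtain B where B: "\<And>x y. cinner (A x) y = cinner x (B y)"
    by metis
  then have AB: "cadjoint A = B"
    by (rule cadjoint_eqI)
  then show "cinner (A x) y = cinner x (cadjoint A y)"
    using B by simp
  show "bounded_clinear (cadjoint A)"
    unfolding AB
  proof (rule bounded_clinear_boundI[where K = K])
    show "B (x + y) = B x + B y" for x y
      by (rule cinner_eqI) (simp add: B [symmetric] cinner_add_right)
    show "B (c *\<^sub>C x) = c *\<^sub>C B x" for c x
      by (rule cinner_eqI) (simp add: B [symmetric] cinner_scaleC_right)
    show "norm (B y) \<le> norm y * K" for y
    proof -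
      have "(norm (B y))\<^sup>2 = cmod (cinner (B y) (B y))"
        by (simp add: cinner_self norm_power)
      also have "\<dots> = cmod (cinner (A (B y)) y)"
        by (simp add: B)
      also have "\<dots> \<le> norm (A (B y)) * norm y"
        by (rule cmod_cinner_le)
      also have "\<dots> \<le> K * norm (B y) * norm y"
        by (intro mult_right_mono K) auto
      finally have "norm (B y) * norm (B y) \<le> norm (B y) * (norm y * K)"
        by (simp add: power2_eq_square mult_ac)
      then show ?thesis
        using K(1) by (cases "norm (B y) = 0") (auto simp: mult_le_cancel_left)
    qed
  qed
qed

lemma cinner_cadjoint':
  fixes A :: "'a::complex_hilbert_space \<Rightarrow> 'b::complex_hilbert_space"
  assumes "bounded_clinear A"
  shows "cinner (cadjoint A y) x = cinner y (A x)"
  by (metis assms cinner_cadjoint cinner_commute)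

lemma cadjoint_cadjoint: "bounded_clinear A \<Longrightarrow> cadjoint (cadjoint A) = A"
  by (rule cadjoint_eqI) (rule cinner_cadjoint')

text \<open>Taking adjoints in A = A' T, with A' the adjoint of A, gives A' = T' A, hence A A' = A'
  (T T') A; so T T' serves as the positive operator.\<close>

lemma posinormal_if_factors:
  assumes A: "bounded_clinear A" and T: "bounded_clinear T"
    and fact: "\<And>x. A x = cadjoint A (T x)"
  shows "posinormal A"
  unfolding posinormal_def
proof (intro conjI A exI)
  note A' = bounded_clinear_cadjoint[OF A] and T' = bounded_clinear_cadjoint[OF T]
  have "cinner (T (cadjoint T x)) x = complex_of_real ((norm (cadjoint T x))\<^sup>2)" for x
    by (simp add: cinner_cadjoint[OF T] cinner_self)
  then show "positive_operator (\<lambda>x. T (cadjoint T x))"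
    unfolding positive_operator_def by (simp add: bounded_clinear_compose[OF T T'])
  have adj: "cadjoint A x = cadjoint T (A x)" for x
    by (rule cinner_eqI) (metis cinner_cadjoint[OF A] fact cinner_cadjoint'[OF A] cinner_cadjoint[OF T])
  then show "A \<circ> cadjoint A = cadjoint A \<circ> (\<lambda>x. T (cadjoint T x)) \<circ> A"
    by (intro ext, unfold o_apply) (metis adj fact)
qed

text \<open>One half of Douglas' lemma. The identity with P bounds the norm of
  \<open>cadjoint A x\<close> by sqrt K times that of \<open>A x\<close>, so the functional given by
  \<open>cadjoint A x\<close> and y is dominated by \<open>A x\<close> and is represented by some
  u.\<close>

lemma posinormal_range:
  assumes "posinormal A"
  obtains u where "A y = cadjoint A u"
proof -
  from assms obtain P where A: "bounded_clinear A" and P: "positive_operator P"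
    and eq: "A \<circ> cadjoint A = cadjoint A \<circ> P \<circ> A"
    unfolding posinormal_def by blast
  note A' = bounded_clinear_cadjoint[OF A]
  from P obtain K where K: "K \<ge> 0" "\<And>x. norm (P x) \<le> K * norm x"
    using bounded_clinear_bound unfolding positive_operator_def by blast
  have dom: "norm (cadjoint A x) \<le> sqrt K * norm (A x)" for x
  proof -
    have "complex_of_real ((norm (cadjoint A x))\<^sup>2) = cinner (A (cadjoint A x)) x"
      by (simp only: cinner_self [symmetric] cinner_cadjoint[OF A])
    also have "A (cadjoint A x) = cadjoint A (P (A x))"
      using eq by (simp add: fun_eq_iff)
    also have "cinner \<dots> x = cinner (P (A x)) (A x)"
      by (rule cinner_cadjoint'[OF A])
    finally have "(norm (cadjoint A x))\<^sup>2 = cmod (cinner (P (A x)) (A x))"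
      by (metis norm_of_real abs_power2)
    also have "\<dots> \<le> norm (P (A x)) * norm (A x)"
      by (rule cmod_cinner_le)
    also have "\<dots> \<le> (K * norm (A x)) * norm (A x)"
      by (intro mult_right_mono K) auto
    also have "\<dots> = (sqrt K * norm (A x))\<^sup>2"
      using K(1) by (simp add: power_mult_distrib power2_eq_square[of "norm _"])
    finally show ?thesis
      using K(1) by (auto intro: power2_le_imp_le)
  qed
  obtain u where u: "\<And>x. cinner (cadjoint A x) y = cinner (A x) u"
  proof (rule dominated_functional_representation[OF A, where l = "\<lambda>x. cinner (cadjoint A x) y"])
    show "cmod (cinner (cadjoint A x) y) \<le> (sqrt K * norm y) * norm (A x)" for x
    proof -
      have "cmod (cinner (cadjoint A x) y) \<le> norm (cadjoint A x) * norm y"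
        by (rule cmod_cinner_le)
      also have "\<dots> \<le> sqrt K * norm (A x) * norm y"
        by (intro mult_right_mono dom) auto
      finally show ?thesis
        by (simp add: mult_ac)
    qed
  qed (auto simp: bounded_clinear_add[OF A'] bounded_clinear_scaleC[OF A'] cinner_add_left
      cinner_scaleC_left)
  have "A y = cadjoint A u"
    by (rule cinner_eqI) (simp add: cinner_cadjoint'[OF A, symmetric] u cinner_cadjoint[OF A, symmetric])
  then show ?thesis
    using that by blast
qed

lemma invertible_imp_posinormal:
  assumes "invertible_operator A"
  shows "posinormal A" "coposinormal A"
proof -
  from assms obtain B where A: "bounded_clinear A" and B: "bounded_clinear B"
    and AB: "\<And>x. A (B x) = x" and BA: "\<And>x. B (A x) = x"
    unfolding invertible_operator_def by (auto simp: fun_eq_iff)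
  have adj: "cadjoint A (cadjoint B x) = x" for x
    by (rule cinner_eqI)
      (simp add: cinner_cadjoint[OF A, symmetric] cinner_cadjoint[OF B, symmetric] BA)
  note A' = bounded_clinear_cadjoint[OF A] and B' = bounded_clinear_cadjoint[OF B]
  show "posinormal A"
    by (rule posinormal_if_factors[OF A bounded_clinear_compose[OF B' A]]) (simp add: adj)
  have "posinormal (cadjoint A)"
    by (rule posinormal_if_factors[OF A' bounded_clinear_compose[OF B A']])
      (simp add: cadjoint_cadjoint[OF A] AB)
  with A show "coposinormal A"
    by (simp add: coposinormal_def)
qed

section \<open>Harmonic majorants and weighted composition operators\<close>

lemma of_real_cmod_square: "(complex_of_real (cmod z))\<^sup>2 = z * cnj z"
  using complex_norm_square[of z] by simp

lemma sums_shift: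
  fixes a :: "nat \<Rightarrow> complex"
  assumes "(\<lambda>n. a n * z ^ n) sums s"
  shows "(\<lambda>n. (case n of 0 \<Rightarrow> 0 | Suc m \<Rightarrow> a m) * z ^ n) sums (z * s)"
  using sums_mult[OF assms, of z]
    sums_Suc_iff[of "\<lambda>n. (case n of 0 \<Rightarrow> 0 | Suc m \<Rightarrow> a m) * z ^ n" "z * s"]
  by (simp add: mult_ac)

text \<open>Cauchy's formula as a mean over the circle: there the inverse of z^n is (cnj z)^n /
  r^(2n), and the factor 2 pi i z of the parametrised derivative cancels one more power of
  z.\<close>

lemma circlepath_taylor_coeff_has_integral:
  assumes f: "f holomorphic_on ball 0 1" and r: "0 < r" "r < 1"
  shows "((\<lambda>t. f (circlepath 0 r t) * cnj (circlepath 0 r t) ^ n) has_integral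
    taylor_coeff f n * complex_of_real r ^ (2 * n)) {0..1}"
proof -
  have "cball 0 r \<subseteq> ball (0::complex) 1"
    using r by auto
  then have "continuous_on (cball 0 r) f" "f holomorphic_on ball 0 r"
    using f holomorphic_on_subset[OF f] ball_subset_cball
    by (blast intro: holomorphic_on_imp_continuous_on)+
  from Cauchy_has_contour_integral_higher_derivative_circlepath[OF this, of 0 n]
  have "((\<lambda>t. f (circlepath 0 r t) / circlepath 0 r t ^ Suc n *
      vector_derivative (circlepath 0 r) (at t)) has_integral
      (2 * pi * \<i>) * taylor_coeff f n) {0..1}"
    using r by (simp add: has_contour_integral taylor_coeff_def fps_expansion_def)
  from has_integral_mult_right[OF this, of "complex_of_real r ^ (2 * n) / (2 * pi * \<i>)"]
  have "((\<lambda>t. complex_of_real r ^ (2 * n) / (2 * pi * \<i>) *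
      (f (circlepath 0 r t) / circlepath 0 r t ^ Suc n *
      vector_derivative (circlepath 0 r) (at t))) has_integral
      taylor_coeff f n * complex_of_real r ^ (2 * n)) {0..1}"
    by (simp add: field_simps)
  moreover have "complex_of_real r ^ (2 * n) / (2 * pi * \<i>) *
      (f (circlepath 0 r t) / circlepath 0 r t ^ Suc n *
      vector_derivative (circlepath 0 r) (at t)) =
      f (circlepath 0 r t) * cnj (circlepath 0 r t) ^ n" for t
  proof -
    define z where "z = circlepath 0 r t"
    have z: "vector_derivative (circlepath 0 r) (at t) = 2 * pi * \<i> * z"
      by (simp add: vector_derivative_circlepath z_def) (simp add: circlepath)
    have "cmod z = r"
      using r by (simp add: z_def circlepath norm_mult)
    then have "z * cnj z = (complex_of_real r)\<^sup>2" "z \<noteq> 0"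
      using r by (auto simp: complex_norm_square [symmetric])
    then have "complex_of_real r ^ (2 * n) = z ^ n * cnj z ^ n"
      by (simp add: power_mult power_mult_distrib [symmetric])
    then show ?thesis
      unfolding z z_def [symmetric] using \<open>z \<noteq> 0\<close> by (simp add: field_simps)
  qed
  ultimately show ?thesis
    by simp
qed

text \<open>With s the Taylor polynomial of G, |G - s|^2 \<ge> 0 gives 2 Re (G cnj s) - |s|^2 \<le>
  |G|^2 \<le> Re H. The mean of the left side over a circle is a finite sum, so no Parseval identity
  for G itself enters, and the mean of Re H is its value at 0. Then the radius tends to 1.\<close>

lemma sum_taylor_coeff_le_harmonic_majorant:
  assumes G: "G holomorphic_on ball 0 1" and H: "H holomorphic_on ball 0 1"
    and le: "\<And>z. z \<in> ball 0 1 \<Longrightarrow> (cmod (G z))\<^sup>2 \<le> Re (H z)"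
  shows "(\<Sum>n<N. (cmod (taylor_coeff G n))\<^sup>2) \<le> Re (H 0)"
proof -
  define a where "a n = (if n < N then taylor_coeff G n else 0)" for n
  define s where "s z = (\<Sum>n<N. taylor_coeff G n * z ^ n)" for z
  have s_sums: "(\<lambda>n. a n * z ^ n) sums s z" for z
    using sums_If_finite_set[of "{..<N}" "\<lambda>n. taylor_coeff G n * z ^ n"]
    by (simp add: a_def s_def if_distrib[of "\<lambda>x. x * _"] cong: if_cong)
  have s: "s holomorphic_on ball 0 1" "taylor_coeff s n = a n" for n
    using taylor_coeff_unique[of a s] s_sums by auto
  have rbound: "(\<Sum>n<N. (cmod (taylor_coeff G n))\<^sup>2 * r ^ (2 * n)) \<le> Re (H 0)"
    if r: "0 < r" "r < 1" for r
  proof -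
    let ?z = "circlepath 0 r"
    let ?S = "\<Sum>n<N. (cmod (taylor_coeff G n))\<^sup>2 * r ^ (2 * n)"
    have zb: "?z t \<in> ball 0 1" for t
      using r by (simp add: circlepath norm_mult)
    \<comment> \<open>Used with f = G and with f = s: both have the same first N coefficients, so
      both means equal \<open>?S\<close>.\<close>
    have ft: "((\<lambda>t. f (?z t) * cnj (s (?z t))) has_integral complex_of_real ?S) {0..1}"
      if f: "f holomorphic_on ball 0 1" "\<And>n. n < N \<Longrightarrow> taylor_coeff f n = taylor_coeff G n" for f
    proof -
      have "((\<lambda>t. \<Sum>n<N. cnj (taylor_coeff G n) * (f (?z t) * cnj (?z t) ^ n)) has_integral
          (\<Sum>n<N. cnj (taylor_coeff G n) * (taylor_coeff f n * complex_of_real r ^ (2 * n)))) {0..1}"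
        by (intro has_integral_sum has_integral_mult_right
            circlepath_taylor_coeff_has_integral f r) auto
      moreover have "(\<Sum>n<N. cnj (taylor_coeff G n) * (taylor_coeff f n * complex_of_real r ^ (2 * n)))
          = complex_of_real ?S"
        by (auto simp: f of_real_cmod_square mult_ac intro!: sum.cong)
      ultimately show ?thesis
        by (simp add: s_def sum_distrib_left mult_ac)
    qed
    have "((\<lambda>t. H (?z t)) has_integral H 0) {0..1}"
      using circlepath_taylor_coeff_has_integral[OF H r, of 0]
      by (simp add: taylor_coeff_def fps_expansion_def)
    then have 1: "((\<lambda>t. Re (H (?z t))) has_integral Re (H 0)) {0..1}"
      by (rule has_integral_Re)
    have "((\<lambda>t. 2 * (G (?z t) * cnj (s (?z t))) - s (?z t) * cnj (s (?z t))) has_integral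
        2 * complex_of_real ?S - complex_of_real ?S) {0..1}"
      by (intro has_integral_diff has_integral_mult_right ft G s(1)) (auto simp: s(2) a_def)
    from has_integral_Re[OF this]
    have 2: "((\<lambda>t. Re (2 * (G (?z t) * cnj (s (?z t))) - s (?z t) * cnj (s (?z t)))) has_integral
        ?S) {0..1}"
      by simp
    show ?thesis
    proof (rule has_integral_le[OF 2 1])
      fix t :: real
      have "0 \<le> (cmod (G (?z t) - s (?z t)))\<^sup>2"
        by simp
      also have "\<dots> = (cmod (G (?z t)))\<^sup>2 - Re (2 * (G (?z t) * cnj (s (?z t))) - s (?z t) * cnj (s (?z t)))"
        unfolding cmod_power2 by (simp add: power2_eq_square algebra_simps)
      finally show "Re (2 * (G (?z t) * cnj (s (?z t))) - s (?z t) * cnj (s (?z t))) \<le> Re (H (?z t))"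
        using le[OF zb] by (smt (verit))
    qed
  qed
  have "((\<lambda>r. \<Sum>n<N. (cmod (taylor_coeff G n))\<^sup>2 * r ^ (2 * n)) \<longlongrightarrow>
      (\<Sum>n<N. (cmod (taylor_coeff G n))\<^sup>2 * 1 ^ (2 * n))) (at_left (1::real))"
    by (intro tendsto_intros)
  moreover have "eventually (\<lambda>r. (\<Sum>n<N. (cmod (taylor_coeff G n))\<^sup>2 * r ^ (2 * n)) \<le> Re (H 0))
      (at_left (1::real))"
    using rbound by (intro eventually_at_leftI[of 0]) auto
  ultimately show ?thesis
    using tendsto_upperbound[of _ _ "at_left (1::real)"] by (force simp: trivial_limit_at_left_real)
qed

lemma hardy2_ext:
  assumes "\<And>z. z \<in> ball 0 1 \<Longrightarrow> hardy2_apply f z = hardy2_apply g z"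
  shows "f = g"
  by (metis assms ext hardy2_apply_inject hardy2_apply_outside)

lemma hardy2_apply_holomorphic: "hardy2_apply f holomorphic_on ball 0 1"
  using hardy2_apply[of f] by (simp add: hardy2_set_def)

lemma norm_hardy2_sq: "(norm f)\<^sup>2 = (\<Sum>n. (cmod (hardy2_coeff f n))\<^sup>2)"
  by (simp add: norm_hardy2_def suminf_nonneg summable_hardy2_coeff)

lemma hardy2_of_harmonic_majorant:
  assumes G: "G holomorphic_on ball 0 1" and H: "H holomorphic_on ball 0 1"
    and le: "\<And>z. z \<in> ball 0 1 \<Longrightarrow> (cmod (G z))\<^sup>2 \<le> Re (H z)"
  obtains q where "\<And>z. z \<in> ball 0 1 \<Longrightarrow> hardy2_apply q z = G z" "(norm q)\<^sup>2 \<le> Re (H 0)"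
proof -
  note bound = sum_taylor_coeff_le_harmonic_majorant[OF G H le]
  have "summable (\<lambda>n. (cmod (taylor_coeff G n))\<^sup>2)"
    by (rule bounded_imp_summable[where B = "Re (H 0)"])
      (use bound[of "Suc _"] in \<open>auto simp: lessThan_Suc_atMost\<close>)
  then obtain q where q: "hardy2_coeff q = taylor_coeff G"
    by (rule hardy2_of_coeff)
  have "hardy2_apply q z = G z" if z: "z \<in> ball 0 1" for z
  proof (rule sums_unique2[OF hardy2_apply_sums[OF z]])
    show "(\<lambda>n. hardy2_coeff q n * z ^ n) sums G z"
      unfolding q using holomorphic_power_series[OF G z]
      by (simp add: taylor_coeff_def fps_expansion_def)
  qed
  moreover have "(norm q)\<^sup>2 \<le> Re (H 0)"
    unfolding norm_hardy2_sq q
    by (rule suminf_le_const) (use \<open>summable _\<close> bound in auto)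
  ultimately show ?thesis
    using that by blast
qed

text \<open>Gives access to absolutely convergent series of vectors in H^2.\<close>

instance hardy2 :: banach ..

section \<open>The shift, reproducing kernels and harmonic majorants\<close>

lift_definition shift :: "hardy2 \<Rightarrow> hardy2" is "\<lambda>f z. z * f z"
proof -
  fix f :: "complex \<Rightarrow> complex" assume f: "f \<in> hardy2_set"
  define a where "a n = (case n of 0 \<Rightarrow> 0 | Suc m \<Rightarrow> taylor_coeff f m)" for n
  show "(\<lambda>z. z * f z) \<in> hardy2_set"
  proof (rule hardy2_setI[where a = a])
    show "(\<lambda>n. a n * z ^ n) sums (z * f z)" if "z \<in> ball 0 1" for z
      unfolding a_def by (rule sums_shift[OF hardy2_sums[OF f that]])
    show "summable (\<lambda>n. (cmod (a n))\<^sup>2)"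
      using f by (subst summable_Suc_iff [symmetric]) (simp add: a_def hardy2_set_def)
    show "z * f z = 0" if "z \<notin> ball 0 1" for z
      using f that by (simp add: hardy2_set_def)
  qed
qed

lemma hardy2_coeff_shift:
  "hardy2_coeff (shift f) n = (case n of 0 \<Rightarrow> 0 | Suc m \<Rightarrow> hardy2_coeff f m)"
  unfolding hardy2_coeff_def shift.rep_eq
by (rule taylor_coeff_unique(2)) (rule sums_shift[OF hardy2_sums[OF hardy2_apply]])

lemma cinner_shift: "cinner (shift f) (shift g) = cinner f g"
  unfolding cinner_hardy2_def
  using suminf_split_head[OF summable_cinner_hardy2, of "shift f" "shift g"]
  by (simp add: hardy2_coeff_shift)

lemma norm_shift [simp]: "norm (shift f) = norm f"
  by (simp add: norm_eq_sqrt_inner inner_eq_Re_cinner cinner_shift)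

lemma bounded_clinear_shift: "bounded_clinear shift"
proof (rule bounded_clinear_boundI[where K = 1])
  show "shift (f + g) = shift f + shift g" "shift (c *\<^sub>C f) = c *\<^sub>C shift f" for f g c
    by (transfer; simp add: algebra_simps)+
qed auto

lemma norm_shift_power: "norm ((shift ^^ n) f) = norm f"
  by (induction n) auto

text \<open>The Szego kernel. The choice operator absorbs the points off the disk, where the
  coefficients are not square summable.\<close>

definition kernel :: "complex \<Rightarrow> hardy2"
  where "kernel w = (SOME k. hardy2_coeff k = (\<lambda>n. cnj w ^ n))"

lemma hardy2_coeff_kernel:
  assumes "w \<in> ball 0 1"
  shows "hardy2_coeff (kernel w) n = cnj w ^ n"
proof -
  have "summable (\<lambda>n. ((cmod w)\<^sup>2) ^ n)"
    using assms by (intro summable_geometric) (simp add: abs_square_less_1)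
  then have "summable (\<lambda>n. (cmod (cnj w ^ n))\<^sup>2)"
    by (simp add: norm_power power_mult [symmetric] mult.commute)
  then obtain k where "hardy2_coeff k = (\<lambda>n. cnj w ^ n)"
    by (rule hardy2_of_coeff)
  then have "hardy2_coeff (kernel w) = (\<lambda>n. cnj w ^ n)"
    unfolding kernel_def by (rule someI)
  then show ?thesis
    by simp
qed

lemma cinner_kernel:
  assumes "w \<in> ball 0 1"
  shows "cinner f (kernel w) = hardy2_apply f w"
  using sums_unique[OF hardy2_apply_sums[OF assms, of f]]
  by (simp add: cinner_hardy2_def hardy2_coeff_kernel[OF assms])

lemma hardy2_apply_kernel:
  assumes "w \<in> ball 0 1" "z \<in> ball 0 1"
  shows "hardy2_apply (kernel w) z = 1 / (1 - cnj w * z)"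
proof -
  have "cmod (cnj w * z) < 1"
    using assms mult_strict_mono'[of "cmod w" 1 "cmod z" 1] by (simp add: norm_mult)
  from geometric_sums[OF this] hardy2_apply_sums[OF assms(2), of "kernel w"] show ?thesis
    by (simp add: hardy2_coeff_kernel[OF assms(1)] power_mult_distrib sums_unique2)
qed

text \<open>Cauchy-Schwarz against the kernel, whose squared norm is its own value 1 / (1 - |w|^2)
  at w. The rate of growth matters: it is too slow for a simple pole on the circle.\<close>

lemma cmod_hardy2_apply_le:
  assumes "w \<in> ball 0 1"
  shows "(1 - (cmod w)\<^sup>2) * (cmod (hardy2_apply f w))\<^sup>2 \<le> (norm f)\<^sup>2"
proof -
  have lt: "(cmod w)\<^sup>2 < 1"
    using assms by (simp add: abs_square_less_1)
  have "complex_of_real ((norm (kernel w))\<^sup>2) = hardy2_apply (kernel w) w"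
    by (simp only: cinner_self [symmetric] cinner_kernel[OF assms])
  also have "\<dots> = complex_of_real (1 / (1 - (cmod w)\<^sup>2))"
    using complex_norm_square[of w] by (simp add: hardy2_apply_kernel[OF assms assms] mult.commute)
  finally have k: "(norm (kernel w))\<^sup>2 = 1 / (1 - (cmod w)\<^sup>2)"
    by (simp only: of_real_eq_iff)
  have "cmod (hardy2_apply f w) \<le> norm f * norm (kernel w)"
    using cmod_cinner_le[of f "kernel w"] by (simp add: cinner_kernel[OF assms])
  then have "(cmod (hardy2_apply f w))\<^sup>2 \<le> (norm f * norm (kernel w))\<^sup>2"
    by (intro power_mono) auto
  then show ?thesis
    using lt by (simp add: power_mult_distrib k field_simps)
qed

text \<open>The least harmonic majorant of \<open>\<bar>f\<bar>\<^sup>2\<close> is the Poisson integral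
  \<open>w \<mapsto> (1 - \<bar>w\<bar>\<^sup>2) \<parallel>k\<parallel>\<^sup>2\<close> with \<open>k(z) = f(z) / (1 - cnj w * z)\<close>, which equals
  \<open>2 Re (cinner f k) - \<parallel>f\<parallel>\<^sup>2\<close>.\<close>

lemma hardy2_harmonic_majorant:
  obtains H where "H holomorphic_on ball 0 1" "Re (H 0) = (norm f)\<^sup>2"
    "\<And>w. w \<in> ball 0 1 \<Longrightarrow> (cmod (hardy2_apply f w))\<^sup>2 \<le> Re (H w)"
    "\<And>w. w \<in> ball 0 1 \<Longrightarrow> Re (H w) \<le> 2 / (1 - cmod w) * (norm f)\<^sup>2"
proof -
  define r where "r n = cinner f ((shift ^^ n) f)" for n
  define k where "k w = (\<Sum>n. cnj w ^ n *\<^sub>C (shift ^^ n) f)" for w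
  define U where "U w = cinner f (k w)" for w
  define H where "H w = 2 * U w - complex_of_real ((norm f)\<^sup>2)" for w
  have nk: "norm (cnj w ^ n *\<^sub>C (shift ^^ n) f) = cmod w ^ n * norm f" for w n
    by (simp add: norm_scaleC norm_shift_power norm_power)
  have smn: "summable (\<lambda>n. norm (cnj w ^ n *\<^sub>C (shift ^^ n) f))" if "w \<in> ball 0 1" for w
    unfolding nk using that by (intro summable_mult2 summable_geometric) auto
  have sm: "summable (\<lambda>n. cnj w ^ n *\<^sub>C (shift ^^ n) f)" if "w \<in> ball 0 1" for w
    using smn[OF that] by (rule summable_norm_cancel)
  have bl: "bounded_linear (cinner f)"
  proof (rule bounded_linear_intro[where K = "norm f"])
    show "norm (cinner f x) \<le> norm x * norm f" for x
      using cmod_cinner_le[of f x] by (simp add: mult.commute)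
  qed (simp_all add: cinner_add_right scaleR_scaleC cinner_scaleC_right scaleR_conv_of_real)
  have U_sums: "(\<lambda>n. r n * w ^ n) sums U w" if "w \<in> ball 0 1" for w
    using bounded_linear.sums[OF bl summable_sums[OF sm[OF that]]]
    by (simp add: r_def U_def k_def cinner_scaleC_right mult.commute)
  have bs: "bounded_linear (\<lambda>x. cnj w *\<^sub>C shift x)" for w
    by (rule bounded_linear_intro[where K = "cmod w"])
      (simp_all add: bounded_clinear_add[OF bounded_clinear_shift] scaleC_add_right scaleR_scaleC
        bounded_clinear_scaleC[OF bounded_clinear_shift] scaleC_scaleC norm_scaleC mult.commute)
  \<comment> \<open>Neumann series form of k (1 - cnj w z) = f.\<close>
  have k_eq: "k w = f + cnj w *\<^sub>C shift (k w)" if w: "w \<in> ball 0 1" for w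
  proof -
    have "(\<lambda>n. cnj w *\<^sub>C shift (cnj w ^ n *\<^sub>C (shift ^^ n) f)) sums (cnj w *\<^sub>C shift (k w))"
      unfolding k_def by (rule bounded_linear.sums[OF bs summable_sums[OF sm[OF w]]])
    then have "(\<lambda>n. cnj w ^ Suc n *\<^sub>C (shift ^^ Suc n) f) sums (cnj w *\<^sub>C shift (k w))"
      by (simp add: bounded_clinear_scaleC[OF bounded_clinear_shift] scaleC_scaleC)
    moreover have "1 *\<^sub>C f = f"
      using scaleR_scaleC[of 1 f] by simp
    ultimately have "(\<lambda>n. cnj w ^ n *\<^sub>C (shift ^^ n) f) sums (cnj w *\<^sub>C shift (k w) + f)"
      by (subst (asm) sums_Suc_iff) simp
    then show ?thesis
      by (simp add: k_def sums_iff add.commute)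
  qed
  \<comment> \<open>Substitute f = k - h with h = cnj w times the shift of k; the shift is
    isometric, so |h|^2 = |w|^2 |k|^2 in norm.\<close>
  have ReH: "Re (H w) = (1 - (cmod w)\<^sup>2) * (norm (k w))\<^sup>2" if w: "w \<in> ball 0 1" for w
  proof -
    define h where "h = cnj w *\<^sub>C shift (k w)"
    have f: "f = k w - h"
      using k_eq[OF w] by (simp add: h_def algebra_simps)
    have "inner h h = (cmod w)\<^sup>2 * inner (k w) (k w)"
      by (simp add: h_def norm_scaleC power_mult_distrib flip: power2_norm_eq_inner)
    moreover have "Re (H w) = 2 * inner (k w - h) (k w) - inner (k w - h) (k w - h)"
      using f by (simp add: H_def U_def inner_eq_Re_cinner [symmetric] power2_norm_eq_inner)
    ultimately show ?thesis
      by (simp add: inner_diff_left inner_diff_right inner_commute power2_norm_eq_inner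
          algebra_simps)
  qed
  have k_apply: "complex_of_real (1 - (cmod w)\<^sup>2) * hardy2_apply (k w) w = hardy2_apply f w"
    if w: "w \<in> ball 0 1" for w
  proof -
    have "hardy2_apply (k w) w = hardy2_apply f w + cnj w * (w * hardy2_apply (k w) w)"
      by (subst k_eq[OF w]) (simp add: plus_hardy2.rep_eq scaleC_hardy2.rep_eq shift.rep_eq)
    then show ?thesis
      using of_real_cmod_square[of w] by (simp add: algebra_simps)
  qed
  have k_norm: "norm (k w) \<le> 1 / (1 - cmod w) * norm f" if w: "w \<in> ball 0 1" for w
  proof -
    have "norm (k w) \<le> (\<Sum>n. norm (cnj w ^ n *\<^sub>C (shift ^^ n) f))"
      unfolding k_def by (rule summable_norm[OF smn[OF w]])
    also have "\<dots> = 1 / (1 - cmod w) * norm f"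
      unfolding nk using w suminf_mult2[OF summable_geometric[of "cmod w"], of "norm f"]
      by (simp add: suminf_geometric)
    finally show ?thesis .
  qed
  show ?thesis
  proof (rule that)
    have "U holomorphic_on ball 0 1"
      by (rule power_series_holomorphic[where a = r]) (use U_sums in auto)
    then show "H holomorphic_on ball 0 1"
      unfolding H_def by (intro holomorphic_intros)
    have "k 0 = f"
      using k_eq[of 0] scaleR_scaleC[of 0 "shift (k 0)"] by simp
    then show "Re (H 0) = (norm f)\<^sup>2"
      by (simp add: H_def U_def cinner_self)
    fix w :: complex assume w: "w \<in> ball 0 1"
    have lt: "(cmod w)\<^sup>2 < 1"
      using w by (simp add: abs_square_less_1)
    \<comment> \<open>Evaluating \<open>k w\<close> at w itself gives f(w) / (1 - |w|^2), so the
      growth bound for \<open>k w\<close> at w is exactly the majorant property.\<close>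
    have "(cmod (hardy2_apply f w))\<^sup>2 = (1 - (cmod w)\<^sup>2) * ((1 - (cmod w)\<^sup>2) * (cmod (hardy2_apply (k w) w))\<^sup>2)"
      using lt unfolding k_apply[OF w, symmetric] norm_mult norm_of_real
      by (simp add: power_mult_distrib) (simp add: power2_eq_square)
    also have "\<dots> \<le> (1 - (cmod w)\<^sup>2) * (norm (k w))\<^sup>2"
      using lt by (intro mult_left_mono cmod_hardy2_apply_le w) auto
    finally show "(cmod (hardy2_apply f w))\<^sup>2 \<le> Re (H w)"
      by (simp add: ReH[OF w])
    have "Re (H w) \<le> 2 * Re (U w)"
      by (simp add: H_def)
    also have "\<dots> \<le> 2 * (norm f * norm (k w))"
      using complex_Re_le_cmod[of "U w"] cmod_cinner_le[of f "k w"] by (simp add: U_def)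
    also have "\<dots> \<le> 2 * (norm f * (1 / (1 - cmod w) * norm f))"
      by (intro mult_left_mono k_norm w) auto
    finally show "Re (H w) \<le> 2 / (1 - cmod w) * (norm f)\<^sup>2"
      by (simp add: power2_eq_square)
  qed
qed

section \<open>Boundedness of weighted composition operators\<close>

definition weighted_composition ::
    "(complex \<Rightarrow> complex) \<Rightarrow> (complex \<Rightarrow> complex) \<Rightarrow> hardy2 \<Rightarrow> hardy2"
  where "weighted_composition g \<phi> f =
    (THE q. \<forall>z\<in>ball 0 1. hardy2_apply q z = g z * hardy2_apply f (\<phi> z))"

lemma composition_operator_weighted:
  "composition_operator \<phi> = weighted_composition (\<lambda>_. 1) \<phi>"
  by (simp add: fun_eq_iff composition_operator_def weighted_composition_def)

context
  fixes g \<phi> :: "complex \<Rightarrow> complex" and B :: real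
  assumes g: "g holomorphic_on ball 0 1" and g_bound: "\<And>z. z \<in> ball 0 1 \<Longrightarrow> cmod (g z) \<le> B"
    and \<phi>: "\<phi> holomorphic_on ball 0 1" and \<phi>_self: "\<phi> ` ball 0 1 \<subseteq> ball 0 1"
begin

text \<open>Littlewood subordination: a harmonic majorant of |f|^2 composed with
  \<open>\<phi>\<close> and multiplied by B^2 is a harmonic majorant of the weighted composite. Its
  value at 0 is controlled at the point \<open>\<phi>\<close> 0, which is the source of the
  constant.\<close>

lemma weighted_composition_exists:
  obtains q where "\<And>z. z \<in> ball 0 1 \<Longrightarrow> hardy2_apply q z = g z * hardy2_apply f (\<phi> z)"
    "norm q \<le> norm f * (B * sqrt (2 / (1 - cmod (\<phi> 0))))"
proof -
  obtain H where H: "H holomorphic_on ball 0 1"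
    "\<And>w. w \<in> ball 0 1 \<Longrightarrow> (cmod (hardy2_apply f w))\<^sup>2 \<le> Re (H w)"
    "\<And>w. w \<in> ball 0 1 \<Longrightarrow> Re (H w) \<le> 2 / (1 - cmod w) * (norm f)\<^sup>2"
    by (rule hardy2_harmonic_majorant[of f]) blast
  have B: "B \<ge> 0"
    using g_bound[of 0] norm_ge_zero[of "g 0"] by (simp del: norm_ge_zero)
  have comp: "(\<lambda>z. F (\<phi> z)) holomorphic_on ball 0 1" if "F holomorphic_on ball 0 1" for F
    using holomorphic_on_compose_gen[OF \<phi> that \<phi>_self] by (simp add: o_def)
  have \<phi>0: "\<phi> 0 \<in> ball 0 1"
    using \<phi>_self by (metis centre_in_ball imageI subsetD zero_less_one)
  obtain q where q: "\<And>z. z \<in> ball 0 1 \<Longrightarrow> hardy2_apply q z = g z * hardy2_apply f (\<phi> z)"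
    "(norm q)\<^sup>2 \<le> Re (complex_of_real (B\<^sup>2) * H (\<phi> 0))"
  proof (rule hardy2_of_harmonic_majorant)
    show "(\<lambda>z. g z * hardy2_apply f (\<phi> z)) holomorphic_on ball 0 1"
      by (intro holomorphic_intros g comp hardy2_apply_holomorphic)
    show "(\<lambda>z. complex_of_real (B\<^sup>2) * H (\<phi> z)) holomorphic_on ball 0 1"
      by (intro holomorphic_intros comp H)
    fix z :: complex assume z: "z \<in> ball 0 1"
    then have \<phi>z: "\<phi> z \<in> ball 0 1"
      using \<phi>_self by blast
    have "(cmod (g z * hardy2_apply f (\<phi> z)))\<^sup>2 = (cmod (g z))\<^sup>2 * (cmod (hardy2_apply f (\<phi> z)))\<^sup>2"
      by (simp add: norm_mult power_mult_distrib)
    also have "\<dots> \<le> B\<^sup>2 * Re (H (\<phi> z))"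
      by (intro mult_mono power_mono g_bound H(2) z \<phi>z) auto
    finally show "(cmod (g z * hardy2_apply f (\<phi> z)))\<^sup>2 \<le> Re (complex_of_real (B\<^sup>2) * H (\<phi> z))"
      by simp
  qed blast
  have "(norm q)\<^sup>2 \<le> B\<^sup>2 * (2 / (1 - cmod (\<phi> 0)) * (norm f)\<^sup>2)"
    using q(2) H(3)[OF \<phi>0] mult_left_mono[of "Re (H (\<phi> 0))" _ "B\<^sup>2"] by fastforce
  also have "\<dots> = (norm f * (B * sqrt (2 / (1 - cmod (\<phi> 0)))))\<^sup>2"
    using \<phi>0 by (simp add: power_mult_distrib)
  finally have "norm q \<le> norm f * (B * sqrt (2 / (1 - cmod (\<phi> 0))))"
    using B \<phi>0 by (auto intro: power2_le_imp_le)
  with q(1) show ?thesis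
    using that by blast
qed

lemma weighted_composition:
  "z \<in> ball 0 1 \<Longrightarrow> hardy2_apply (weighted_composition g \<phi> f) z = g z * hardy2_apply f (\<phi> z)"
  "norm (weighted_composition g \<phi> f) \<le> norm f * (B * sqrt (2 / (1 - cmod (\<phi> 0))))"
proof -
  obtain q where q: "\<And>z. z \<in> ball 0 1 \<Longrightarrow> hardy2_apply q z = g z * hardy2_apply f (\<phi> z)"
    "norm q \<le> norm f * (B * sqrt (2 / (1 - cmod (\<phi> 0))))"
    by (rule weighted_composition_exists[of f]) blast
  have "weighted_composition g \<phi> f = q"
    unfolding weighted_composition_def using q(1) by (intro the_equality) (auto intro: hardy2_ext)
  with q show "z \<in> ball 0 1 \<Longrightarrow>
      hardy2_apply (weighted_composition g \<phi> f) z = g z * hardy2_apply f (\<phi> z)"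
    "norm (weighted_composition g \<phi> f) \<le> norm f * (B * sqrt (2 / (1 - cmod (\<phi> 0))))"
    by auto
qed

lemma bounded_clinear_weighted_composition: "bounded_clinear (weighted_composition g \<phi>)"
proof (rule bounded_clinear_boundI)
  show "weighted_composition g \<phi> (f + h) = weighted_composition g \<phi> f + weighted_composition g \<phi> h"
    for f h
    by (rule hardy2_ext) (simp add: weighted_composition(1) plus_hardy2.rep_eq algebra_simps)
  show "weighted_composition g \<phi> (c *\<^sub>C f) = c *\<^sub>C weighted_composition g \<phi> f" for c f
    by (rule hardy2_ext) (simp add: weighted_composition(1) scaleC_hardy2.rep_eq algebra_simps)
qed (rule weighted_composition(2))

end

section \<open>Linear-fractional composition operators and Cowen's adjoint formula\<close>

definition linfrac :: "complex \<Rightarrow> complex \<Rightarrow> complex \<Rightarrow> complex \<Rightarrow> complex \<Rightarrow> complex"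
  where "linfrac a b c d z = (a * z + b) / (c * z + d)"

text \<open>The set where the inequality fails is open; if it meets the closed disk, it contains
  infinitely many points of the open disk. Each of them satisfies the premise of \<open>test\<close>
  for some s in the disk, but u y + v has at most one root.\<close>

lemma cmod_linfrac_le_extend:
  fixes P Q R S u v :: complex
  assumes uv: "u \<noteq> 0 \<or> v \<noteq> 0"
    and test: "\<And>y s. y \<in> ball 0 1 \<Longrightarrow> s \<in> ball 0 1 \<Longrightarrow> R * y + S = cnj s * (P * y + Q) \<Longrightarrow> u * y + v = 0"
    and y: "cmod y \<le> 1"
  shows "cmod (P * y + Q) \<le> cmod (R * y + S)"
proof (rule ccontr)
  define U where "U = {y. cmod (R * y + S) < cmod (P * y + Q)}"
  assume "\<not> cmod (P * y + Q) \<le> cmod (R * y + S)"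
  then have "y \<in> U"
    by (simp add: U_def)
  have "open U"
    unfolding U_def by (intro open_Collect_less continuous_intros)
  have "y \<in> closure (ball 0 1)"
    using y by simp
  then have "U \<inter> ball 0 1 \<noteq> {}"
    using \<open>open U\<close> \<open>y \<in> U\<close> open_Int_closure_eq_empty by blast
  moreover have "open (U \<inter> ball 0 1)"
    using \<open>open U\<close> by auto
  ultimately have "infinite (U \<inter> ball 0 1)"
    using finite_imp_not_open by blast
  moreover have "U \<inter> ball 0 1 \<subseteq> {- v / u}"
  proof
    fix z assume z: "z \<in> U \<inter> ball 0 1"
    define s where "s = cnj ((R * z + S) / (P * z + Q))"
    have "cmod (R * z + S) < cmod (P * z + Q)"
      using z by (simp add: U_def)
    then have "P * z + Q \<noteq> 0"
      by auto
    moreover from this have "s \<in> ball 0 1"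
      using \<open>cmod (R * z + S) < _\<close>
      unfolding s_def mem_ball_0 complex_mod_cnj norm_divide by (simp add: divide_less_eq)
    ultimately have "u * z + v = 0"
      using z by (intro test[of z s]) (auto simp: s_def)
    with uv show "z \<in> {- v / u}"
      by (cases "u = 0") (auto simp: field_simps add_eq_0_iff)
  qed
  ultimately show False
    using finite_subset by blast
qed

text \<open>The selfmap property is cross-multiplied, so it carries over to homogeneous coordinates;
  the strict inequality also excludes a zero of the denominator in the disk.\<close>

locale linfrac_selfmap =
  fixes a b c d :: complex
  assumes self: "\<And>z. cmod z < 1 \<Longrightarrow> cmod (a * z + b) < cmod (c * z + d)"
    and det: "a * d - b * c \<noteq> 0"
begin

lemma self_closed:
  assumes "cmod z \<le> 1"
  shows "cmod (a * z + b) \<le> cmod (c * z + d)"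
proof -
  have "closed {z. cmod (a * z + b) \<le> cmod (c * z + d)}"
    by (intro closed_Collect_le continuous_intros)
  moreover have "ball 0 1 \<subseteq> {z. cmod (a * z + b) \<le> cmod (c * z + d)}"
    using self by (auto intro: less_imp_le)
  ultimately have "closure (ball 0 1) \<subseteq> {z. cmod (a * z + b) \<le> cmod (c * z + d)}"
    by (rule closure_minimal[rotated])
  then show ?thesis
    using assms by (auto simp: subset_iff)
qed

lemma b_less_d: "cmod b < cmod d"
  using self[of 0] by simp

text \<open>At a pole in the closed disk the weak inequality would make the numerator vanish as
  well, contradicting the determinant.\<close>

lemma c_less_d: "cmod c < cmod d"
proof (rule ccontr)
  assume le: "\<not> cmod c < cmod d"
  with b_less_d have c: "c \<noteq> 0"
    by auto
  define z where "z = - d / c"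
  have d: "d = - c * z"
    using c by (simp add: z_def)
  have "cmod z \<le> 1"
    using le c by (simp add: z_def norm_divide divide_le_eq)
  from self_closed[OF this] have "b = - a * z"
    by (simp add: d add_eq_0_iff)
  with d det show False
    by simp
qed

lemma den_bound: "cmod z \<le> 1 \<Longrightarrow> cmod d - cmod c \<le> cmod (c * z + d)"
proof -
  assume "cmod z \<le> 1"
  then have "cmod (c * z) \<le> cmod c"
    by (simp add: norm_mult mult_left_le)
  moreover have "cmod d - cmod (c * z) \<le> cmod (c * z + d)"
    by (metis add.commute norm_diff_ineq)
  ultimately show ?thesis
    by linarith
qed

lemma den_nonzero: "cmod z \<le> 1 \<Longrightarrow> c * z + d \<noteq> 0"
  using den_bound[of z] c_less_d by auto

lemma linfrac_in_ball: "z \<in> ball 0 1 \<Longrightarrow> linfrac a b c d z \<in> ball 0 1"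
  using self[of z] den_nonzero[of z] by (simp add: linfrac_def norm_divide divide_less_eq)

lemma linfrac_image: "linfrac a b c d ` ball 0 1 \<subseteq> ball 0 1"
  using linfrac_in_ball by blast

lemma linfrac_holomorphic: "linfrac a b c d holomorphic_on ball 0 1"
  unfolding linfrac_def using den_nonzero by (intro holomorphic_intros) auto

lemma linfrac_inj: "inj_on (linfrac a b c d) (ball 0 1)"
proof (rule inj_onI)
  fix x y assume xy: "x \<in> ball 0 1" "y \<in> ball 0 1" "linfrac a b c d x = linfrac a b c d y"
  then have "(a * x + b) * (c * y + d) = (a * y + b) * (c * x + d)"
    using den_nonzero[of x] den_nonzero[of y] by (simp add: linfrac_def frac_eq_eq)
  then have "(a * d - b * c) * (x - y) = 0"
    by algebra
  with det show "x = y"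
    by simp
qed

text \<open>Identities checked at image points spread to the whole disk, because the image is open.
  This is how functions known only on the image are shown to have forbidden poles.\<close>

lemma linfrac_image_identity:
  assumes "F holomorphic_on ball 0 1" "G holomorphic_on ball 0 1"
    and "\<And>z. z \<in> ball 0 1 \<Longrightarrow> F (linfrac a b c d z) = G (linfrac a b c d z)"
    and "y \<in> ball 0 1"
  shows "F y = G y"
proof (rule analytic_continuation_open[of "linfrac a b c d ` ball 0 1" "ball 0 1" F G])
  show "open (linfrac a b c d ` ball 0 1)"
    by (rule open_mapping_thm3[OF linfrac_holomorphic open_ball linfrac_inj])
qed (use assms linfrac_image in auto)

text \<open>If the adjoint map sent z to a point X / Y outside the open disk, then s = cnj (Y / X)
  would lie in the closed disk while the original map sends s to 1 / cnj z, outside the closed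
  disk.\<close>

lemma adjoint_selfmap: "linfrac_selfmap (cnj a) (- cnj c) (- cnj b) (cnj d)"
proof
  show "cnj a * cnj d - - cnj c * - cnj b \<noteq> 0"
    using det by (metis complex_cnj_diff complex_cnj_mult complex_cnj_zero_iff minus_mult_minus
        mult.commute)
  fix z assume z: "cmod z < 1"
  show "cmod (cnj a * z + - cnj c) < cmod (- cnj b * z + cnj d)"
  proof (rule ccontr)
    define X Y where "X = cnj a * z - cnj c" and "Y = cnj d - cnj b * z"
    assume "\<not> cmod (cnj a * z + - cnj c) < cmod (- cnj b * z + cnj d)"
    then have le: "cmod Y \<le> cmod X"
      by (simp add: X_def Y_def)
    have "cmod (cnj b * z) \<le> cmod b"
      using z by (simp add: norm_mult mult_left_le)
    then have "Y \<noteq> 0"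
      using b_less_d by (metis Y_def complex_mod_cnj eq_iff_diff_eq_0 leD)
    then have "X \<noteq> 0"
      using le by auto
    define s where "s = cnj (Y / X)"
    have s: "cmod s \<le> 1"
      using le \<open>X \<noteq> 0\<close> by (simp add: s_def norm_divide divide_le_eq)
    have "cnj s * X = Y"
      using \<open>X \<noteq> 0\<close> by (simp add: s_def)
    then have "cnj (cnj s * X) = cnj Y"
      by simp
    then have eq: "c * s + d = cnj z * (a * s + b)"
      by (simp add: X_def Y_def algebra_simps)
    have "a * s + b \<noteq> 0"
      using eq den_nonzero[OF s] by auto
    then have "cmod (c * s + d) < cmod (a * s + b)"
      unfolding eq using z by (simp add: norm_mult)
    then show False
      using self_closed[OF s] by simp
  qed
qed

end

section \<open>The adjoint formula and the comparison of ranges\<close>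

locale linfrac_composition = linfrac_selfmap a b c d +
  adj: linfrac_selfmap "cnj a" "- cnj c" "- cnj b" "cnj d" for a b c d
begin

abbreviation \<phi> where "\<phi> \<equiv> linfrac a b c d"
abbreviation \<sigma> where "\<sigma> \<equiv> linfrac (cnj a) (- cnj c) (- cnj b) (cnj d)"
abbreviation C\<^sub>\<phi> where "C\<^sub>\<phi> \<equiv> composition_operator \<phi>"

lemma composition_operator_apply:
  "z \<in> ball 0 1 \<Longrightarrow> hardy2_apply (C\<^sub>\<phi> f) z = hardy2_apply f (\<phi> z)"
  using weighted_composition(1)[of "\<lambda>_. 1" 1, OF _ _ linfrac_holomorphic linfrac_image]
  by (simp add: composition_operator_weighted)

lemma bounded_clinear_composition_operator: "bounded_clinear C\<^sub>\<phi>"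
  unfolding composition_operator_weighted
  by (rule bounded_clinear_weighted_composition[where B = 1])
    (use linfrac_holomorphic linfrac_image in auto)

lemma cadjoint_composition_kernel:
  assumes s: "s \<in> ball 0 1"
  shows "cadjoint C\<^sub>\<phi> (kernel s) = kernel (\<phi> s)"
  by (rule cinner_eqI)
    (simp only: cinner_cadjoint[OF bounded_clinear_composition_operator, symmetric]
      cinner_kernel[OF s] cinner_kernel[OF linfrac_in_ball[OF s]] composition_operator_apply[OF s])

text \<open>Multiplication by the denominator of \<open>\<phi>\<close>; it appears, through its
  adjoint, as the rightmost factor in Cowen's formula. The multiplier \<open>M\<^sub>h'\<close>
  inverts it, since the denominator is bounded away from 0.\<close>

definition M\<^sub>h where "M\<^sub>h = weighted_composition (\<lambda>z. c * z + d) (\<lambda>z. z)"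
definition M\<^sub>h' where "M\<^sub>h' = weighted_composition (\<lambda>z. 1 / (c * z + d)) (\<lambda>z. z)"

lemma M\<^sub>h:
  "z \<in> ball 0 1 \<Longrightarrow> hardy2_apply (M\<^sub>h f) z = (c * z + d) * hardy2_apply f z"
  "bounded_clinear M\<^sub>h"
proof -
  have bound: "cmod (c * z + d) \<le> cmod c + cmod d" if "z \<in> ball 0 1" for z
  proof -
    have "cmod (c * z + d) \<le> cmod (c * z) + cmod d"
      by (rule norm_triangle_ineq)
    also have "cmod (c * z) \<le> cmod c"
      using that by (simp add: norm_mult mult_left_le)
    finally show ?thesis
      by simp
  qed
  have hol: "(\<lambda>z. c * z + d) holomorphic_on ball 0 1" "(\<lambda>z. z) holomorphic_on ball 0 1"
    by (intro holomorphic_intros)+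
  show "z \<in> ball 0 1 \<Longrightarrow> hardy2_apply (M\<^sub>h f) z = (c * z + d) * hardy2_apply f z"
    "bounded_clinear M\<^sub>h"
    unfolding M\<^sub>h_def
    by (rule weighted_composition(1)[OF hol(1) bound hol(2)]; simp)
      (rule bounded_clinear_weighted_composition[OF hol(1) bound hol(2)]; simp)
qed

lemma M\<^sub>h':
  "z \<in> ball 0 1 \<Longrightarrow> hardy2_apply (M\<^sub>h' f) z = 1 / (c * z + d) * hardy2_apply f z"
  "bounded_clinear M\<^sub>h'"
proof -
  have bound: "cmod (1 / (c * z + d)) \<le> 1 / (cmod d - cmod c)" if "z \<in> ball 0 1" for z
    using den_bound[of z] c_less_d that by (simp add: norm_divide frac_le)
  have hol: "(\<lambda>z. 1 / (c * z + d)) holomorphic_on ball 0 1" "(\<lambda>z. z) holomorphic_on ball 0 1"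
    using den_nonzero by (auto intro!: holomorphic_intros)
  show "z \<in> ball 0 1 \<Longrightarrow> hardy2_apply (M\<^sub>h' f) z = 1 / (c * z + d) * hardy2_apply f z"
    "bounded_clinear M\<^sub>h'"
    unfolding M\<^sub>h'_def
    by (rule weighted_composition(1)[OF hol(1) bound hol(2)]; simp)
      (rule bounded_clinear_weighted_composition[OF hol(1) bound hol(2)]; simp)
qed

lemma cadjoint_M\<^sub>h_inverse: "cadjoint M\<^sub>h (cadjoint M\<^sub>h' f) = f"
proof (rule cinner_eqI)
  fix q
  have "M\<^sub>h' (M\<^sub>h q) = q"
    by (rule hardy2_ext) (use den_nonzero in \<open>simp add: M\<^sub>h(1) M\<^sub>h'(1)\<close>)
  then show "cinner q (cadjoint M\<^sub>h (cadjoint M\<^sub>h' f)) = cinner q f"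
    by (simp add: cinner_cadjoint[OF M\<^sub>h(2), symmetric] cinner_cadjoint[OF M\<^sub>h'(2), symmetric])
qed

text \<open>Cowen's formula for the adjoint of a linear-fractional composition operator.\<close>

lemma cadjoint_composition_operator_apply:
  assumes z: "z \<in> ball 0 1"
  shows "hardy2_apply (cadjoint C\<^sub>\<phi> f) z =
    1 / (cnj d - cnj b * z) * hardy2_apply (cadjoint M\<^sub>h f) (\<sigma> z)"
proof -
  define g where "g = 1 / (cnj d - cnj b * z)"
  have den: "cnj d - cnj b * z \<noteq> 0"
    using adj.den_nonzero[of z] z by simp
  have \<sigma>z: "\<sigma> z \<in> ball 0 1"
    by (rule adj.linfrac_in_ball[OF z])
  \<comment> \<open>Both kernels have the numerator c x + d - cnj z (a x + b) in their denominators;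
    this is what singles out \<open>\<sigma>\<close>.\<close>
  have eq: "C\<^sub>\<phi> (kernel z) = cnj g *\<^sub>C M\<^sub>h (kernel (\<sigma> z))"
  proof (rule hardy2_ext)
    fix x :: complex assume x: "x \<in> ball 0 1"
    have n1: "c * x + d \<noteq> 0"
      using den_nonzero[of x] x by simp
    have n2: "d - b * cnj z \<noteq> 0"
      using den by (metis complex_cnj_cnj complex_cnj_diff complex_cnj_mult complex_cnj_zero_iff)
    have e1: "1 - cnj z * \<phi> x = (c * x + d - cnj z * (a * x + b)) / (c * x + d)"
      using n1 by (simp add: linfrac_def field_simps)
    have e2: "1 - cnj (\<sigma> z) * x = (c * x + d - cnj z * (a * x + b)) / (d - b * cnj z)"
      using n2 by (simp add: linfrac_def field_simps)
    show "hardy2_apply (C\<^sub>\<phi> (kernel z)) x = hardy2_apply (cnj g *\<^sub>C M\<^sub>h (kernel (\<sigma> z))) x"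
      using n1 n2
      by (simp only: composition_operator_apply[OF x] hardy2_apply_kernel[OF z linfrac_in_ball[OF x]]
          scaleC_hardy2.rep_eq M\<^sub>h(1)[OF x] hardy2_apply_kernel[OF \<sigma>z x] e1 e2)
        (simp add: g_def)
  qed
  have "hardy2_apply (cadjoint C\<^sub>\<phi> f) z = cinner f (C\<^sub>\<phi> (kernel z))"
    by (simp only: cinner_kernel[OF z, symmetric]
        cinner_cadjoint'[OF bounded_clinear_composition_operator])
  also have "\<dots> = g * hardy2_apply (cadjoint M\<^sub>h f) (\<sigma> z)"
    by (simp only: eq cinner_scaleC_right complex_cnj_cnj cinner_cadjoint'[OF M\<^sub>h(2), symmetric]
        cinner_kernel[OF \<sigma>z])
  finally show ?thesis
    by (simp add: g_def)
qed

text \<open>Solves f o \<open>\<phi>\<close> = g (W f o \<open>\<sigma>\<close>) for W. The matrix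
  \<open>P\<close>, \<open>Q\<close>, \<open>R\<close>, \<open>S\<close> is that of
  \<open>\<phi>\<close> times the adjugate of that of \<open>\<sigma>\<close>, and the weight is 1 /
  g transported by the inverse of \<open>\<sigma>\<close>; |b| < |a| keeps it bounded.\<close>

lemma posinormal_compositionI:
  assumes ba: "cmod b < cmod a"
    and X: "\<And>x y. cmod (cnj a * x - cnj c * y) < cmod (cnj d * y - cnj b * x) \<Longrightarrow>
      cmod (a * x + b * y) < cmod (c * x + d * y)"
  shows "posinormal C\<^sub>\<phi>"
proof -
  define \<Delta> where "\<Delta> = cnj (a * d - b * c)"
  have \<Delta>: "\<Delta> \<noteq> 0" "\<Delta> = cnj a * cnj d - cnj b * cnj c"
    using det by (simp_all add: \<Delta>_def del: complex_cnj_diff) (simp add: algebra_simps)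
  define P Q R S where "P = a * cnj d + b * cnj b" and "Q = a * cnj c + b * cnj a"
    and "R = c * cnj d + d * cnj b" and "S = c * cnj c + d * cnj a"
  interpret \<chi>: linfrac_selfmap P Q R S
  proof
    show "P * S - Q * R \<noteq> 0"
    proof -
      have "P * S - Q * R = (a * d - b * c) * \<Delta>"
        unfolding P_def Q_def R_def S_def \<Delta> by algebra
      with \<Delta>(1) det show ?thesis
        by simp
    qed
    fix z assume z: "cmod z < 1"
    \<comment> \<open>The vector fed to \<open>X\<close> is the adjugate of the matrix of
      \<open>\<sigma>\<close> applied to (z, 1), so \<open>\<sigma>\<close> returns it to
      \<open>\<Delta>\<close> times (z, 1).\<close>
    have "cnj a * (cnj d * z + cnj c) - cnj c * (cnj b * z + cnj a) = \<Delta> * z"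
      "cnj d * (cnj b * z + cnj a) - cnj b * (cnj d * z + cnj c) = \<Delta>"
      unfolding \<Delta> by algebra+
    then have "cmod (a * (cnj d * z + cnj c) + b * (cnj b * z + cnj a)) <
        cmod (c * (cnj d * z + cnj c) + d * (cnj b * z + cnj a))"
      using z \<Delta>(1) by (intro X) (simp add: norm_mult)
    then show "cmod (P * z + Q) < cmod (R * z + S)"
      by (simp add: P_def Q_def R_def S_def algebra_simps)
  qed
  have wden: "cmod a - cmod b \<le> cmod (cnj b * z + cnj a)" if "z \<in> ball 0 1" for z
  proof -
    have "cmod (cnj b * z) \<le> cmod b"
      using that by (simp add: norm_mult mult_left_le)
    then show ?thesis
      using norm_diff_ineq[of "cnj a" "cnj b * z"] by (simp add: add.commute)
  qed
  have wbound: "cmod (\<Delta> / (cnj b * z + cnj a)) \<le> cmod \<Delta> / (cmod a - cmod b)" if "z \<in> ball 0 1" for z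
    using wden[OF that] ba by (simp add: norm_divide frac_le)
  have "cnj b * z + cnj a \<noteq> 0" if "z \<in> ball 0 1" for z
    using wden[OF that] ba by auto
  then have whol: "(\<lambda>z. \<Delta> / (cnj b * z + cnj a)) holomorphic_on ball 0 1"
    by (intro holomorphic_intros) auto
  define W where "W = weighted_composition (\<lambda>z. \<Delta> / (cnj b * z + cnj a)) (linfrac P Q R S)"
  have W: "bounded_clinear W"
    unfolding W_def by (rule bounded_clinear_weighted_composition[OF whol wbound
      \<chi>.linfrac_holomorphic \<chi>.linfrac_image])
  have W_apply: "hardy2_apply (W f) z = \<Delta> / (cnj b * z + cnj a) * hardy2_apply f (linfrac P Q R S z)"
    if "z \<in> ball 0 1" for f z
    unfolding W_def by (rule weighted_composition(1)[OF whol wbound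
      \<chi>.linfrac_holomorphic \<chi>.linfrac_image that])
  show ?thesis
  proof (rule posinormal_if_factors[OF bounded_clinear_composition_operator
        bounded_clinear_compose[OF bounded_clinear_cadjoint[OF M\<^sub>h'(2)] W]])
    fix f
    show "C\<^sub>\<phi> f = cadjoint C\<^sub>\<phi> (cadjoint M\<^sub>h' (W f))"
    proof (rule hardy2_ext)
      fix z :: complex assume z: "z \<in> ball 0 1"
      define e where "e = cnj d - cnj b * z"
      have e: "e \<noteq> 0"
        using adj.den_nonzero[of z] z by (simp add: e_def)
      have \<sigma>: "\<sigma> z = (cnj a * z - cnj c) / e"
        by (simp add: linfrac_def e_def)
      have 1: "cnj b * \<sigma> z + cnj a = \<Delta> / e"
        unfolding \<sigma> using e by (simp add: field_simps) (simp add: e_def \<Delta>(2) algebra_simps)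
      have 2: "P * \<sigma> z + Q = \<Delta> * (a * z + b) / e"
        unfolding \<sigma> using e
        by (simp add: field_simps) (simp add: e_def \<Delta>(2) P_def Q_def algebra_simps)
      have 3: "R * \<sigma> z + S = \<Delta> * (c * z + d) / e"
        unfolding \<sigma> using e
        by (simp add: field_simps) (simp add: e_def \<Delta>(2) R_def S_def algebra_simps)
      have 4: "linfrac P Q R S (\<sigma> z) = \<phi> z"
        unfolding linfrac_def[of P] 2 3 using e \<Delta>(1) by (simp add: linfrac_def)
      have "hardy2_apply (cadjoint C\<^sub>\<phi> (cadjoint M\<^sub>h' (W f))) z = hardy2_apply f (\<phi> z)"
        unfolding cadjoint_composition_operator_apply[OF z] cadjoint_M\<^sub>h_inverse
          W_apply[OF adj.linfrac_in_ball[OF z]] 1 4 e_def [symmetric]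
        using e \<Delta>(1) by simp
      then show "hardy2_apply (C\<^sub>\<phi> f) z = hardy2_apply (cadjoint C\<^sub>\<phi> (cadjoint M\<^sub>h' (W f))) z"
        by (simp add: composition_operator_apply[OF z])
    qed
  qed
qed

text \<open>Solves g (F o \<open>\<sigma>\<close>) = (W F) o \<open>\<phi>\<close> for W. Now the
  matrix is that of \<open>\<sigma>\<close> times the adjugate of that of \<open>\<phi>\<close>, and
  the weight is g transported by the inverse of \<open>\<phi>\<close>. Its denominator is bounded
  below because the composite is a selfmap.\<close>

lemma coposinormal_compositionI:
  assumes Y: "\<And>x y. cmod (a * x + b * y) < cmod (c * x + d * y) \<Longrightarrow>
      cmod (cnj a * x - cnj c * y) < cmod (cnj d * y - cnj b * x)"
  shows "coposinormal C\<^sub>\<phi>"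
proof -
  define \<Delta> where "\<Delta> = a * d - b * c"
  have \<Delta>: "\<Delta> \<noteq> 0"
    using det by (simp add: \<Delta>_def)
  define P Q R S where "P = cnj a * d + cnj c * c" and "Q = - cnj a * b - cnj c * a"
    and "R = - (cnj b * d + cnj d * c)" and "S = cnj b * b + cnj d * a"
  interpret \<psi>: linfrac_selfmap P Q R S
  proof
    show "P * S - Q * R \<noteq> 0"
    proof -
      have "P * S - Q * R = cnj \<Delta> * \<Delta>"
        unfolding P_def Q_def R_def S_def \<Delta>_def by (simp add: algebra_simps)
      with \<Delta> show ?thesis
        by simp
    qed
    fix z assume z: "cmod z < 1"
    have "a * (d * z - b) + b * (a - c * z) = \<Delta> * z" "c * (d * z - b) + d * (a - c * z) = \<Delta>"
      unfolding \<Delta>_def by algebra+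
    then have "cmod (cnj a * (d * z - b) - cnj c * (a - c * z)) <
        cmod (cnj d * (a - c * z) - cnj b * (d * z - b))"
      using z \<Delta> by (intro Y) (simp add: norm_mult)
    then show "cmod (P * z + Q) < cmod (R * z + S)"
      by (simp add: P_def Q_def R_def S_def algebra_simps)
  qed
  have wbound: "cmod ((a - c * z) / (R * z + S)) \<le> (cmod a + cmod c) / (cmod S - cmod R)"
    if "z \<in> ball 0 1" for z
    unfolding norm_divide
  proof (rule frac_le)
    have "cmod (a - c * z) \<le> cmod a + cmod (c * z)"
      by (rule norm_triangle_ineq4)
    also have "cmod (c * z) \<le> cmod c"
      using that by (simp add: norm_mult mult_left_le)
    finally show "cmod (a - c * z) \<le> cmod a + cmod c"
      by simp
  qed (use \<psi>.den_bound[of z] \<psi>.c_less_d that in auto)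
  have whol: "(\<lambda>z. (a - c * z) / (R * z + S)) holomorphic_on ball 0 1"
    using \<psi>.den_nonzero by (intro holomorphic_intros) auto
  define W where "W = weighted_composition (\<lambda>z. (a - c * z) / (R * z + S)) (linfrac P Q R S)"
  have W: "bounded_clinear W"
    unfolding W_def by (rule bounded_clinear_weighted_composition[OF whol wbound
      \<psi>.linfrac_holomorphic \<psi>.linfrac_image])
  have W_apply: "hardy2_apply (W f) z = (a - c * z) / (R * z + S) * hardy2_apply f (linfrac P Q R S z)"
    if "z \<in> ball 0 1" for f z
    unfolding W_def by (rule weighted_composition(1)[OF whol wbound
      \<psi>.linfrac_holomorphic \<psi>.linfrac_image that])
  note C = bounded_clinear_composition_operator
  have "posinormal (cadjoint C\<^sub>\<phi>)"
  proof (rule posinormal_if_factors[OF bounded_clinear_cadjoint[OF C]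
        bounded_clinear_compose[OF W bounded_clinear_cadjoint[OF M\<^sub>h(2)]]], unfold cadjoint_cadjoint[OF C])
    fix f
    show "cadjoint C\<^sub>\<phi> f = C\<^sub>\<phi> (W (cadjoint M\<^sub>h f))"
    proof (rule hardy2_ext)
      fix z :: complex assume z: "z \<in> ball 0 1"
      define e where "e = cnj d - cnj b * z"
      define h where "h = c * z + d"
      have e: "e \<noteq> 0"
        using adj.den_nonzero[of z] z by (simp add: e_def)
      have h: "h \<noteq> 0"
        using den_nonzero[of z] z by (simp add: h_def)
      have \<phi>: "\<phi> z = (a * z + b) / h"
        by (simp add: linfrac_def h_def)
      have 1: "a - c * \<phi> z = \<Delta> / h"
        unfolding \<phi> using h by (simp add: field_simps) (simp add: h_def \<Delta>_def algebra_simps)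
      have 2: "P * \<phi> z + Q = \<Delta> * (cnj a * z - cnj c) / h"
        unfolding \<phi> using h
        by (simp add: field_simps) (simp add: h_def \<Delta>_def P_def Q_def algebra_simps)
      have 3: "R * \<phi> z + S = \<Delta> * e / h"
        unfolding \<phi> using h
        by (simp add: field_simps) (simp add: h_def e_def \<Delta>_def R_def S_def algebra_simps)
      have 4: "linfrac P Q R S (\<phi> z) = \<sigma> z"
        unfolding linfrac_def[of P] 2 3 using h e \<Delta> by (simp add: linfrac_def e_def)
      have "hardy2_apply (C\<^sub>\<phi> (W (cadjoint M\<^sub>h f))) z = 1 / e * hardy2_apply (cadjoint M\<^sub>h f) (\<sigma> z)"
        unfolding composition_operator_apply[OF z] W_apply[OF linfrac_in_ball[OF z]] 1 3 4
        using e h \<Delta> by simp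
      then show "hardy2_apply (cadjoint C\<^sub>\<phi> f) z = hardy2_apply (C\<^sub>\<phi> (W (cadjoint M\<^sub>h f))) z"
        by (simp add: cadjoint_composition_operator_apply[OF z] e_def)
    qed
  qed
  with C show ?thesis
    by (simp add: coposinormal_def)
qed

text \<open>The test functions are the kernels: if \<open>\<phi> \<circ> \<sigma>\<inverse>\<close> left the disk, the function \<open>F\<close> with
  \<open>C\<^sub>\<phi> (kernel s) = cadjoint C\<^sub>\<phi> F\<close> would have a pole in the disk for a suitable \<open>s\<close>.\<close>

lemma posinormal_compositionD:
  assumes "posinormal C\<^sub>\<phi>"
  shows "cmod b < cmod a"
    and "cmod (cnj a * x - cnj c * y) \<le> cmod (cnj d * y - cnj b * x) \<Longrightarrow>
      cmod (a * x + b * y) \<le> cmod (c * x + d * y)"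
proof -
  define \<Delta> where "\<Delta> = cnj (a * d - b * c)"
  have \<Delta>: "\<Delta> \<noteq> 0" "\<Delta> = cnj a * cnj d - cnj b * cnj c"
    using det by (simp_all add: \<Delta>_def del: complex_cnj_diff) (simp add: algebra_simps)
  define P Q R S where "P = a * cnj d + b * cnj b" and "Q = a * cnj c + b * cnj a"
    and "R = c * cnj d + d * cnj b" and "S = c * cnj c + d * cnj a"
  have "\<exists>F. \<forall>z\<in>ball 0 1. 1 / (1 - cnj s * \<phi> z) = 1 / (cnj d - cnj b * z) * hardy2_apply F (\<sigma> z)"
    if s: "s \<in> ball 0 1" for s
  proof -
    obtain u where u: "C\<^sub>\<phi> (kernel s) = cadjoint C\<^sub>\<phi> u"
      using posinormal_range[OF assms] by blast
    have "1 / (1 - cnj s * \<phi> z) = 1 / (cnj d - cnj b * z) * hardy2_apply (cadjoint M\<^sub>h u) (\<sigma> z)"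
      if z: "z \<in> ball 0 1" for z
      by (simp only: hardy2_apply_kernel[OF s linfrac_in_ball[OF z], symmetric]
          composition_operator_apply[OF z, symmetric] u cadjoint_composition_operator_apply[OF z])
    then show ?thesis
      by blast
  qed
  then obtain F where F: "\<And>s z. s \<in> ball 0 1 \<Longrightarrow> z \<in> ball 0 1 \<Longrightarrow>
      1 / (1 - cnj s * \<phi> z) = 1 / (cnj d - cnj b * z) * hardy2_apply (F s) (\<sigma> z)"
    by metis
  have e: "cnj d - cnj b * z \<noteq> 0" if "z \<in> ball 0 1" for z
    using adj.den_nonzero[of z] that by simp
  \<comment> \<open>For s = 0 the kernel is the constant 1, so this determines the function in H^2
    that represents it.\<close>
  have F0: "hardy2_apply (F 0) y * (cnj b * y + cnj a) = \<Delta>" if y: "y \<in> ball 0 1" for y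
  proof (rule adj.linfrac_image_identity[OF _ _ _ y])
    fix z :: complex assume z: "z \<in> ball 0 1"
    have "hardy2_apply (F 0) (\<sigma> z) = cnj d - cnj b * z"
      using F[of 0 z] z e[OF z] by (simp add: field_simps)
    moreover have "cnj b * \<sigma> z + cnj a = \<Delta> / (cnj d - cnj b * z)"
      unfolding linfrac_def using e[OF z] by (simp add: \<Delta>(2) field_simps)
    ultimately show "hardy2_apply (F 0) (\<sigma> z) * (cnj b * \<sigma> z + cnj a) = \<Delta>"
      using e[OF z] by simp
  qed (intro holomorphic_intros hardy2_apply_holomorphic)+
  show "cmod b < cmod a"
  proof (rule ccontr)
    assume "\<not> cmod b < cmod a"
    then have ab: "cmod a \<le> cmod b"
      by simp
    then have b: "b \<noteq> 0"
      using det by auto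
    define y where "y = - cnj a / cnj b"
    define K where "K = (norm (F 0))\<^sup>2 * (cmod a)\<^sup>2"
    define D where "D = (cmod \<Delta>)\<^sup>2"
    \<comment> \<open>If the pole y of \<open>F 0\<close> lies in the closed disk, the growth bound
      at r y gives D \<le> K (1 - r). This r makes the right side K D / (K + D), which is less than
      D.\<close>
    define r where "r = 1 - D / (K + D)"
    have D: "D > 0" and K: "K \<ge> 0"
      using \<Delta>(1) by (auto simp: D_def K_def)
    then have r: "0 \<le> r" "r < 1"
      by (auto simp: r_def)
    have y: "cmod y \<le> 1"
      using ab b by (simp add: y_def norm_divide divide_le_eq)
    define w where "w = complex_of_real r * y"
    have cw: "cmod w \<le> r"
      using r y by (simp add: w_def norm_mult mult_left_le)
    then have w: "w \<in> ball 0 1"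
      using r by simp
    have eq: "cnj b * w + cnj a = cnj a * complex_of_real (1 - r)"
      using b by (simp add: w_def y_def field_simps)
    have "1 - r \<le> 1 - r\<^sup>2"
      using r by (simp add: power2_eq_square mult_left_le)
    also have "\<dots> \<le> 1 - (cmod w)\<^sup>2"
      using cw by (simp add: power_mono)
    finally have "(1 - r) * D \<le> (1 - (cmod w)\<^sup>2) * D"
      using D by simp
    also have "\<dots> = (1 - (cmod w)\<^sup>2) * (cmod (hardy2_apply (F 0) w))\<^sup>2 * ((cmod a)\<^sup>2 * (1 - r)\<^sup>2)"
      using r unfolding D_def F0[OF w, symmetric] eq norm_mult norm_of_real by (simp add: power_mult_distrib)
    also have "\<dots> \<le> (norm (F 0))\<^sup>2 * ((cmod a)\<^sup>2 * (1 - r)\<^sup>2)"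
      by (intro mult_right_mono cmod_hardy2_apply_le w) auto
    also have "\<dots> = (1 - r) * (K * (1 - r))"
      by (simp add: K_def power2_eq_square mult_ac)
    finally have "D \<le> K * (1 - r)"
      using r by simp
    also have "\<dots> = K * D / (K + D)"
      by (simp add: r_def)
    also have "\<dots> < D"
      using D K by (simp add: divide_less_eq algebra_simps)
    finally show False
      by simp
  qed
  \<comment> \<open>The formula for \<open>F s\<close> with its denominator cleared, hence valid
    also where that denominator vanishes: there it forces R y + S = 0.\<close>
  have key: "hardy2_apply (F s) y * (cnj b * y + cnj a) * ((R * y + S) - cnj s * (P * y + Q)) = \<Delta> * (R * y + S)"
    if s: "s \<in> ball 0 1" and y: "y \<in> ball 0 1" for s y
  proof (rule adj.linfrac_image_identity[OF _ _ _ y])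
    fix z :: complex assume z: "z \<in> ball 0 1"
    define q where "q = cnj d - cnj b * z"
    define h where "h = c * z + d"
    define k where "k = h - cnj s * (a * z + b)"
    have q: "q \<noteq> 0"
      using e[OF z] by (simp add: q_def)
    have h: "h \<noteq> 0"
      using den_nonzero[of z] z by (simp add: h_def)
    have sk: "1 - cnj s * \<phi> z = k / h"
      unfolding k_def linfrac_def h_def [symmetric] using h by (simp add: field_simps)
    have "cmod (cnj s * \<phi> z) < 1"
      using s linfrac_in_ball[OF z] mult_strict_mono'[of "cmod s" 1 "cmod (\<phi> z)" 1]
      by (simp add: norm_mult)
    then have "1 - cnj s * \<phi> z \<noteq> 0"
      by auto
    then have k: "k \<noteq> 0"
      using sk h by auto
    have "h / k = 1 / q * hardy2_apply (F s) (\<sigma> z)"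
      using F[OF s z] by (simp add: sk q_def)
    then have 0: "hardy2_apply (F s) (\<sigma> z) = q * h / k"
      using q by (simp add: field_simps)
    have \<sigma>: "\<sigma> z = (cnj a * z - cnj c) / q"
      by (simp add: linfrac_def q_def)
    have 1: "cnj b * \<sigma> z + cnj a = \<Delta> / q"
      unfolding \<sigma> using q by (simp add: field_simps) (simp add: q_def \<Delta>(2) algebra_simps)
    have 2: "P * \<sigma> z + Q = \<Delta> * (a * z + b) / q"
      unfolding \<sigma> using q
      by (simp add: field_simps) (simp add: q_def \<Delta>(2) P_def Q_def algebra_simps)
    have 3: "R * \<sigma> z + S = \<Delta> * h / q"
      unfolding \<sigma> using q
      by (simp add: field_simps) (simp add: q_def h_def \<Delta>(2) R_def S_def algebra_simps)
    have 4: "(R * \<sigma> z + S) - cnj s * (P * \<sigma> z + Q) = \<Delta> * k / q"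
      unfolding 2 3 by (simp add: k_def diff_divide_distrib algebra_simps)
    show "hardy2_apply (F s) (\<sigma> z) * (cnj b * \<sigma> z + cnj a) *
        ((R * \<sigma> z + S) - cnj s * (P * \<sigma> z + Q)) = \<Delta> * (R * \<sigma> z + S)"
      unfolding 4 unfolding 0 1 3 using q k by (simp add: field_simps)
  qed (intro holomorphic_intros hardy2_apply_holomorphic)+
  have RS: "R \<noteq> 0 \<or> S \<noteq> 0"
  proof -
    have "P * S - Q * R = (a * d - b * c) * \<Delta>"
      unfolding P_def Q_def R_def S_def \<Delta> by algebra
    with \<Delta>(1) det show ?thesis
      by auto
  qed
  have le: "cmod (P * z + Q) \<le> cmod (R * z + S)" if "cmod z \<le> 1" for z
  proof (rule cmod_linfrac_le_extend[OF RS _ that])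
    fix y s :: complex
    assume "y \<in> ball 0 1" "s \<in> ball 0 1" "R * y + S = cnj s * (P * y + Q)"
    with key[of s y] show "R * y + S = 0"
      using \<Delta>(1) by simp
  qed
  assume xy: "cmod (cnj a * x - cnj c * y) \<le> cmod (cnj d * y - cnj b * x)"
  \<comment> \<open>The image of (x, y) under \<open>\<sigma>\<close>; the composite matrix then
    yields \<open>\<Delta>\<close> times the image under \<open>\<phi>\<close>. If Y = 0, the
    hypothesis makes X = 0 too.\<close>
  define X Y where "X = cnj a * x - cnj c * y" and "Y = cnj d * y - cnj b * x"
  have "P * X + Q * Y = \<Delta> * (a * x + b * y)" "R * X + S * Y = \<Delta> * (c * x + d * y)"
    unfolding P_def Q_def R_def S_def X_def Y_def \<Delta> by algebra+
  moreover have "cmod (P * X + Q * Y) \<le> cmod (R * X + S * Y)"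
  proof (cases "Y = 0")
    case True
    with xy show ?thesis
      by (simp add: X_def Y_def)
  next
    case False
    have "cmod (X / Y) \<le> 1"
      using xy False by (simp add: X_def Y_def norm_divide divide_le_eq)
    from mult_right_mono[OF le[OF this], of "cmod Y"] show ?thesis
      using False by (simp add: norm_mult [symmetric] distrib_right)
  qed
  ultimately show "cmod (a * x + b * y) \<le> cmod (c * x + d * y)"
    using \<Delta>(1) by (simp add: norm_mult)
qed

text \<open>The same pole argument with the roles exchanged: the adjoint sends the kernel at s to
  the kernel at \<open>\<phi>\<close> s, which must be G o \<open>\<phi>\<close> with G in H^2. A
  pole of G in the disk can only be cancelled by the numerator a - c y.\<close>

lemma coposinormal_compositionD:
  assumes "coposinormal C\<^sub>\<phi>"
    and xy: "cmod (a * x + b * y) \<le> cmod (c * x + d * y)"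
  shows "cmod (cnj a * x - cnj c * y) \<le> cmod (cnj d * y - cnj b * x)"
proof -
  define \<Delta> where "\<Delta> = a * d - b * c"
  have \<Delta>: "\<Delta> \<noteq> 0"
    using det by (simp add: \<Delta>_def)
  define P Q R S where "P = cnj a * d + cnj c * c" and "Q = - cnj a * b - cnj c * a"
    and "R = - (cnj b * d + cnj d * c)" and "S = cnj b * b + cnj d * a"
  note C = bounded_clinear_composition_operator
  have "\<exists>G. \<forall>z\<in>ball 0 1. 1 / (1 - cnj (\<phi> s) * z) = hardy2_apply G (\<phi> z)"
    if s: "s \<in> ball 0 1" for s
  proof -
    obtain G where "cadjoint C\<^sub>\<phi> (kernel s) = C\<^sub>\<phi> G"
      using posinormal_range[of "cadjoint C\<^sub>\<phi>" "kernel s"] assms(1)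
      unfolding coposinormal_def cadjoint_cadjoint[OF C] by blast
    then have "1 / (1 - cnj (\<phi> s) * z) = hardy2_apply G (\<phi> z)" if z: "z \<in> ball 0 1" for z
      by (simp only: hardy2_apply_kernel[OF linfrac_in_ball[OF s] z, symmetric]
          cadjoint_composition_kernel[OF s, symmetric] composition_operator_apply[OF z])
    then show ?thesis
      by blast
  qed
  then obtain G where G: "\<And>s z. s \<in> ball 0 1 \<Longrightarrow> z \<in> ball 0 1 \<Longrightarrow>
      1 / (1 - cnj (\<phi> s) * z) = hardy2_apply (G s) (\<phi> z)"
    by metis
  have key: "hardy2_apply (G s) y * ((R * y + S) - cnj s * (P * y + Q)) = cnj (c * s + d) * (a - c * y)"
    if s: "s \<in> ball 0 1" and y: "y \<in> ball 0 1" for s y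
  proof (rule linfrac_image_identity[OF _ _ _ y])
    fix z :: complex assume z: "z \<in> ball 0 1"
    define h where "h = c * z + d"
    define l where "l = cnj (c * s + d)"
    define k where "k = l - cnj (a * s + b) * z"
    have h: "h \<noteq> 0"
      using den_nonzero[of z] z by (simp add: h_def)
    have l: "l \<noteq> 0"
      using den_nonzero[of s] s by (simp add: l_def del: complex_cnj_add complex_cnj_mult)
    have sk: "1 - cnj (\<phi> s) * z = k / l"
      using l by (simp add: k_def linfrac_def l_def field_simps)
    have "cmod (cnj (\<phi> s) * z) < 1"
      using z linfrac_in_ball[OF s] mult_strict_mono'[of "cmod (\<phi> s)" 1 "cmod z" 1]
      by (simp add: norm_mult)
    then have "1 - cnj (\<phi> s) * z \<noteq> 0"
      by auto
    then have k: "k \<noteq> 0"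
      using sk by auto
    have 0: "hardy2_apply (G s) (\<phi> z) = l / k"
      using G[OF s z] by (simp add: sk)
    have \<phi>: "\<phi> z = (a * z + b) / h"
      by (simp add: linfrac_def h_def)
    have 1: "a - c * \<phi> z = \<Delta> / h"
      unfolding \<phi> using h by (simp add: field_simps) (simp add: h_def \<Delta>_def algebra_simps)
    have 2: "P * \<phi> z + Q = \<Delta> * (cnj a * z - cnj c) / h"
      unfolding \<phi> using h
      by (simp add: field_simps) (simp add: h_def \<Delta>_def P_def Q_def algebra_simps)
    have 3: "R * \<phi> z + S = \<Delta> * (cnj d - cnj b * z) / h"
      unfolding \<phi> using h
      by (simp add: field_simps) (simp add: h_def \<Delta>_def R_def S_def algebra_simps)
    have 4: "(R * \<phi> z + S) - cnj s * (P * \<phi> z + Q) = \<Delta> * k / h"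
      unfolding 2 3 by (simp add: k_def l_def diff_divide_distrib [symmetric] algebra_simps)
    show "hardy2_apply (G s) (\<phi> z) * ((R * \<phi> z + S) - cnj s * (P * \<phi> z + Q)) =
        cnj (c * s + d) * (a - c * \<phi> z)"
      unfolding 4 unfolding 0 1 l_def [symmetric] using k by (simp add: field_simps)
  qed (intro holomorphic_intros hardy2_apply_holomorphic)+
  have ac: "- c \<noteq> 0 \<or> a \<noteq> 0"
    using det by auto
  have le: "cmod (P * z + Q) \<le> cmod (R * z + S)" if "cmod z \<le> 1" for z
  proof (rule cmod_linfrac_le_extend[OF ac _ that])
    fix y s :: complex
    assume "y \<in> ball 0 1" "s \<in> ball 0 1" "R * y + S = cnj s * (P * y + Q)"
    with key[of s y] den_nonzero[of s] show "- c * y + a = 0"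
      by (simp del: complex_cnj_add complex_cnj_mult)
  qed
  define X Y where "X = a * x + b * y" and "Y = c * x + d * y"
  have "P * X + Q * Y = \<Delta> * (cnj a * x - cnj c * y)" "R * X + S * Y = \<Delta> * (cnj d * y - cnj b * x)"
    unfolding P_def Q_def R_def S_def X_def Y_def \<Delta>_def by algebra+
  moreover have "cmod (P * X + Q * Y) \<le> cmod (R * X + S * Y)"
  proof (cases "Y = 0")
    case True
    with xy show ?thesis
      by (simp add: X_def Y_def)
  next
    case False
    have "cmod (X / Y) \<le> 1"
      using xy False by (simp add: X_def Y_def norm_divide divide_le_eq)
    from mult_right_mono[OF le[OF this], of "cmod Y"] show ?thesis
      using False by (simp add: norm_mult [symmetric] distrib_right)
  qed
  ultimately show ?thesis
    using \<Delta> by (simp add: norm_mult)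
qed

end

section \<open>Linear-fractional selfmaps of the disk\<close>

text \<open>The matrix with rows (1, w) and (cnj w, 1) multiplies the form by 1 - |w|^2: an
  unnormalised disk automorphism when |w| < 1.\<close>

lemma cmod_square_mixture:
  "(cmod (x + w * y))\<^sup>2 - (cmod (cnj w * x + y))\<^sup>2 = (1 - (cmod w)\<^sup>2) * ((cmod x)\<^sup>2 - (cmod y)\<^sup>2)"
proof -
  have "complex_of_real ((cmod (x + w * y))\<^sup>2 - (cmod (cnj w * x + y))\<^sup>2) =
      complex_of_real ((1 - (cmod w)\<^sup>2) * ((cmod x)\<^sup>2 - (cmod y)\<^sup>2))"
    by (simp add: of_real_cmod_square algebra_simps)
  then show ?thesis
    by (simp only: of_real_eq_iff)
qed

lemma cmod_square_diff_affine:
  "(cmod (c * z + d))\<^sup>2 - (cmod (a * z + b))\<^sup>2 =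
    ((cmod c)\<^sup>2 - (cmod a)\<^sup>2) * (cmod z)\<^sup>2 + ((cmod d)\<^sup>2 - (cmod b)\<^sup>2) + 2 * Re ((c * cnj d - a * cnj b) * z)"
  unfolding cmod_power2 by (simp add: power2_eq_square algebra_simps)

lemma unimodular_opposite:
  obtains z where "cmod z = 1" "B * z = - complex_of_real (cmod B)"
proof (cases "B = 0")
  case True
  then show ?thesis
    using that[of 1] by simp
next
  case False
  show ?thesis
  proof (rule that)
    show "cmod (- cnj B / cmod B) = 1"
      using False by (simp add: norm_divide)
    show "B * (- cnj B / cmod B) = - complex_of_real (cmod B)"
      using False of_real_cmod_square[of B] by (simp add: power2_eq_square field_simps)
  qed
qed

text \<open>The right side is the value at the point of the circle where \<open>\<gamma>\<close> z
  points opposite to \<open>\<mu>\<close>.\<close>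

lemma affine_min_on_circle:
  assumes "\<And>z. cmod z = 1 \<Longrightarrow> K \<le> cmod (\<gamma> * z + \<mu>)"
  shows "K \<le> \<bar>cmod \<mu> - cmod \<gamma>\<bar>"
proof (cases "\<mu> = 0")
  case True
  then show ?thesis
    using assms[of 1] by simp
next
  case False
  obtain z where z: "cmod z = 1" "(\<gamma> * cnj \<mu>) * z = - complex_of_real (cmod (\<gamma> * cnj \<mu>))"
    by (rule unimodular_opposite)
  have "cmod \<mu> * cmod (\<gamma> * z + \<mu>) = cmod (\<gamma> * cnj \<mu> * z + \<mu> * cnj \<mu>)"
    using norm_mult[of "cnj \<mu>" "\<gamma> * z + \<mu>"] by (simp add: algebra_simps)
  also have "\<gamma> * cnj \<mu> * z + \<mu> * cnj \<mu> = complex_of_real (cmod \<mu> * (cmod \<mu> - cmod \<gamma>))"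
    unfolding z(2) of_real_cmod_square [symmetric]
    by (simp add: norm_mult power2_eq_square algebra_simps)
  also have "cmod \<dots> = cmod \<mu> * \<bar>cmod \<mu> - cmod \<gamma>\<bar>"
    unfolding norm_of_real by (simp add: abs_mult)
  finally show ?thesis
    using False assms[OF z(1)] by simp
qed

text \<open>The Schwarz--Pick inequality at the origin, in the form obtained by applying the Schwarz lemma
  to the linear-fractional map followed by the automorphism moving the image of the origin back.\<close>

lemma linfrac_schwarz_pick:
  fixes A B C D :: complex
  assumes le: "\<And>z. cmod z \<le> 1 \<Longrightarrow> cmod (A * z + B) \<le> cmod (C * z + D)"
    and det: "A * D - B * C \<noteq> 0"
  shows "cmod (A * D - B * C) + cmod (cnj D * C - cnj B * A) \<le> (cmod D)\<^sup>2 - (cmod B)\<^sup>2"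
proof -
  define L where "L = cnj D * C - cnj B * A"
  define \<delta> where "\<delta> = (cmod D)\<^sup>2 - (cmod B)\<^sup>2"
  have BD: "cmod B \<le> cmod D"
    using le[of 0] by simp
  then have \<delta>0: "\<delta> \<ge> 0"
    by (simp add: \<delta>_def power_mono)
  \<comment> \<open>After the automorphism that takes B / D to 0, the map reads z (A D - B C) / (L z
    + \<open>\<delta>\<close>); the estimate says that it still maps into the closed disk.\<close>
  have ineq: "cmod z * cmod (A * D - B * C) \<le> cmod (L * z + \<delta>)" if z: "cmod z \<le> 1" for z
  proof -
    define X Y where "X = A * z + B" and "Y = C * z + D"
    have "(cmod (cnj D * Y - cnj B * X))\<^sup>2 - (cmod (D * X - B * Y))\<^sup>2 = \<delta> * ((cmod Y)\<^sup>2 - (cmod X)\<^sup>2)"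
      unfolding \<delta>_def cmod_power2 by (simp add: power2_eq_square algebra_simps)
    moreover have "(cmod X)\<^sup>2 \<le> (cmod Y)\<^sup>2"
      using le[OF z] by (simp add: X_def Y_def power_mono)
    ultimately have "(cmod (D * X - B * Y))\<^sup>2 \<le> (cmod (cnj D * Y - cnj B * X))\<^sup>2"
      using \<delta>0 by (smt (verit) mult_nonneg_nonneg)
    then have "cmod (D * X - B * Y) \<le> cmod (cnj D * Y - cnj B * X)"
      by (rule power2_le_imp_le) simp
    moreover have "D * X - B * Y = z * (A * D - B * C)"
      by (simp add: X_def Y_def algebra_simps)
    moreover have "cnj D * Y - cnj B * X = L * z + \<delta>"
      by (simp add: X_def Y_def L_def \<delta>_def of_real_cmod_square algebra_simps)
    ultimately show ?thesis
      by (simp add: norm_mult)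
  qed
  have "\<delta> \<noteq> 0"
  proof
    assume "\<delta> = 0"
    then have "L \<noteq> 0"
      using ineq[of 1] det by auto
    \<comment> \<open>If \<open>\<delta>\<close> = 0, the step z = -t cnj L changes the difference
      of squares from 0 to t |L|^2 (t E - 2). The choice of t keeps z in the disk and t E below 1,
      so this is negative.\<close>
    define E where "E = (cmod C)\<^sup>2 - (cmod A)\<^sup>2"
    define t where "t = 1 / (cmod L + \<bar>E\<bar> + 1)"
    have t: "t > 0" "t * cmod L \<le> 1" "t * E < 1"
    proof -
      have "E < cmod L + \<bar>E\<bar> + 1" "0 < cmod L + \<bar>E\<bar> + 1"
        using norm_ge_zero[of L] by linarith+
      then show "t > 0" "t * cmod L \<le> 1" "t * E < 1"
        by (simp_all add: t_def)
    qed
    define z where "z = - complex_of_real t * cnj L"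
    have cz: "cmod z = t * cmod L"
      using t by (simp add: z_def norm_mult)
    have "(C * cnj D - A * cnj B) * z = - complex_of_real (t * (cmod L)\<^sup>2)"
      by (simp add: z_def L_def of_real_cmod_square algebra_simps)
    then have "(cmod (C * z + D))\<^sup>2 - (cmod (A * z + B))\<^sup>2 =
        E * (t * cmod L)\<^sup>2 + \<delta> + 2 * Re (- complex_of_real (t * (cmod L)\<^sup>2))"
      unfolding cmod_square_diff_affine cz E_def \<delta>_def by presburger
    then have "(cmod (C * z + D))\<^sup>2 - (cmod (A * z + B))\<^sup>2 = t * (cmod L)\<^sup>2 * (t * E - 2)"
      using \<open>\<delta> = 0\<close> by (simp add: power2_eq_square algebra_simps)
    also have "\<dots> < 0"
      using t \<open>L \<noteq> 0\<close> by (intro mult_pos_neg) auto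
    finally have "(cmod (C * z + D))\<^sup>2 < (cmod (A * z + B))\<^sup>2"
      by simp
    then have "cmod (C * z + D) < cmod (A * z + B)"
      by (rule power2_less_imp_less) simp
    then show False
      using le[of z] t cz by simp
  qed
  then have \<delta>: "\<delta> > 0"
    using \<delta>0 by simp
  \<comment> \<open>Otherwise the zero of L z + \<open>\<delta>\<close> lies in the closed disk,
    where \<open>ineq\<close> bounds a positive number by 0.\<close>
  have L\<delta>: "cmod L \<le> \<delta>"
  proof (rule ccontr)
    assume "\<not> cmod L \<le> \<delta>"
    then have "L \<noteq> 0" "cmod (- complex_of_real \<delta> / L) \<le> 1"
      using \<delta> by (auto simp: norm_divide divide_le_eq)
    with ineq[of "- complex_of_real \<delta> / L"] \<delta> det show False
      by (simp add: norm_divide mult_le_0_iff divide_le_0_iff zero_less_divide_iff)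
  qed
  have "cmod (A * D - B * C) \<le> \<bar>cmod (complex_of_real \<delta>) - cmod L\<bar>"
  proof (rule affine_min_on_circle)
    show "cmod (A * D - B * C) \<le> cmod (L * z + complex_of_real \<delta>)" if "cmod z = 1" for z
      using ineq[of z] that by simp
  qed
  moreover have "cmod (complex_of_real \<delta>) = \<delta>"
    using \<delta> by simp
  ultimately show ?thesis
    using L\<delta> unfolding L_def [symmetric] \<delta>_def [symmetric] by linarith
qed

section \<open>Disk involutions and automorphisms\<close>

lemma disk_involution_in_ball:
  assumes "w \<in> ball 0 1" "z \<in> ball 0 1"
  shows "disk_involution w z \<in> ball 0 1" "1 - cnj w * z \<noteq> 0"
proof -
  have "(cmod (w - z))\<^sup>2 - (cmod (1 - cnj w * z))\<^sup>2 = (1 - (cmod w)\<^sup>2) * ((cmod z)\<^sup>2 - 1)"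
    using cmod_square_mixture[of "- z" w 1] by (simp add: add.commute)
  also have "\<dots> < 0"
    using assms by (intro mult_pos_neg) (simp_all add: abs_square_less_1)
  finally have lt: "cmod (w - z) < cmod (1 - cnj w * z)"
    by (auto intro: power2_less_imp_less)
  then show "1 - cnj w * z \<noteq> 0"
    by auto
  with lt show "disk_involution w z \<in> ball 0 1"
    by (simp add: disk_involution_def norm_divide divide_less_eq)
qed

lemma disk_involution_involution:
  assumes "w \<in> ball 0 1" "z \<in> ball 0 1"
  shows "disk_involution w (disk_involution w z) = z"
proof -
  have n: "1 - cnj w * z \<noteq> 0"
    by (rule disk_involution_in_ball(2)[OF assms])
  have m: "1 - cnj w * w \<noteq> 0"
    using disk_involution_in_ball(2)[OF assms(1) assms(1)] .
  have "w - disk_involution w z = z * (1 - cnj w * w) / (1 - cnj w * z)"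
    "1 - cnj w * disk_involution w z = (1 - cnj w * w) / (1 - cnj w * z)"
    using n by (simp_all add: disk_involution_def field_simps)
  then show ?thesis
    unfolding disk_involution_def[of w "disk_involution w z"] using n m by simp
qed

context linfrac_selfmap
begin

text \<open>On the circle the difference of squares is A + 2 Re (B z) and nonnegative, so it can
  vanish only where B z = -A / 2. Two such points force B = 0 and then A = 0.\<close>

lemma automorphism_if_two_boundary_points:
  assumes z: "cmod z1 = 1" "cmod z2 = 1" "z1 \<noteq> z2"
    and bd: "cmod (a * z1 + b) = cmod (c * z1 + d)" "cmod (a * z2 + b) = cmod (c * z2 + d)"
  shows "disk_automorphism (linfrac a b c d)"
proof -
  define A where "A = (cmod c)\<^sup>2 - (cmod a)\<^sup>2 + ((cmod d)\<^sup>2 - (cmod b)\<^sup>2)"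
  define B where "B = c * cnj d - a * cnj b"
  have circle: "(cmod (c * z + d))\<^sup>2 - (cmod (a * z + b))\<^sup>2 = A + 2 * Re (B * z)" if "cmod z = 1" for z
    using that by (simp add: cmod_square_diff_affine A_def B_def)
  obtain z0 where z0: "cmod z0 = 1" "B * z0 = - complex_of_real (cmod B)"
    by (rule unimodular_opposite)
  have "0 \<le> (cmod (c * z0 + d))\<^sup>2 - (cmod (a * z0 + b))\<^sup>2"
    using self_closed[of z0] z0(1) by (simp add: power_mono)
  then have AB: "2 * cmod B \<le> A"
    using circle[OF z0(1)] z0(2) by simp
  have eq: "B * z = - complex_of_real A / 2"
    if "cmod z = 1" "cmod (a * z + b) = cmod (c * z + d)" for z
  proof -
    have re: "Re (B * z) = - A / 2"
      using circle[OF that(1)] that(2) by simp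
    have n: "cmod (B * z) = cmod B"
      using that(1) by (simp add: norm_mult)
    have "(Re (B * z))\<^sup>2 + (Im (B * z))\<^sup>2 = (cmod B)\<^sup>2"
      using n cmod_power2[of "B * z"] by simp
    moreover have "(cmod B)\<^sup>2 \<le> (A / 2)\<^sup>2"
      using AB by (intro power_mono) auto
    ultimately have "(Im (B * z))\<^sup>2 \<le> 0"
      using re by (simp add: power2_eq_square)
    then have "Im (B * z) = 0"
      by simp
    with re show ?thesis
      by (simp add: complex_eq_iff)
  qed
  have "B * z1 = B * z2"
    using eq z bd by simp
  then have B: "B = 0"
    using z by simp
  then have A: "A = 0"
    using eq[OF z(1) bd(1)] by simp
  define D where "D = (cmod d)\<^sup>2 - (cmod b)\<^sup>2"
  have D: "D > 0"
    using b_less_d by (simp add: D_def power_strict_mono)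
  \<comment> \<open>The matrix now preserves the form up to the positive factor D, so the preimage
    of a disk point is itself in the disk.\<close>
  have all: "(cmod (c * z + d))\<^sup>2 - (cmod (a * z + b))\<^sup>2 = D * (1 - (cmod z)\<^sup>2)" for z
  proof -
    have *: "(cmod c)\<^sup>2 - (cmod a)\<^sup>2 = - D"
      using A by (simp add: A_def D_def)
    show ?thesis
      unfolding cmod_square_diff_affine * B [unfolded B_def] D_def [symmetric]
      by (simp add: algebra_simps)
  qed
  have ca: "(cmod c)\<^sup>2 < (cmod a)\<^sup>2"
    using A D by (simp add: A_def D_def)
  have "\<exists>z\<in>ball 0 1. linfrac a b c d z = y" if y: "y \<in> ball 0 1" for y
  proof -
    have "cmod (c * y) \<le> cmod c"
      using y by (simp add: norm_mult mult_left_le)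
    also have "\<dots> < cmod a"
      using ca by (rule power2_less_imp_less) simp
    finally have n: "a - c * y \<noteq> 0"
      by auto
    define \<Delta> where "\<Delta> = a * d - b * c"
    define z where "z = (d * y - b) / (a - c * y)"
    have num: "a * z + b = y * (\<Delta> / (a - c * y))" and den: "c * z + d = \<Delta> / (a - c * y)"
      using n by (simp_all add: z_def \<Delta>_def field_simps)
    have nz: "\<Delta> / (a - c * y) \<noteq> 0"
      using n det by (simp add: \<Delta>_def)
    have "cmod (a * z + b) < cmod (c * z + d)"
      unfolding num den norm_mult[of y] using y nz by (simp del: divide_eq_0_iff)
    then have "0 < D * (1 - (cmod z)\<^sup>2)"
      unfolding all [symmetric] by (simp add: power_strict_mono)
    then have "z \<in> ball 0 1"
      using D by (simp add: zero_less_mult_iff abs_square_less_1)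
    moreover have "linfrac a b c d z = y"
      unfolding linfrac_def num den using nz by simp
    ultimately show ?thesis
      by blast
  qed
  then have "linfrac a b c d ` ball 0 1 = ball 0 1"
    using linfrac_image by blast
  then show ?thesis
    unfolding disk_automorphism_def bij_betw_def using linfrac_holomorphic linfrac_inj by blast
qed

lemma linfrac_composition: "linfrac_composition a b c d"
  by (intro linfrac_composition.intro linfrac_selfmap_axioms adjoint_selfmap)

lemma automorphism_invertible:
  assumes "disk_automorphism (linfrac a b c d)"
  shows "invertible_operator (composition_operator (linfrac a b c d))"
proof -
  have onto: "\<exists>y\<in>ball 0 1. linfrac a b c d y = z" if "z \<in> ball 0 1" for z
    using assms that unfolding disk_automorphism_def bij_betw_def by (metis imageE)
  define \<Delta> where "\<Delta> = a * d - b * c"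
  have inv: "a - c * linfrac a b c d y = \<Delta> / (c * y + d)"
    "d * linfrac a b c d y - b = \<Delta> * y / (c * y + d)" if "y \<in> ball 0 1" for y
    using den_nonzero[of y] that by (simp_all add: linfrac_def \<Delta>_def field_simps)
  have \<Delta>: "\<Delta> \<noteq> 0"
    using det by (simp add: \<Delta>_def)
  have "linfrac_selfmap d (- b) (- c) a"
  proof
    show "d * a - - b * - c \<noteq> 0"
      using det by (simp add: mult.commute)
    fix z :: complex assume "cmod z < 1"
    then obtain y where y: "y \<in> ball 0 1" "z = linfrac a b c d y"
      using onto[of z] by auto
    show "cmod (d * z + - b) < cmod (- c * z + a)"
      using y(1) inv[OF y(1)] den_nonzero[of y] \<Delta>
      by (simp add: y(2) norm_mult norm_divide divide_strict_right_mono)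
  qed
  then interpret i: linfrac_composition d "- b" "- c" a
    by (rule linfrac_selfmap.linfrac_composition)
  interpret linfrac_composition a b c d
    by (rule linfrac_composition)
  have 1: "linfrac d (- b) (- c) a (linfrac a b c d z) = z" if z: "z \<in> ball 0 1" for z
    using inv[OF z] \<Delta> den_nonzero[of z] z by (simp add: linfrac_def[of d])
  have 2: "linfrac a b c d (linfrac d (- b) (- c) a z) = z" if z: "z \<in> ball 0 1" for z
    using onto[OF z] 1 by metis
  show ?thesis
    unfolding invertible_operator_def
  proof (intro conjI exI)
    show "composition_operator \<phi> \<circ> composition_operator (linfrac d (- b) (- c) a) = id"
      by (auto simp: fun_eq_iff composition_operator_apply i.composition_operator_apply 1
          linfrac_in_ball simp del: mem_ball mem_ball_0 intro!: hardy2_ext)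
    show "composition_operator (linfrac d (- b) (- c) a) \<circ> composition_operator \<phi> = id"
      by (auto simp: fun_eq_iff composition_operator_apply i.composition_operator_apply 2
          i.linfrac_in_ball simp del: mem_ball mem_ball_0 intro!: hardy2_ext)
  qed (rule bounded_clinear_composition_operator i.bounded_clinear_composition_operator)+
qed

end

section \<open>Fixed points\<close>

lemma fixed_point_form_difference:
  fixes a b c d e w x y :: complex
  assumes "a = d + c * w - e" "b = w * e"
  shows "((cmod (cnj a * x - cnj c * y))\<^sup>2 - (cmod (cnj d * y - cnj b * x))\<^sup>2) -
   ((cmod (a * x + b * y))\<^sup>2 - (cmod (c * x + d * y))\<^sup>2) =
   (cmod (cnj w * x - y))\<^sup>2 * ((cmod c)\<^sup>2 - (cmod e)\<^sup>2) + (cmod (c * x + e * y))\<^sup>2 * (1 - (cmod w)\<^sup>2)"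
  (is "?l = ?r")
proof -
  have "complex_of_real ?l = complex_of_real ?r"
    unfolding assms by (simp add: of_real_cmod_square algebra_simps)
  then show ?thesis
    by (simp only: of_real_eq_iff)
qed

locale linfrac_fixed_point = linfrac_composition a b c d for a b c d +
  fixes w :: complex
  assumes fixed: "a * w + b = w * (c * w + d)" and w: "cmod w \<le> 1"
begin

definition e where "e = d - a + c * w"
text \<open>The eigenvalues of the matrix are \<open>\<mu>\<close>, with eigenvector (w, 1), and
  \<open>\<kappa>\<close>, the trace a + d minus \<open>\<mu>\<close>. Their quotient
  \<open>\<kappa>\<close> / \<open>\<mu>\<close> is the multiplier at w.\<close>

definition \<kappa> where "\<kappa> = a - c * w"
definition \<mu> where "\<mu> = c * w + d"
text \<open>For |w| < 1, the off-diagonal entry in the basis (1, cnj w), (w, 1). Unless the map is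
  the identity, it vanishes exactly when the second fixed point is the reflection 1 / cnj w of w,
  read as infinity when w = 0.\<close>

definition \<gamma> where "\<gamma> = c + cnj w * e"

lemma b_eq: "b = w * e"
  using fixed by (simp add: e_def algebra_simps)

lemma cnj_b_eq: "cnj b = cnj w * cnj e"
  by (simp add: b_eq)

lemma \<mu>_nonzero: "\<mu> \<noteq> 0"
  using den_nonzero[OF w] by (simp add: \<mu>_def)

lemma det_eq: "a * d - b * c = \<kappa> * \<mu>"
  unfolding b_eq \<kappa>_def \<mu>_def e_def by algebra

lemma \<kappa>_nonzero: "\<kappa> \<noteq> 0"
  using det unfolding det_eq by simp

lemma \<mu>_minus_\<kappa>: "\<mu> - \<kappa> = c * w + e"
  by (simp add: \<mu>_def \<kappa>_def e_def)

lemma fixed_point_iff: "a * z + b = z * (c * z + d) \<longleftrightarrow> z = w \<or> c * z + e = 0"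
proof -
  have "a * z + b - z * (c * z + d) = (w - z) * (c * z + e)"
    unfolding b_eq e_def by algebra
  then show ?thesis
    by (metis eq_iff_diff_eq_0 mult_eq_0_iff)
qed

lemma form_difference:
  "((cmod (cnj a * x - cnj c * y))\<^sup>2 - (cmod (cnj d * y - cnj b * x))\<^sup>2) -
   ((cmod (a * x + b * y))\<^sup>2 - (cmod (c * x + d * y))\<^sup>2) =
   (cmod (cnj w * x - y))\<^sup>2 * ((cmod c)\<^sup>2 - (cmod e)\<^sup>2) + (cmod (c * x + e * y))\<^sup>2 * (1 - (cmod w)\<^sup>2)"
  by (rule fixed_point_form_difference) (simp_all add: e_def b_eq)

lemma posinormal_if_c_ge_e:
  assumes "cmod b < cmod a" "cmod e \<le> cmod c"
  shows "posinormal C\<^sub>\<phi>"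
proof (rule posinormal_compositionI[OF assms(1)])
  fix x y assume lt: "cmod (cnj a * x - cnj c * y) < cmod (cnj d * y - cnj b * x)"
  have "0 \<le> (cmod (cnj w * x - y))\<^sup>2 * ((cmod c)\<^sup>2 - (cmod e)\<^sup>2) + (cmod (c * x + e * y))\<^sup>2 * (1 - (cmod w)\<^sup>2)"
    using assms(2) w by (intro add_nonneg_nonneg mult_nonneg_nonneg) (simp_all add: power_mono power_le_one)
  moreover have "(cmod (cnj a * x - cnj c * y))\<^sup>2 < (cmod (cnj d * y - cnj b * x))\<^sup>2"
    using lt by (simp add: power_strict_mono)
  ultimately have "(cmod (a * x + b * y))\<^sup>2 < (cmod (c * x + d * y))\<^sup>2"
    using form_difference[of x y] by linarith
  then show "cmod (a * x + b * y) < cmod (c * x + d * y)"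
    by (rule power2_less_imp_less) simp
qed

lemma coposinormal_if_c_le_e:
  assumes "cmod w = 1" "cmod c \<le> cmod e"
  shows "coposinormal C\<^sub>\<phi>"
proof (rule coposinormal_compositionI)
  fix x y assume lt: "cmod (a * x + b * y) < cmod (c * x + d * y)"
  have "(cmod (cnj w * x - y))\<^sup>2 * ((cmod c)\<^sup>2 - (cmod e)\<^sup>2) \<le> 0"
    using assms(2) by (intro mult_nonneg_nonpos) (simp_all add: power_mono)
  moreover have "(cmod (a * x + b * y))\<^sup>2 < (cmod (c * x + d * y))\<^sup>2"
    using lt by (simp add: power_strict_mono)
  ultimately have "(cmod (cnj a * x - cnj c * y))\<^sup>2 < (cmod (cnj d * y - cnj b * x))\<^sup>2"
    using form_difference[of x y] assms(1) by simp
  then show "cmod (cnj a * x - cnj c * y) < cmod (cnj d * y - cnj b * x)"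
    by (rule power2_less_imp_less) simp
qed

text \<open>If |c| < |e|, the difference of the forms is a negative multiple of |cnj w x - y|^2. On
  vectors that \<open>\<sigma>\<close> sends to the circle posinormality requires the opposite sign,
  so all of them would lie on the line cnj w x = y.\<close>

lemma posinormal_boundary:
  assumes "posinormal C\<^sub>\<phi>" "cmod w = 1"
  shows "cmod e \<le> cmod c"
proof (rule ccontr)
  assume "\<not> cmod e \<le> cmod c"
  then have neg: "(cmod c)\<^sup>2 - (cmod e)\<^sup>2 < 0"
    by (simp add: power_strict_mono)
  have *: "cnj w * (cnj d * y + cnj c) = cnj b * y + cnj a" if y: "cmod y = 1" for y
  proof -
    define u v where "u = cnj d * y + cnj c" and "v = cnj b * y + cnj a"
    have "cnj a * u - cnj c * v = cnj (a * d - b * c) * y" "cnj d * v - cnj b * u = cnj (a * d - b * c)"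
      by (simp_all add: u_def v_def algebra_simps)
    then have eq: "cmod (cnj a * u - cnj c * v) = cmod (cnj d * v - cnj b * u)"
      using y by (simp add: norm_mult del: complex_cnj_diff complex_cnj_mult)
    then have "cmod (a * u + b * v) \<le> cmod (c * u + d * v)"
      using posinormal_compositionD(2)[OF assms(1), of u v] by simp
    then have "(cmod (a * u + b * v))\<^sup>2 \<le> (cmod (c * u + d * v))\<^sup>2"
      by (simp add: power_mono)
    moreover have "(cmod (c * u + d * v))\<^sup>2 - (cmod (a * u + b * v))\<^sup>2 =
        (cmod (cnj w * u - v))\<^sup>2 * ((cmod c)\<^sup>2 - (cmod e)\<^sup>2)"
      using form_difference[of u v] assms(2) eq by simp
    ultimately have "0 \<le> (cmod (cnj w * u - v))\<^sup>2 * ((cmod c)\<^sup>2 - (cmod e)\<^sup>2)"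
      by linarith
    have "cnj w * u - v = 0"
    proof (rule ccontr)
      assume "cnj w * u - v \<noteq> 0"
      then have "(cmod (cnj w * u - v))\<^sup>2 * ((cmod c)\<^sup>2 - (cmod e)\<^sup>2) < 0"
        using neg by (intro mult_pos_neg) simp_all
      with \<open>0 \<le> _\<close> show False
        by linarith
    qed
    then show ?thesis
      by (simp add: u_def v_def)
  qed
  \<comment> \<open>Two affine functions of y that agree at 1 and -1 have equal coefficients; the
    rows of the matrix become proportional.\<close>
  have ba: "cnj b = cnj w * cnj d" "cnj a = cnj w * cnj c"
    using *[of 1] *[of "-1"] by (simp_all add: algebra_simps) algebra+
  have "cnj a * cnj d - cnj b * cnj c = 0"
    unfolding ba by (simp add: mult_ac)
  then have "cnj (a * d - b * c) = 0"
    by simp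
  with det show False
    by (simp only: complex_cnj_zero_iff)
qed

end

section \<open>An interior fixed point and the triangular form of the matrix\<close>

locale linfrac_interior_fixed_point = linfrac_fixed_point +
  assumes w1: "cmod w < 1"
begin

abbreviation s where "s \<equiv> 1 - (cmod w)\<^sup>2"

lemma s_pos: "s > 0"
  using w1 by (simp add: abs_square_less_1)

lemma s_mult_iff: "s * r < 0 \<longleftrightarrow> r < 0" "s * r \<le> 0 \<longleftrightarrow> r \<le> 0"
  using s_pos by (auto simp only: mult_less_0_iff mult_le_0_iff)

text \<open>The vectors \<open>(1, cnj w)\<close> and \<open>(w, 1)\<close> are orthogonal for the form
  \<open>\<bar>x\<bar>\<^sup>2 - \<bar>y\<bar>\<^sup>2\<close>, and the second is an eigenvector; in this basis the matrix is triangular.\<close>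

lemma form_\<phi>:
  "(cmod (a * (p + q * w) + b * (p * cnj w + q)))\<^sup>2 - (cmod (c * (p + q * w) + d * (p * cnj w + q)))\<^sup>2 =
    s * ((cmod (\<kappa> * p))\<^sup>2 - (cmod (\<gamma> * p + \<mu> * q))\<^sup>2)"
proof -
  have 1: "a * (p + q * w) + b * (p * cnj w + q) = \<kappa> * p + w * (\<gamma> * p + \<mu> * q)"
    unfolding b_eq \<kappa>_def \<gamma>_def \<mu>_def e_def by algebra
  have 2: "c * (p + q * w) + d * (p * cnj w + q) = cnj w * (\<kappa> * p) + (\<gamma> * p + \<mu> * q)"
    unfolding \<kappa>_def \<gamma>_def \<mu>_def e_def by algebra
  show ?thesis
    unfolding 1 2 by (rule cmod_square_mixture)
qed

lemma form_\<sigma>: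
  "(cmod (cnj a * (p + q * w) - cnj c * (p * cnj w + q)))\<^sup>2 -
    (cmod (cnj d * (p * cnj w + q) - cnj b * (p + q * w)))\<^sup>2 =
    s * ((cmod (cnj \<kappa> * p - cnj \<gamma> * q))\<^sup>2 - (cmod (cnj \<mu> * q))\<^sup>2)"
proof -
  have 1: "cnj a * (p + q * w) - cnj c * (p * cnj w + q) = (cnj \<kappa> * p - cnj \<gamma> * q) + w * (cnj \<mu> * q)"
    by (simp add: \<kappa>_def \<gamma>_def \<mu>_def e_def algebra_simps)
  have 2: "cnj d * (p * cnj w + q) - cnj b * (p + q * w) = cnj w * (cnj \<kappa> * p - cnj \<gamma> * q) + cnj \<mu> * q"
    unfolding cnj_b_eq by (simp add: \<kappa>_def \<gamma>_def \<mu>_def e_def algebra_simps)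
  show ?thesis
    unfolding 1 2 by (rule cmod_square_mixture)
qed

lemma coordinates:
  obtains p q where "x = p + q * w" "y = p * cnj w + q"
proof
  define n where "n = 1 - cnj w * w"
  have n: "n \<noteq> 0"
    using disk_involution_in_ball(2)[of w w] w1 by (simp add: n_def)
  have "(x - w * y) + (y - cnj w * x) * w = x * n" "(x - w * y) * cnj w + (y - cnj w * x) = y * n"
    by (simp_all add: n_def algebra_simps)
  then show "x = (x - w * y) / n + (y - cnj w * x) / n * w"
    "y = (x - w * y) / n * cnj w + (y - cnj w * x) / n"
    using n by (simp_all add: add_divide_distrib [symmetric])
qed

lemma cmod_le_iff: "cmod u \<le> cmod v \<longleftrightarrow> (cmod u)\<^sup>2 - (cmod v)\<^sup>2 \<le> 0" for u v :: complex
  by (simp add: power2_le_iff_abs_le flip: abs_le_square_iff)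

lemma cmod_less_iff: "cmod u < cmod v \<longleftrightarrow> (cmod u)\<^sup>2 - (cmod v)\<^sup>2 < 0" for u v :: complex
  using cmod_le_iff[of v u] by linarith

text \<open>This is \<open>\<phi>\<close> conjugated by the automorphism z -> (z + w) / (1 + cnj w
  z), which carries 0 to w.\<close>

lemma conjugate_selfmap: "linfrac_selfmap \<kappa> 0 \<gamma> \<mu>"
proof
  show "\<kappa> * \<mu> - 0 * \<gamma> \<noteq> 0"
    using \<kappa>_nonzero \<mu>_nonzero by simp
  fix z assume z: "cmod z < 1"
  define x y where "x = z + 1 * w" and "y = z * cnj w + 1"
  have "(cmod x)\<^sup>2 - (cmod y)\<^sup>2 = s * ((cmod z)\<^sup>2 - 1)"
    using cmod_square_mixture[of z w 1] by (simp add: x_def y_def mult.commute)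
  also have "\<dots> < 0"
    using s_pos z by (simp add: mult_pos_neg abs_square_less_1)
  finally have xy: "cmod x < cmod y"
    by (simp add: cmod_less_iff)
  then have y: "y \<noteq> 0"
    by auto
  have "cmod (a * (x / y) + b) < cmod (c * (x / y) + d)"
    using xy y by (intro self) (simp add: norm_divide divide_less_eq)
  then have "cmod (a * (x / y) + b) * cmod y < cmod (c * (x / y) + d) * cmod y"
    using y by simp
  then have "cmod (a * x + b * y) < cmod (c * x + d * y)"
    using y by (simp add: norm_mult [symmetric] distrib_right)
  then have "s * ((cmod (\<kappa> * z))\<^sup>2 - (cmod (\<gamma> * z + \<mu> * 1))\<^sup>2) < 0"
    unfolding form_\<phi> [symmetric] by (simp only: cmod_less_iff x_def y_def)
  then show "cmod (\<kappa> * z + 0) < cmod (\<gamma> * z + \<mu>)"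
    unfolding cmod_less_iff s_mult_iff by simp
qed

lemma \<gamma>_less_\<mu>: "cmod \<gamma> < cmod \<mu>"
  using linfrac_selfmap.c_less_d[OF conjugate_selfmap] .

lemma \<kappa>_plus_\<gamma>_le_\<mu>: "cmod \<kappa> + cmod \<gamma> \<le> cmod \<mu>"
proof -
  have "cmod \<kappa> \<le> \<bar>cmod \<mu> - cmod \<gamma>\<bar>"
  proof (rule affine_min_on_circle)
    show "cmod \<kappa> \<le> cmod (\<gamma> * z + \<mu>)" if "cmod z = 1" for z
      using linfrac_selfmap.self_closed[OF conjugate_selfmap, of z] that by (simp add: norm_mult)
  qed
  with \<gamma>_less_\<mu> show ?thesis
    by simp
qed

text \<open>Relates the triangular form to the second fixed point: |\<open>\<gamma>\<close>| =
  |\<open>\<mu>\<close> - \<open>\<kappa>\<close>| means |c| = |e|, which for c \<noteq> 0 puts -e /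
  c on the circle.\<close>

lemma \<gamma>_square: "(cmod \<gamma>)\<^sup>2 - (cmod (\<mu> - \<kappa>))\<^sup>2 = s * ((cmod c)\<^sup>2 - (cmod e)\<^sup>2)"
  using cmod_square_mixture[of c "cnj w" e] unfolding \<gamma>_def \<mu>_minus_\<kappa> by (simp add: mult.commute)

text \<open>The matrix is diagonal in an orthogonal basis for the form, so both pullbacks are the
  same multiple of |\<open>\<kappa>\<close> p|^2 - |\<open>\<mu>\<close> q|^2.\<close>

lemma posinormal_if_\<gamma>_zero:
  assumes "cmod b < cmod a" "\<gamma> = 0"
  shows "posinormal C\<^sub>\<phi>"
proof (rule posinormal_compositionI[OF assms(1)])
  fix x y assume lt: "cmod (cnj a * x - cnj c * y) < cmod (cnj d * y - cnj b * x)"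
  obtain p q where "x = p + q * w" "y = p * cnj w + q"
    by (rule coordinates)
  with lt show "cmod (a * x + b * y) < cmod (c * x + d * y)"
    using assms(2) by (simp only: cmod_less_iff form_\<phi> form_\<sigma> s_mult_iff) (simp add: norm_mult)
qed

lemma coposinormal_if_\<gamma>_zero:
  assumes "\<gamma> = 0"
  shows "coposinormal C\<^sub>\<phi>"
proof (rule coposinormal_compositionI)
  fix x y assume lt: "cmod (a * x + b * y) < cmod (c * x + d * y)"
  obtain p q where "x = p + q * w" "y = p * cnj w + q"
    by (rule coordinates)
  with lt show "cmod (cnj a * x - cnj c * y) < cmod (cnj d * y - cnj b * x)"
    using assms by (simp only: cmod_less_iff form_\<phi> form_\<sigma> s_mult_iff) (simp add: norm_mult)
qed

text \<open>\<open>A\<close>, \<open>B\<close>, \<open>C\<close>, \<open>D\<close> is the matrix of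
  \<open>\<sigma>\<close> after the inverse of \<open>\<phi>\<close> in the coordinates (p, q). Its
  determinant has modulus |\<open>\<kappa>\<close> \<open>\<mu>\<close>|^2, and Schwarz-Pick bounds
  this by |\<open>\<kappa>\<close>|^2 (|\<open>\<mu>\<close>|^2 -
  |\<open>\<gamma>\<close>|^2).\<close>

lemma coposinormal_imp_\<gamma>_zero:
  assumes "coposinormal C\<^sub>\<phi>"
  shows "\<gamma> = 0"
proof -
  have Y: "cmod (cnj \<kappa> * p - cnj \<gamma> * q) \<le> cmod (cnj \<mu> * q)"
    if "cmod (\<kappa> * p) \<le> cmod (\<gamma> * p + \<mu> * q)" for p q
  proof -
    have "cmod (a * (p + q * w) + b * (p * cnj w + q)) \<le> cmod (c * (p + q * w) + d * (p * cnj w + q))"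
      using that by (simp only: cmod_le_iff form_\<phi> s_mult_iff)
    from coposinormal_compositionD[OF assms this] show ?thesis
      by (simp only: cmod_le_iff form_\<sigma> s_mult_iff)
  qed
  define A B C D where "A = cnj \<kappa> * \<mu> + \<gamma> * cnj \<gamma>" and "B = - (cnj \<gamma> * \<kappa>)"
    and "C = - (cnj \<mu> * \<gamma>)" and "D = cnj \<mu> * \<kappa>"
  have det': "A * D - B * C = (\<kappa> * \<mu>) * cnj (\<kappa> * \<mu>)"
    by (simp add: A_def B_def C_def D_def algebra_simps)
  have "cmod (A * D - B * C) + cmod (cnj D * C - cnj B * A) \<le> (cmod D)\<^sup>2 - (cmod B)\<^sup>2"
  proof (rule linfrac_schwarz_pick)
    show "A * D - B * C \<noteq> 0"
      unfolding det' using \<kappa>_nonzero \<mu>_nonzero by simp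
    fix z assume z: "cmod z \<le> 1"
    have "\<gamma> * (\<mu> * z) + \<mu> * (\<kappa> - \<gamma> * z) = \<mu> * \<kappa>"
      by algebra
    then have "cmod (\<kappa> * (\<mu> * z)) \<le> cmod (\<gamma> * (\<mu> * z) + \<mu> * (\<kappa> - \<gamma> * z))"
      using mult_left_mono[OF z, of "cmod \<kappa> * cmod \<mu>"] by (simp add: norm_mult mult_ac)
    from Y[OF this] show "cmod (A * z + B) \<le> cmod (C * z + D)"
      by (simp add: A_def B_def C_def D_def algebra_simps)
  qed
  moreover have "cmod (A * D - B * C) = (cmod \<kappa> * cmod \<mu>)\<^sup>2"
    unfolding det' by (simp add: norm_mult power2_eq_square mult_ac)
  ultimately have "(cmod \<kappa> * cmod \<mu>)\<^sup>2 \<le> (cmod D)\<^sup>2 - (cmod B)\<^sup>2"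
    using norm_ge_zero[of "cnj D * C - cnj B * A"] by linarith
  then have "(cmod \<gamma> * cmod \<kappa>)\<^sup>2 \<le> 0"
    by (simp add: B_def D_def norm_mult mult.commute)
  then show ?thesis
    using \<kappa>_nonzero by simp
qed

text \<open>Schwarz-Pick for \<open>\<phi>\<close> after the inverse of \<open>\<sigma>\<close>, in
  the coordinates (p, q), gives |\<open>\<mu>\<close> - \<open>\<kappa>\<close>| \<le>
  |\<open>\<gamma>\<close>|. The reverse inequality is |\<open>\<kappa>\<close>| +
  |\<open>\<gamma>\<close>| \<le> |\<open>\<mu>\<close>|, which holds for every selfmap of this
  form.\<close>

lemma posinormal_imp:
  assumes "posinormal C\<^sub>\<phi>" and \<gamma>: "\<gamma> \<noteq> 0"
  shows "cmod (\<mu> - \<kappa>) = cmod \<gamma>"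
proof -
  have X: "cmod (\<kappa> * p) \<le> cmod (\<gamma> * p + \<mu> * q)"
    if "cmod (cnj \<kappa> * p - cnj \<gamma> * q) \<le> cmod (cnj \<mu> * q)" for p q
  proof -
    have "cmod (cnj a * (p + q * w) - cnj c * (p * cnj w + q)) \<le>
        cmod (cnj d * (p * cnj w + q) - cnj b * (p + q * w))"
      using that by (simp only: cmod_le_iff form_\<sigma> s_mult_iff)
    from posinormal_compositionD(2)[OF assms(1) this] show ?thesis
      by (simp only: cmod_le_iff form_\<phi> s_mult_iff)
  qed
  define A B C D where "A = \<kappa> * cnj \<mu>" and "B = \<kappa> * cnj \<gamma>"
    and "C = \<gamma> * cnj \<mu>" and "D = \<gamma> * cnj \<gamma> + \<mu> * cnj \<kappa>"
  define m r k x where "m = cmod \<mu>" and "r = cmod \<gamma>" and "k = cmod \<kappa>" and "x = Re (cnj \<mu> * \<kappa>)"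
  have pos: "m > 0" "r > 0" "k > 0"
    using \<mu>_nonzero \<gamma> \<kappa>_nonzero by (simp_all add: m_def r_def k_def)
  have det': "A * D - B * C = (\<kappa> * \<mu>) * cnj (\<kappa> * \<mu>)"
    by (simp add: A_def B_def C_def D_def algebra_simps)
  have sp: "cmod (A * D - B * C) + cmod (cnj D * C - cnj B * A) \<le> (cmod D)\<^sup>2 - (cmod B)\<^sup>2"
  proof (rule linfrac_schwarz_pick)
    show "A * D - B * C \<noteq> 0"
      unfolding det' using \<kappa>_nonzero \<mu>_nonzero by simp
    fix z assume z: "cmod z \<le> 1"
    have "cnj \<kappa> * (cnj \<mu> * z + cnj \<gamma>) - cnj \<gamma> * cnj \<kappa> = cnj \<kappa> * cnj \<mu> * z"
      by algebra
    then have "cmod (cnj \<kappa> * (cnj \<mu> * z + cnj \<gamma>) - cnj \<gamma> * cnj \<kappa>) \<le> cmod (cnj \<mu> * cnj \<kappa>)"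
      using mult_left_mono[OF z, of "cmod \<kappa> * cmod \<mu>"] by (simp add: norm_mult mult_ac)
    from X[OF this] show "cmod (A * z + B) \<le> cmod (C * z + D)"
      by (simp add: A_def B_def C_def D_def algebra_simps)
  qed
  have L: "cnj D * C - cnj B * A = \<gamma> * cnj \<mu> * (complex_of_real (r\<^sup>2 - k\<^sup>2) + cnj \<mu> * \<kappa>)"
    by (simp add: A_def B_def C_def D_def r_def k_def of_real_cmod_square algebra_simps)
  have D: "D = complex_of_real (r\<^sup>2) + cnj (cnj \<mu> * \<kappa>)"
    by (simp add: D_def r_def of_real_cmod_square)
  have mk: "(cmod (cnj \<mu> * \<kappa>))\<^sup>2 = (m * k)\<^sup>2"
    by (simp add: norm_mult m_def k_def)
  have shift: "(cmod (complex_of_real t + z))\<^sup>2 = t\<^sup>2 + 2 * t * Re z + (cmod z)\<^sup>2" for t z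
    unfolding cmod_power2 by (simp add: power2_eq_square algebra_simps)
  have D2: "(cmod D)\<^sup>2 = r ^ 4 + 2 * r\<^sup>2 * x + (m * k)\<^sup>2"
    unfolding D shift complex_mod_cnj mk by (simp add: x_def)
  have B2: "(cmod B)\<^sup>2 = (k * r)\<^sup>2"
    by (simp add: B_def norm_mult k_def r_def)
  define y where "y = r\<^sup>2 - k\<^sup>2 + 2 * x"
  have "cmod (A * D - B * C) = (m * k)\<^sup>2"
    unfolding det' by (simp add: norm_mult m_def k_def power2_eq_square mult_ac)
  with sp have "cmod (cnj D * C - cnj B * A) \<le> r\<^sup>2 * y"
    unfolding D2 B2 by (simp add: y_def power_mult_distrib algebra_simps power4_eq_xxxx power2_eq_square)
  then have "r * (m * cmod (complex_of_real (r\<^sup>2 - k\<^sup>2) + cnj \<mu> * \<kappa>)) \<le> r * (r * y)"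
    unfolding L by (simp add: norm_mult r_def m_def power2_eq_square mult_ac)
  then have le: "m * cmod (complex_of_real (r\<^sup>2 - k\<^sup>2) + cnj \<mu> * \<kappa>) \<le> r * y"
    using pos by simp
  then have ry: "0 \<le> r * y"
    using pos by (smt (verit) mult_nonneg_nonneg norm_ge_zero)
  then have y: "0 \<le> y"
    using pos by (simp add: zero_le_mult_iff)
  have "(m * cmod (complex_of_real (r\<^sup>2 - k\<^sup>2) + cnj \<mu> * \<kappa>))\<^sup>2 \<le> (r * y)\<^sup>2"
    using le pos by (intro power_mono) auto
  then have "m\<^sup>2 * ((r\<^sup>2 - k\<^sup>2) * y + (m * k)\<^sup>2) \<le> r\<^sup>2 * y\<^sup>2"
    unfolding power_mult_distrib[of m] shift mk x_def [symmetric]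
    by (simp add: y_def power_mult_distrib algebra_simps power2_eq_square)
  \<comment> \<open>The squared estimate factors; the second factor is positive, and m^2 \<le> y is
    the wanted inequality.\<close>
  then have "0 \<le> (y - m\<^sup>2) * (r\<^sup>2 * y + m\<^sup>2 * k\<^sup>2)"
    by (simp add: power_mult_distrib algebra_simps power2_eq_square)
  moreover have "0 < r\<^sup>2 * y + m\<^sup>2 * k\<^sup>2"
    using pos y by (intro add_nonneg_pos) auto
  ultimately have "m\<^sup>2 \<le> y"
    by (simp add: zero_le_mult_iff)
  moreover have "(cmod (\<mu> - \<kappa>))\<^sup>2 = m\<^sup>2 - 2 * x + k\<^sup>2"
    unfolding m_def k_def x_def cmod_power2 by (simp add: power2_eq_square algebra_simps)
  ultimately have "(cmod (\<mu> - \<kappa>))\<^sup>2 \<le> (cmod \<gamma>)\<^sup>2"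
    by (simp add: y_def r_def)
  then have "cmod (\<mu> - \<kappa>) \<le> cmod \<gamma>"
    by (rule power2_le_imp_le) simp
  moreover have "cmod \<mu> - cmod \<kappa> \<le> cmod (\<mu> - \<kappa>)"
    by (rule norm_triangle_ineq2)
  ultimately show ?thesis
    using \<kappa>_plus_\<gamma>_le_\<mu> by linarith
qed

lemma \<gamma>_nonzero_imp_c_nonzero: "cmod c = cmod e \<Longrightarrow> \<gamma> \<noteq> 0 \<Longrightarrow> c \<noteq> 0"
  by (auto simp: \<gamma>_def)

text \<open>The point \<open>disk_involution w \<zeta>\<close> has coordinates p =
  -\<open>\<zeta>\<close>, q = 1, on which the triangular matrix acts.\<close>

lemma \<phi>_disk_involution:
  assumes \<zeta>: "\<zeta> \<in> ball 0 1"
  shows "\<phi> (disk_involution w \<zeta>) =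
    (w * (\<mu> - \<gamma> * \<zeta>) - \<kappa> * \<zeta>) / ((\<mu> - \<gamma> * \<zeta>) - cnj w * \<kappa> * \<zeta>)"
    and "(\<mu> - \<gamma> * \<zeta>) - cnj w * \<kappa> * \<zeta> \<noteq> 0"
proof -
  have wb: "w \<in> ball 0 1"
    using w1 by simp
  note n = disk_involution_in_ball[OF wb \<zeta>]
  have 1: "a * (w - \<zeta>) + b * (1 - cnj w * \<zeta>) = w * (\<mu> - \<gamma> * \<zeta>) - \<kappa> * \<zeta>"
    "c * (w - \<zeta>) + d * (1 - cnj w * \<zeta>) = (\<mu> - \<gamma> * \<zeta>) - cnj w * \<kappa> * \<zeta>"
    unfolding b_eq \<kappa>_def \<gamma>_def \<mu>_def e_def by algebra+
  have "a * disk_involution w \<zeta> + b = (w * (\<mu> - \<gamma> * \<zeta>) - \<kappa> * \<zeta>) / (1 - cnj w * \<zeta>)"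
    "c * disk_involution w \<zeta> + d = ((\<mu> - \<gamma> * \<zeta>) - cnj w * \<kappa> * \<zeta>) / (1 - cnj w * \<zeta>)"
    unfolding 1 [symmetric] disk_involution_def using n(2) by (simp_all add: field_simps)
  moreover have "c * disk_involution w \<zeta> + d \<noteq> 0"
    using den_nonzero[of "disk_involution w \<zeta>"] n(1) by simp
  ultimately show "\<phi> (disk_involution w \<zeta>) =
      (w * (\<mu> - \<gamma> * \<zeta>) - \<kappa> * \<zeta>) / ((\<mu> - \<gamma> * \<zeta>) - cnj w * \<kappa> * \<zeta>)"
    "(\<mu> - \<gamma> * \<zeta>) - cnj w * \<kappa> * \<zeta> \<noteq> 0"
    using n(2) by (auto simp: linfrac_def)
qed

lemma \<phi>_conjugate_to_dilation:
  assumes "\<gamma> = 0" and z: "z \<in> ball 0 1"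
  shows "\<phi> z = disk_involution w (\<kappa> / \<mu> * disk_involution w z)"
proof -
  have wb: "w \<in> ball 0 1"
    using w1 by simp
  note n = disk_involution_in_ball(1)[OF wb z]
  define \<zeta> where "\<zeta> = disk_involution w z"
  have "\<phi> z = (w * \<mu> - \<kappa> * \<zeta>) / (\<mu> - cnj w * \<kappa> * \<zeta>)"
    using \<phi>_disk_involution(1)[OF n] assms(1) by (simp add: disk_involution_involution[OF wb z] \<zeta>_def)
  also have "w * \<mu> - \<kappa> * \<zeta> = \<mu> * (w - \<kappa> / \<mu> * \<zeta>)"
    using \<mu>_nonzero by (simp add: field_simps)
  also have "\<mu> - cnj w * \<kappa> * \<zeta> = \<mu> * (1 - cnj w * (\<kappa> / \<mu> * \<zeta>))"
    using \<mu>_nonzero by (simp add: field_simps)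
  finally show ?thesis
    unfolding disk_involution_def[of w "\<kappa> / \<mu> * _"] \<zeta>_def [symmetric] using \<mu>_nonzero by simp
qed

lemma conjugate_to_dilation_imp_\<gamma>_zero:
  assumes "\<And>z. z \<in> ball 0 1 \<Longrightarrow> \<phi> z = disk_involution w (\<alpha> * disk_involution w z)"
    and \<alpha>: "cmod \<alpha> < 1"
  shows "\<gamma> = 0"
proof -
  have wb: "w \<in> ball 0 1"
    using w1 by simp
  have "\<kappa> = \<alpha> * (\<mu> - \<gamma> * \<zeta>)" if \<zeta>: "\<zeta> \<in> ball 0 1" "\<zeta> \<noteq> 0" for \<zeta>
  proof -
    have "cmod (\<alpha> * \<zeta>) < 1"
      using \<zeta>(1) \<alpha> mult_strict_mono'[of "cmod \<alpha>" 1 "cmod \<zeta>" 1] by (simp add: norm_mult)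
    then have n: "1 - cnj w * (\<alpha> * \<zeta>) \<noteq> 0"
      using disk_involution_in_ball(2)[OF wb, of "\<alpha> * \<zeta>"] by simp
    define N where "N = \<mu> - \<gamma> * \<zeta>"
    have "(w * N - \<kappa> * \<zeta>) / (N - cnj w * \<kappa> * \<zeta>) = (w - \<alpha> * \<zeta>) / (1 - cnj w * (\<alpha> * \<zeta>))"
      using assms(1)[OF disk_involution_in_ball(1)[OF wb \<zeta>(1)]] \<phi>_disk_involution(1)[OF \<zeta>(1)]
      by (simp add: N_def disk_involution_involution[OF wb \<zeta>(1)] disk_involution_def[of w "\<alpha> * \<zeta>"])
    then have "(w * N - \<kappa> * \<zeta>) * (1 - cnj w * (\<alpha> * \<zeta>)) = (w - \<alpha> * \<zeta>) * (N - cnj w * \<kappa> * \<zeta>)"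
      using n \<phi>_disk_involution(2)[OF \<zeta>(1)] by (simp add: N_def frac_eq_eq)
    then have "\<zeta> * (1 - cnj w * w) * (\<kappa> - \<alpha> * N) = 0"
      by algebra
    then show ?thesis
      using \<zeta>(2) disk_involution_in_ball(2)[OF wb wb] by (simp add: N_def)
  qed
  \<comment> \<open>Any two distinct nonzero points separate the coefficient of
    \<open>\<zeta>\<close> from the constant term.\<close>
  from this[of "1/2"] this[of "-1/2"] have 1: "\<kappa> = \<alpha> * (\<mu> - \<gamma> / 2)" "\<kappa> = \<alpha> * (\<mu> + \<gamma> / 2)"
    by (simp_all add: norm_divide)
  have "\<alpha> * \<gamma> = \<alpha> * (\<mu> + \<gamma> / 2) - \<alpha> * (\<mu> - \<gamma> / 2)"
    by (simp add: field_simps)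
  then have "\<alpha> * \<gamma> = 0"
    unfolding 1 [symmetric] by simp
  moreover have "\<alpha> \<noteq> 0"
    using 1 \<kappa>_nonzero by auto
  ultimately show ?thesis
    by simp
qed

text \<open>With q = 1 and |p| = 1 the form of the image vanishes, so (p + w) / (p cnj w + 1) is a
  circle point mapped to the circle; p = 1 and p = -1 give two distinct ones.\<close>

lemma automorphism_if_isometric:
  assumes "\<gamma> = 0" "cmod \<kappa> = cmod \<mu>"
  shows "disk_automorphism \<phi>"
proof (rule automorphism_if_two_boundary_points)
  have "w \<noteq> 1" "w \<noteq> - 1"
    using w1 by auto
  then have n': "1 + w \<noteq> 0" "1 - w \<noteq> 0"
    by (auto simp: add_eq_0_iff)
  then have "cnj (1 + w) \<noteq> 0" "cnj (1 - w) \<noteq> 0"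
    unfolding complex_cnj_zero_iff .
  then have n: "1 + cnj w \<noteq> 0" "1 - cnj w \<noteq> 0" "1 - cnj w * w \<noteq> 0"
    using w1 disk_involution_in_ball(2)[of w w] by simp_all
  show "cmod ((1 + w) / (1 + cnj w)) = 1" "cmod ((w - 1) / (1 - cnj w)) = 1"
    using n n' complex_mod_cnj[of "1 + w"] complex_mod_cnj[of "1 - w"]
    by (simp_all add: norm_divide norm_minus_commute[of w])
  show "(1 + w) / (1 + cnj w) \<noteq> (w - 1) / (1 - cnj w)"
  proof
    assume "(1 + w) / (1 + cnj w) = (w - 1) / (1 - cnj w)"
    then have "(1 + w) * (1 - cnj w) = (w - 1) * (1 + cnj w)"
      using n by (simp add: frac_eq_eq)
    then have "1 - cnj w * w = 0"
      by algebra
    with n show False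
      by simp
  qed
  have bd: "cmod (a * ((p + w) / (p * cnj w + 1)) + b) = cmod (c * ((p + w) / (p * cnj w + 1)) + d)"
    if p: "cmod p = 1" and y: "p * cnj w + 1 \<noteq> 0" for p
  proof -
    have "cmod (a * (p + w) + b * (p * cnj w + 1)) = cmod (c * (p + w) + d * (p * cnj w + 1))"
      using form_\<phi>[of p 1] assms p by (simp add: norm_mult)
    moreover have "a * ((p + w) / (p * cnj w + 1)) + b = (a * (p + w) + b * (p * cnj w + 1)) / (p * cnj w + 1)"
      "c * ((p + w) / (p * cnj w + 1)) + d = (c * (p + w) + d * (p * cnj w + 1)) / (p * cnj w + 1)"
      using y by (simp_all add: field_simps)
    ultimately show ?thesis
      by (simp add: norm_divide)
  qed
  show "cmod (a * ((1 + w) / (1 + cnj w)) + b) = cmod (c * ((1 + w) / (1 + cnj w)) + d)"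
    using bd[of 1] n by (simp add: add.commute)
  show "cmod (a * ((w - 1) / (1 - cnj w)) + b) = cmod (c * ((w - 1) / (1 - cnj w)) + d)"
    using bd[of "-1"] n by simp
qed

end

section \<open>Classification\<close>

lemma linear_fractional_selfmap_coeffs:
  assumes "linear_fractional_selfmap \<phi>" "\<not> \<phi> constant_on ball 0 1"
  obtains a b c d where "linfrac_selfmap a b c d" "\<phi> = linfrac a b c d"
proof -
  from assms(1) obtain a b c d where \<phi>: "\<And>z. \<phi> z = (a * z + b) / (c * z + d)"
    and den: "\<And>z. z \<in> ball 0 1 \<Longrightarrow> c * z + d \<noteq> 0" and self: "\<phi> ` ball 0 1 \<subseteq> ball 0 1"
    unfolding linear_fractional_selfmap_def by blast
  have "linfrac_selfmap a b c d"
  proof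
    show "a * d - b * c \<noteq> 0"
    proof
      assume "a * d - b * c = 0"
      then have "(a * z + b) * d = b * (c * z + d)" for z
        by algebra
      then have "\<phi> z = b / d" if "z \<in> ball 0 1" for z
        using den[OF that] den[of 0] by (simp add: \<phi> frac_eq_eq)
      then have "\<phi> constant_on ball 0 1"
        unfolding constant_on_def by blast
      with assms(2) show False
        by simp
    qed
    fix z :: complex assume "cmod z < 1"
    then have z: "z \<in> ball 0 1"
      by simp
    then have "\<phi> z \<in> ball 0 1" "c * z + d \<noteq> 0"
      using self den[OF z] by blast+
    then show "cmod (a * z + b) < cmod (c * z + d)"
      by (simp add: \<phi> norm_divide divide_less_eq)
  qed
  moreover have "\<phi> = linfrac a b c d"
    by (simp add: fun_eq_iff \<phi> linfrac_def)
  ultimately show ?thesis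
    using that by blast
qed

text \<open>The orbit of p is constant and the one-point set is compact.\<close>

lemma denjoy_wolff_point_unique_fixed_point:
  assumes "denjoy_wolff_point \<phi> w" "p \<in> ball 0 1" "\<phi> p = p"
  shows "p = w"
proof -
  have "uniform_limit {p} (\<lambda>n. \<phi> ^^ n) (\<lambda>_. w) sequentially"
    using assms(1,2) unfolding denjoy_wolff_point_def by (metis compact_sing empty_subsetI insert_subset)
  then have "(\<lambda>n. (\<phi> ^^ n) p) \<longlonglongrightarrow> w"
    by (rule tendsto_uniform_limitI) simp
  moreover have "(\<phi> ^^ n) p = p" for n
    by (induction n) (simp_all add: assms(3))
  ultimately show ?thesis
    by (simp add: LIMSEQ_const_iff)
qed

lemma (in linfrac_selfmap) zero_in_ball_iff:
  "(\<exists>\<beta>\<in>ball 0 1. linfrac a b c d \<beta> = 0) \<longleftrightarrow> cmod b < cmod a"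
proof
  assume "\<exists>\<beta>\<in>ball 0 1. linfrac a b c d \<beta> = 0"
  then obtain \<beta> where \<beta>: "\<beta> \<in> ball 0 1" "linfrac a b c d \<beta> = 0"
    by blast
  then have "a * \<beta> + b = 0"
    using den_nonzero[of \<beta>] by (simp add: linfrac_def)
  then have b: "b = - (a * \<beta>)"
    by (simp add: add_eq_0_iff)
  with det have "a \<noteq> 0"
    by auto
  then show "cmod b < cmod a"
    using \<beta>(1) by (simp add: b norm_mult)
next
  assume "cmod b < cmod a"
  then have "a \<noteq> 0" "- b / a \<in> ball 0 1"
    by (auto simp: norm_divide divide_less_eq)
  then show "\<exists>\<beta>\<in>ball 0 1. linfrac a b c d \<beta> = 0"
    by (intro bexI[of _ "- b / a"]) (simp_all add: linfrac_def)
qed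

section \<open>The second fixed point and the multiplier\<close>

context linfrac_fixed_point
begin

lemma \<phi>_fixed_iff: "cmod z \<le> 1 \<Longrightarrow> \<phi> z = z \<longleftrightarrow> z = w \<or> c * z + e = 0"
  using fixed_point_iff[of z] den_nonzero[of z] by (simp add: linfrac_def divide_eq_eq)

lemma deriv_at_fixed_point: "deriv \<phi> w = \<kappa> / \<mu>"
proof -
  have "(\<phi> has_field_derivative (a * d - b * c) / (c * w + d)\<^sup>2) (at w)"
    unfolding linfrac_def [abs_def] using den_nonzero[OF w]
    by (auto intro!: derivative_eq_intros simp: power2_eq_square algebra_simps)
  then show ?thesis
    using \<mu>_nonzero unfolding det_eq \<mu>_def [symmetric]
    by (simp add: DERIV_imp_deriv power2_eq_square)
qed

lemma c_le_e_if_unique: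
  assumes "cmod w = 1" "\<And>p. p \<in> ball 0 1 \<Longrightarrow> \<phi> p = p \<Longrightarrow> p = w"
  shows "cmod c \<le> cmod e"
proof (rule ccontr)
  assume lt: "\<not> cmod c \<le> cmod e"
  then have "c \<noteq> 0"
    by auto
  then have "cmod (- e / c) < 1" "c * (- e / c) + e = 0"
    using lt by (simp_all add: norm_divide divide_less_eq)
  then have "- e / c = w"
    using assms(2)[of "- e / c"] \<phi>_fixed_iff[of "- e / c"] by simp
  with \<open>cmod (- e / c) < 1\<close> assms(1) show False
    by (simp only: less_irrefl)
qed

text \<open>Either w is a double fixed point, and the eigenvalues coincide, or -e / c is a second
  fixed point on the circle, and two boundary points go to the circle.\<close>

lemma boundary_classification:
  assumes "cmod w = 1" "cmod c = cmod e"
  shows "disk_automorphism \<phi> \<or> deriv \<phi> w = 1"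
proof (cases "c * w + e = 0")
  case True
  then have "\<mu> = \<kappa>"
    using \<mu>_minus_\<kappa> by simp
  then show ?thesis
    using deriv_at_fixed_point \<mu>_nonzero by simp
next
  case False
  then have "c \<noteq> 0"
    using assms(2) by auto
  define q where "q = - e / c"
  have q: "cmod q = 1" "c * q + e = 0"
    using \<open>c \<noteq> 0\<close> assms(2) by (simp_all add: q_def norm_divide flip: assms(2))
  then have "a * q + b = q * (c * q + d)" "q \<noteq> w"
    using fixed_point_iff[of q] False by auto
  then have "disk_automorphism \<phi>"
    using q(1) assms(1) fixed
    by (intro automorphism_if_two_boundary_points[of w q]) (simp_all add: norm_mult)
  then show ?thesis
    by simp
qed

lemma e_le_c_if_deriv_one:
  assumes "cmod w = 1" "deriv \<phi> w = 1"
  shows "cmod e \<le> cmod c"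
proof -
  have "\<mu> = \<kappa>"
    using assms(2) \<mu>_nonzero by (simp add: deriv_at_fixed_point)
  then have "e = - (c * w)"
    using \<mu>_minus_\<kappa> by (simp add: eq_neg_iff_add_eq_0 add.commute)
  then show ?thesis
    using assms(1) by (simp add: norm_mult)
qed

end

context linfrac_interior_fixed_point
begin

lemma dilation_factor:
  assumes "\<gamma> = 0" "\<not> disk_automorphism \<phi>"
  shows "0 < cmod (\<kappa> / \<mu>)" "cmod (\<kappa> / \<mu>) < 1"
    "\<And>z. z \<in> ball 0 1 \<Longrightarrow> \<phi> z = disk_involution w (\<kappa> / \<mu> * disk_involution w z)"
proof -
  show "0 < cmod (\<kappa> / \<mu>)"
    using \<kappa>_nonzero \<mu>_nonzero by simp
  have "cmod \<kappa> \<le> cmod \<mu>"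
    using \<kappa>_plus_\<gamma>_le_\<mu> assms(1) by simp
  moreover have "cmod \<kappa> \<noteq> cmod \<mu>"
    using automorphism_if_isometric assms by blast
  ultimately show "cmod (\<kappa> / \<mu>) < 1"
    using \<mu>_nonzero by (simp add: norm_divide divide_less_eq)
qed (rule \<phi>_conjugate_to_dilation[OF assms(1)])

text \<open>The involution vanishes only at w, so a zero \<open>\<beta>\<close> satisfies
  \<open>\<alpha>\<close> \<open>disk_involution w \<beta>\<close> = w.\<close>

lemma zero_in_ball_iff_dilation:
  assumes \<phi>: "\<And>z. z \<in> ball 0 1 \<Longrightarrow> \<phi> z = disk_involution w (\<alpha> * disk_involution w z)"
    and \<alpha>: "cmod \<alpha> < 1" "\<alpha> \<noteq> 0"
  shows "cmod b < cmod a \<longleftrightarrow> cmod w < cmod \<alpha>"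
proof -
  have wb: "w \<in> ball 0 1"
    using w1 by simp
  show ?thesis
    unfolding zero_in_ball_iff [symmetric]
  proof
    assume "\<exists>\<beta>\<in>ball 0 1. \<phi> \<beta> = 0"
    then obtain \<beta> where \<beta>: "\<beta> \<in> ball 0 1" "\<phi> \<beta> = 0"
      by blast
    define \<zeta> where "\<zeta> = disk_involution w \<beta>"
    have \<zeta>: "cmod \<zeta> < 1"
      using disk_involution_in_ball(1)[OF wb \<beta>(1)] by (simp add: \<zeta>_def)
    have "cmod (\<alpha> * \<zeta>) < 1"
      using \<zeta> \<alpha>(1) mult_strict_mono'[of "cmod \<alpha>" 1 "cmod \<zeta>" 1] by (simp add: norm_mult)
    then have "1 - cnj w * (\<alpha> * \<zeta>) \<noteq> 0"
      using disk_involution_in_ball(2)[OF wb, of "\<alpha> * \<zeta>"] by simp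
    moreover have "disk_involution w (\<alpha> * \<zeta>) = 0"
      using \<phi>[OF \<beta>(1)] \<beta>(2) by (simp add: \<zeta>_def)
    ultimately have "w = \<alpha> * \<zeta>"
      by (simp add: disk_involution_def)
    then show "cmod w < cmod \<alpha>"
      using \<zeta> \<alpha>(2) by (simp add: norm_mult)
  next
    assume "cmod w < cmod \<alpha>"
    then have wa: "w / \<alpha> \<in> ball 0 1"
      using \<alpha>(2) by (simp add: norm_divide divide_less_eq)
    have "\<phi> (disk_involution w (w / \<alpha>)) = disk_involution w w"
      using \<phi>[OF disk_involution_in_ball(1)[OF wb wa]] disk_involution_involution[OF wb wa] \<alpha>(2)
      by simp
    also have "\<dots> = 0"
      by (simp add: disk_involution_def)
    finally show "\<exists>\<beta>\<in>ball 0 1. \<phi> \<beta> = 0"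
      using disk_involution_in_ball(1)[OF wb wa] by blast
  qed
qed

end

theorem theorem1p6:
  fixes \<phi> :: "complex \<Rightarrow> complex" and w :: complex
  assumes "linear_fractional_selfmap \<phi>"
    and "\<not> \<phi> constant_on ball 0 1"
    and "denjoy_wolff_point \<phi> w"
  shows "(posinormal (composition_operator \<phi>) \<longleftrightarrow>
      disk_automorphism \<phi> \<or>
      (w \<in> ball 0 1 \<and>
        (\<exists>\<alpha>. cmod \<alpha> < 1 \<and> cmod w < cmod \<alpha> \<and>
          (\<forall>z\<in>ball 0 1. \<phi> z = disk_involution w (\<alpha> * disk_involution w z)))) \<or>
      (cmod w = 1 \<and> deriv \<phi> w = 1 \<and> (\<exists>\<beta>\<in>ball 0 1. \<phi> \<beta> = 0)) \<or>
      ((\<exists>p\<in>ball 0 1. \<phi> p = p) \<and> (\<exists>q\<in>sphere 0 1. \<phi> q = q) \<and> (\<exists>\<beta>\<in>ball 0 1. \<phi> \<beta> = 0)))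
    \<and> (coposinormal (composition_operator \<phi>) \<longleftrightarrow>
      disk_automorphism \<phi> \<or>
      w \<in> sphere 0 1 \<or>
      (w \<in> ball 0 1 \<and>
        (\<exists>\<alpha>. 0 < cmod \<alpha> \<and> cmod \<alpha> < 1 \<and>
          (\<forall>z\<in>ball 0 1. \<phi> z = disk_involution w (\<alpha> * disk_involution w z)))))
    \<and> (disk_automorphism \<phi> \<longrightarrow> invertible_operator (composition_operator \<phi>))"
proof -
  obtain a b c d where sm: "linfrac_selfmap a b c d" and \<phi>_eq: "\<phi> = linfrac a b c d"
    by (rule linear_fractional_selfmap_coeffs[OF assms(1,2)])
  let ?f = "linfrac a b c d"
  from sm interpret linfrac_composition a b c d
    by (rule linfrac_selfmap.linfrac_composition)
  have wle: "cmod w \<le> 1" and fw: "?f w = w"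
    using assms(3) by (simp_all add: denjoy_wolff_point_def \<phi>_eq)
  have uniq: "\<And>p. p \<in> ball 0 1 \<Longrightarrow> ?f p = p \<Longrightarrow> p = w"
    using denjoy_wolff_point_unique_fixed_point[OF assms(3)] by (simp add: \<phi>_eq)
  have "a * w + b = w * (c * w + d)"
    using fw den_nonzero[OF wle] by (simp add: linfrac_def divide_eq_eq)
  then interpret linfrac_fixed_point a b c d w
    using wle by unfold_locales
  have aut: "posinormal C\<^sub>\<phi>" "coposinormal C\<^sub>\<phi>" if "disk_automorphism ?f"
    using invertible_imp_posinormal[OF automorphism_invertible[OF that]] .
  note zero = zero_in_ball_iff
  consider (interior) "cmod w < 1" | (boundary) "cmod w = 1"
    using wle by linarith
  then show ?thesis
  proof cases
    case boundary
    have ce: "cmod c \<le> cmod e"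
      using c_le_e_if_unique[OF boundary uniq] .
    have "disk_automorphism ?f \<or> (deriv ?f w = 1 \<and> (\<exists>\<beta>\<in>ball 0 1. ?f \<beta> = 0))" if "posinormal C\<^sub>\<phi>"
    proof -
      have "cmod c = cmod e"
        using ce posinormal_boundary[OF that boundary] by simp
      then show ?thesis
        using boundary_classification[OF boundary] posinormal_compositionD(1)[OF that] zero by blast
    qed
    moreover have "posinormal C\<^sub>\<phi>" if "deriv ?f w = 1" "\<exists>\<beta>\<in>ball 0 1. ?f \<beta> = 0"
      using posinormal_if_c_ge_e e_le_c_if_deriv_one[OF boundary that(1)] that(2) zero by blast
    moreover have "coposinormal C\<^sub>\<phi>"
      by (rule coposinormal_if_c_le_e[OF boundary ce])
    \<comment> \<open>A fixed point in the disk would equal w, so the alternative with one interior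
      and one boundary fixed point cannot occur.\<close>
    moreover have "\<not> (\<exists>p\<in>ball 0 1. ?f p = p)" "w \<notin> ball 0 1" "w \<in> sphere 0 1"
      using uniq boundary by force+
    ultimately show ?thesis
      unfolding \<phi>_eq using aut automorphism_invertible boundary by blast
  next
    case interior
    interpret linfrac_interior_fixed_point a b c d w
      by unfold_locales (rule interior)
    have "disk_automorphism ?f \<or>
        (\<exists>\<alpha>. cmod \<alpha> < 1 \<and> cmod w < cmod \<alpha> \<and>
          (\<forall>z\<in>ball 0 1. ?f z = disk_involution w (\<alpha> * disk_involution w z))) \<or>
        ((\<exists>q\<in>sphere 0 1. ?f q = q) \<and> (\<exists>\<beta>\<in>ball 0 1. ?f \<beta> = 0))"
      if pos: "posinormal C\<^sub>\<phi>"
    proof (cases "\<gamma> = 0")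
      case True
      show ?thesis
      proof (cases "disk_automorphism ?f")
        case False
        note dil = dilation_factor[OF True False]
        have "cmod w < cmod (\<kappa> / \<mu>)"
          using zero_in_ball_iff_dilation[OF dil(3,2)] dil(1) posinormal_compositionD(1)[OF pos] by simp
        with dil show ?thesis
          by blast
      qed simp
    next
      case False
      \<comment> \<open>This places the second fixed point on the circle.\<close>
      have "(cmod c)\<^sup>2 = (cmod e)\<^sup>2"
        using \<gamma>_square s_pos posinormal_imp[OF pos False] by simp
      then have ce: "cmod c = cmod e"
        by simp
      then have c: "c \<noteq> 0"
        using False \<gamma>_nonzero_imp_c_nonzero by blast
      then have "- e / c \<in> sphere 0 1" "?f (- e / c) = - e / c"
        using ce c \<phi>_fixed_iff[of "- e / c"] by (simp_all add: norm_divide flip: ce)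
      then show ?thesis
        using zero posinormal_compositionD(1)[OF pos] by blast
    qed
    moreover have "posinormal C\<^sub>\<phi>" if "cmod \<alpha> < 1" "cmod w < cmod \<alpha>"
      "\<forall>z\<in>ball 0 1. ?f z = disk_involution w (\<alpha> * disk_involution w z)" for \<alpha>
    proof -
      have "\<alpha> \<noteq> 0"
        using that(2) by auto
      then have "cmod b < cmod a"
        using zero_in_ball_iff_dilation[of \<alpha>] that by blast
      then show ?thesis
        using posinormal_if_\<gamma>_zero conjugate_to_dilation_imp_\<gamma>_zero[of \<alpha>] that by blast
    qed
    moreover have "posinormal C\<^sub>\<phi>" if q: "q \<in> sphere 0 1" "?f q = q" and "\<exists>\<beta>\<in>ball 0 1. ?f \<beta> = 0" for q
    proof (rule posinormal_if_c_ge_e)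
      \<comment> \<open>Since w is interior, q differs from w and is therefore the second fixed
        point.\<close>
      have "c * q + e = 0"
        using \<phi>_fixed_iff[of q] q interior by auto
      then have "e = - (c * q)"
        by (simp add: add_eq_0_iff)
      then show "cmod e \<le> cmod c"
        using q(1) by (simp add: norm_mult)
      show "cmod b < cmod a"
        using that(3) zero by blast
    qed
    moreover have "disk_automorphism ?f \<or> (\<exists>\<alpha>. 0 < cmod \<alpha> \<and> cmod \<alpha> < 1 \<and>
        (\<forall>z\<in>ball 0 1. ?f z = disk_involution w (\<alpha> * disk_involution w z)))" if "coposinormal C\<^sub>\<phi>"
      using dilation_factor[OF coposinormal_imp_\<gamma>_zero[OF that]] by blast
    moreover have "coposinormal C\<^sub>\<phi>" if "cmod \<alpha> < 1"
      "\<forall>z\<in>ball 0 1. ?f z = disk_involution w (\<alpha> * disk_involution w z)" for \<alpha>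
      using coposinormal_if_\<gamma>_zero conjugate_to_dilation_imp_\<gamma>_zero[of \<alpha>] that by blast
    moreover have "cmod w \<noteq> 1" "w \<in> ball 0 1" "w \<notin> sphere 0 1"
      using interior by auto
    moreover have "\<exists>p\<in>ball 0 1. ?f p = p"
      using fw \<open>w \<in> ball 0 1\<close> by blast
    ultimately show ?thesis
      unfolding \<phi>_eq using aut automorphism_invertible by metis
  qed
qed

end
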